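(* Let $d\geqslant4$ and $u\in\mathbb{R}^d$, $u\neq0$. The set $$E_u=\left\{\phi\in W_0^d\,:\,\exists\,0\leqslant s<t\leqslant1,\ \phi(t)-\phi(s)=u\right\}$$ is closed in $W_0^d$, and the support of the measure $\theta_u$ is included in $E_u$.
   Context: $W_0^d$ is the classical Wiener space of continuous functions $\omega:[0,1]\to\mathbb{R}^d$ with $\omega(0)=0$, with the topology of uniform convergence, its Borel $\sigma$-field $\mathcal{B}(W_0^d)$ and the Wiener measure $\mu$; $w(t)(\omega)=\omega(t)$ is the canonical $d$-dimensional Brownian motion. $\Delta_2=\{(s,t)\in[0,1]^2:s<t\}$ and $p^d_\varepsilon(z)=(2\pi\varepsilon)^{-d/2}\exp(-\|z\|^2/(2\varepsilon))$. Every $\eta\in L^2(\mu)$ has an Itô–Wiener expansion $\eta=\sum_{k\ge0}I_k(f_k)$, with $I_k(f_k)$ multiple Itô integrals of deterministic square-integrable kernels. For $\gamma\in\mathbb{R}$, $\mathbb{D}^{2,\gamma}$ is the completion of the space of finite sums $\eta=\sum_{k=0}^nI_k(f_k)$ for the norm $\|\eta\|_{2,\gamma}^2=\sum_k(k+1)^\gamma\,\mathbb{E}\,I_k(f_k)^2$. Put $\mathbb{D}^{2,+\infty}=\bigcap_{\alpha>0}\mathbb{D}^{2,\alpha}$, $\mathbb{D}^{2,-\infty}=\bigcup_{\alpha>0}\mathbb{D}^{2,-\alpha}$. $(\Phi,F)$ is the duality pairing of $\Phi\in\mathbb{D}^{2,-\infty}$ and $F\in\mathbb{D}^{2,+\infty}$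 extending $\mathbb{E}(\Phi F)$. For $d\geqslant4$, $u\neq0$, $\rho_2(u)=\lim_{\varepsilon\to0}\int_{\Delta_2}p^d_\varepsilon(w(t)-w(s)-u)\,ds\,dt$, the limit existing in $\mathbb{D}^{2,\gamma}$ for every $\gamma<(4-d)/2$. $\rho_2(u)$ is positive ($(\rho_2(u),F)\ge0$ whenever $F\in\mathbb{D}^{2,+\infty}$, $F\ge0$ $\mu$-a.e.), and $\theta_u$ is the unique finite positive measure on $(W_0^d,\mathcal{B}(W_0^d))$ with $(\rho_2(u),F)=\int F\,d\theta_u$ for all $F\in\mathbb{D}^{2,+\infty}$. In this integral $F$ is represented by a quasi-continuous version, i.e. a function $\widetilde F$ with $\widetilde F=F$ $\mu$-a.e. such that for all $r,\delta>0$ there is an open $O\subset W_0^d$ with $C_2^r(O)<\delta$ and $\widetilde F|_{W_0^d\setminus O}$ continuous, where $C_2^r(O)=\inf\{\|f\|_{2,r}^2:f\in\mathbb{D}^{2,r},\,f\geqslant\mathbf{1}_O\ \mu\text{-a.e.}\}$. The support of a finite Borel measure is the smallest closed set whose complement has measure zero. *)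

theory Defs
  imports "HOL-Probability.Probability"
begin

section \<open>The classical Wiener space\<close>

text \<open>
  Paths on the unit interval are extended by 0 to the whole real line, so that equality of
  elements of the type is equality of paths on the unit interval.
\<close>

typedef (overloaded) ('d::finite) wiener =
  "{\<omega> :: real \<Rightarrow> real ^ 'd. continuous_on {0..1} \<omega> \<and> \<omega> 0 = 0 \<and> (\<forall>t. t \<notin> {0..1} \<longrightarrow> \<omega> t = 0)}"
  morphisms path Wiener
  by (rule exI [of _ "\<lambda>_. 0"]) auto

lemma path_continuous: "continuous_on {0..1} (path \<omega>)"
  and path_0: "path \<omega> 0 = 0"
  and path_outside: "t \<notin> {0..1} \<Longrightarrow> path \<omega> t = 0"
  using path [of \<omega>] by auto

lemma wiener_eqI: "(\<And>t. t \<in> {0..1} \<Longrightarrow> path \<omega> t = path \<eta> t) \<Longrightarrow> \<omega> = \<eta>"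
  by (metis path_inject path_outside ext)

instantiation wiener :: (finite) metric_space
begin

definition dist_wiener :: "'a wiener \<Rightarrow> 'a wiener \<Rightarrow> real" where
  "dist_wiener \<omega> \<eta> = (SUP t\<in>{0..1}. dist (path \<omega> t) (path \<eta> t))"

definition uniformity_wiener :: "('a wiener \<times> 'a wiener) filter" where
  "uniformity_wiener = (INF e\<in>{0<..}. principal {(x, y). dist x y < e})"

definition open_wiener :: "'a wiener set \<Rightarrow> bool" where
  "open_wiener U \<longleftrightarrow> (\<forall>x\<in>U. \<forall>\<^sub>F (x', y) in uniformity. x' = x \<longrightarrow> y \<in> U)"

lemma bdd_above_dist_path: "bdd_above ((\<lambda>t. dist (path \<omega> t) (path \<eta> t)) ` {0..1})"
  by (intro bounded_imp_bdd_above compact_imp_bounded compact_continuous_image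
        continuous_intros path_continuous compact_Icc)

lemma dist_path_le: "t \<in> {0..1} \<Longrightarrow> dist (path \<omega> t) (path \<eta> t) \<le> dist \<omega> \<eta>"
  unfolding dist_wiener_def by (rule cSUP_upper [OF _ bdd_above_dist_path])

lemma dist_wiener_le:
  "(\<And>t. t \<in> {0..1} \<Longrightarrow> dist (path \<omega> t) (path \<eta> t) \<le> b) \<Longrightarrow> dist \<omega> \<eta> \<le> b"
  unfolding dist_wiener_def by (rule cSUP_least) auto

instance
proof
  fix x y z :: "'a wiener"
  show "dist x y = 0 \<longleftrightarrow> x = y"
  proof
    assume 0: "dist x y = 0"
    show "x = y"
      by (rule wiener_eqI) (use dist_path_le [of _ x y] 0 in auto)
  next
    assume "x = y" then show "dist x y = 0" by (simp add: dist_wiener_def)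
  qed
  show "dist x y \<le> dist x z + dist y z"
  proof (rule dist_wiener_le)
    fix t :: real assume "t \<in> {0..1}"
    then show "dist (path x t) (path y t) \<le> dist x z + dist y z"
      using dist_path_le [of t x z] dist_path_le [of t y z]
        dist_triangle2 [of "path x t" "path y t" "path z t"] by linarith
  qed
qed (simp_all add: uniformity_wiener_def open_wiener_def)

end

lemma wiener_separable:
  "\<exists>D :: ('d::finite) wiener set. countable D \<and> (\<forall>\<omega>. \<forall>e>0. \<exists>\<eta>\<in>D. dist \<omega> \<eta> < e)"
proof -
  obtain D0 :: "(real ^ 'd) set" where D0: "countable D0"
    and dense: "\<And>X. open X \<Longrightarrow> X \<noteq> {} \<Longrightarrow> \<exists>d\<in>D0. d \<in> X"
    by (rule countable_dense_setE) blast
  define P :: "nat \<times> nat \<times> (real ^ 'd) list \<Rightarrow> 'd wiener \<Rightarrow> bool" where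
    "P = (\<lambda>(m, n, xs) \<omega>. (\<forall>i\<le>n. dist (path \<omega> (real i / real n)) (xs ! i) < 1 / real m) \<and>
      (\<forall>s\<in>{0..1}. \<forall>t\<in>{0..1}. \<bar>s - t\<bar> \<le> 1 / real n \<longrightarrow> dist (path \<omega> s) (path \<omega> t) < 1 / real m))"
  define D where "D = (\<lambda>p. SOME \<omega>. P p \<omega>) ` (UNIV \<times> UNIV \<times> lists D0)"
  have "countable D"
    unfolding D_def by (intro countable_image countable_SIGMA countable_lists D0) auto
  moreover have "\<exists>\<eta>\<in>D. dist \<omega> \<eta> < e" if e: "e > 0" for \<omega> :: "'d wiener" and e :: real
  proof -
    obtain m :: nat where m: "m > 0" "8 / real m < e"
      using reals_Archimedean2 [of "8 / e"] e
      by (metis divide_less_eq gr0I mult.commute of_nat_0 of_nat_0_less_iff pos_divide_less_eq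
          not_less_iff_gr_or_eq zero_less_divide_iff zero_less_numeral)
    have "uniformly_continuous_on {0..1} (path \<omega>)"
      by (simp add: compact_uniformly_continuous path_continuous)
    then obtain d where d: "d > 0"
      "\<And>s t. s \<in> {0..1} \<Longrightarrow> t \<in> {0..1} \<Longrightarrow> dist t s < d \<Longrightarrow> dist (path \<omega> t) (path \<omega> s) < 1 / real m"
      unfolding uniformly_continuous_on_def using m(1) by (metis of_nat_0_less_iff zero_less_divide_1_iff)
    obtain n :: nat where n: "n > 0" "1 / real n < d"
      using nat_approx_posE [OF d(1)] by (metis of_nat_Suc zero_less_Suc)
    have "\<forall>i. \<exists>x\<in>D0. dist (path \<omega> (real i / real n)) x < 1 / real m"
      using dense [of "ball _ (1 / real m)"] m(1) by (metis centre_in_ball empty_iff mem_ball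
          of_nat_0_less_iff open_ball zero_less_divide_1_iff)
    then obtain x where x: "\<And>i. x i \<in> D0" "\<And>i. dist (path \<omega> (real i / real n)) (x i) < 1 / real m"
      by metis
    define xs where "xs = map x [0..<Suc n]"
    have xs: "xs ! i = x i" if "i \<le> n" for i
      using that unfolding xs_def by (simp only: nth_map_upt) (metis add_0 diff_zero le_imp_less_Suc nth_map_upt)
    have P: "P (m, n, xs) \<omega>"
      using x(2) d(2) n by (fastforce simp: P_def xs dist_real_def)
    define \<eta> where "\<eta> = (SOME \<omega>. P (m, n, xs) \<omega>)"
    have P': "P (m, n, xs) \<eta>" unfolding \<eta>_def using P by (rule someI)
    have "\<eta> \<in> D"
      unfolding D_def \<eta>_def using x(1) by (intro image_eqI [OF refl]) (auto simp: xs_def)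
    moreover have "dist \<omega> \<eta> \<le> 4 / real m"
    proof (rule dist_wiener_le)
      fix t :: real assume t: "t \<in> {0..1}"
      define i where "i = nat \<lfloor>real n * t\<rfloor>"
      have i: "real i \<le> real n * t" "real n * t < real i + 1"
        using t by (auto simp: i_def)
      have "real n * t \<le> real n" using t by (simp add: mult_left_le)
      with i have "i \<le> n" by linarith
      define s where "s = real i / real n"
      have s: "s \<in> {0..1}" using \<open>i \<le> n\<close> n by (auto simp: s_def)
      have ts: "t - s = (real n * t - real i) / real n" using n by (simp add: s_def field_simps)
      have "\<bar>t - s\<bar> \<le> 1 / real n"
        unfolding ts using i n by (simp add: abs_divide divide_right_mono)
      then have "\<bar>t - s\<bar> \<le> 1 / real n" "\<bar>s - t\<bar> \<le> 1 / real n"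
        by (simp_all add: abs_minus_commute)
      then have "dist (path \<omega> t) (path \<omega> s) < 1 / real m" "dist (path \<eta> s) (path \<eta> t) < 1 / real m"
        using P P' s t by (auto simp: P_def)
      moreover have "dist (path \<omega> s) (xs ! i) < 1 / real m" "dist (path \<eta> s) (xs ! i) < 1 / real m"
        using P P' \<open>i \<le> n\<close> by (auto simp: P_def s_def)
      ultimately have "dist (path \<omega> t) (path \<eta> t) \<le> 1 / real m + 1 / real m + 1 / real m + 1 / real m"
        using dist_triangle [of "path \<omega> t" "path \<eta> t" "path \<omega> s"]
          dist_triangle [of "path \<omega> s" "path \<eta> t" "path \<eta> s"]
          dist_triangle2 [of "path \<omega> s" "path \<eta> s" "xs ! i"] by linarith
      then show "dist (path \<omega> t) (path \<eta> t) \<le> 4 / real m" by simp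
    qed
    moreover have "4 / real m < e"
    proof -
      have "4 / real m \<le> 8 / real m" by (simp add: divide_right_mono)
      with m(2) show ?thesis by linarith
    qed
    ultimately show ?thesis by (meson le_less_trans)
  qed
  ultimately show ?thesis by blast
qed

instance wiener :: (finite) second_countable_topology
proof
  obtain D :: "'a wiener set" where D: "countable D" "\<And>\<omega> e. e > 0 \<Longrightarrow> \<exists>\<eta>\<in>D. dist \<omega> \<eta> < e"
    using wiener_separable by blast
  define B where "B = (\<lambda>(\<eta>, n). ball \<eta> (1 / real (Suc n))) ` (D \<times> UNIV)"
  have "topological_basis B"
  proof (rule topological_basisI)
    fix U :: "'a wiener set" and \<omega> assume "open U" "\<omega> \<in> U"
    then obtain e where e: "e > 0" "ball \<omega> e \<subseteq> U" by (metis open_contains_ball)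
    obtain n where n: "1 / real (Suc n) < e / 2" using e(1) nat_approx_posE half_gt_zero by blast
    obtain \<eta> where \<eta>: "\<eta> \<in> D" "dist \<omega> \<eta> < 1 / real (Suc n)"
      using D(2) [of "1 / real (Suc n)" \<omega>] by auto
    have "ball \<eta> (1 / real (Suc n)) \<subseteq> ball \<omega> e"
    proof
      fix x assume "x \<in> ball \<eta> (1 / real (Suc n))"
      then have "dist \<eta> x < 1 / real (Suc n)" by simp
      with \<eta>(2) n have "dist \<omega> x < e" using dist_triangle [of \<omega> x \<eta>] by linarith
      then show "x \<in> ball \<omega> e" by simp
    qed
    moreover have "\<omega> \<in> ball \<eta> (1 / real (Suc n))" using \<eta>(2) by (simp only: mem_ball dist_commute)
    ultimately show "\<exists>B'\<in>B. \<omega> \<in> B' \<and> B' \<subseteq> U"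
      using \<eta>(1) e(2) unfolding B_def by (intro bexI [of _ "ball \<eta> (1 / real (Suc n))"]) auto
  qed (auto simp: B_def)
  moreover have "countable B" unfolding B_def using D(1) by (intro countable_image countable_SIGMA) auto
  ultimately show "\<exists>B :: 'a wiener set set. countable B \<and> open = generate_topology B"
    using topological_basis_imp_subbasis by blast
qed

definition measure_support :: "'a::topological_space measure \<Rightarrow> 'a set" where
  "measure_support \<nu> = \<Inter>{C. closed C \<and> emeasure \<nu> (- C) = 0}"

lemma measure_support_smallest:
  fixes \<nu> :: "'a::second_countable_topology measure"
  assumes "sets \<nu> = sets borel"
  shows "closed (measure_support \<nu>)"
    and "emeasure \<nu> (- measure_support \<nu>) = 0"
    and "closed C \<Longrightarrow> emeasure \<nu> (- C) = 0 \<Longrightarrow> measure_support \<nu> \<subseteq> C"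
proof -
  show "closed (measure_support \<nu>)" unfolding measure_support_def by (intro closed_Inter) auto
  let ?F = "uminus ` {C. closed C \<and> emeasure \<nu> (- C) = 0}"
  have "\<And>S. S \<in> ?F \<Longrightarrow> open S" by auto
  then obtain G where G: "G \<subseteq> ?F" "countable G" "\<Union>G = \<Union>?F" by (rule Lindelof)
  have "(\<Union>S\<in>G. S) \<in> null_sets \<nu>"
    by (rule null_sets_UN' [OF G(2)]) (use G(1) assms in \<open>auto intro!: null_setsI\<close>)
  then have "emeasure \<nu> (\<Union>G) = 0" by auto
  moreover have "- measure_support \<nu> = \<Union>G"
    unfolding G(3) measure_support_def by auto
  ultimately show "emeasure \<nu> (- measure_support \<nu>) = 0" by simp
  show "closed C \<Longrightarrow> emeasure \<nu> (- C) = 0 \<Longrightarrow> measure_support \<nu> \<subseteq> C"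
    unfolding measure_support_def by auto
qed

definition wiener_measure :: "('d::finite) wiener measure \<Rightarrow> bool" where
  "wiener_measure \<mu> \<longleftrightarrow> prob_space \<mu> \<and> sets \<mu> = sets borel \<and>
    (\<forall>(n::nat) (t :: nat \<Rightarrow> real). 0 \<le> t 0 \<and> (\<forall>i<n. t i < t (Suc i)) \<and> t n \<le> 1 \<longrightarrow>
      prob_space.indep_vars \<mu> (\<lambda>_. borel)
        (\<lambda>(i, c) \<omega>. (path \<omega> (t (Suc i)) - path \<omega> (t i)) $ c) ({..<n} \<times> (UNIV :: 'd set)) \<and>
      (\<forall>i<n. \<forall>c. distributed \<mu> lborel (\<lambda>\<omega>. (path \<omega> (t (Suc i)) - path \<omega> (t i)) $ c)
        (normal_density 0 (sqrt (t (Suc i) - t i)))))"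


section \<open>Multiple Ito integrals and the Ito-Wiener expansion\<close>

definition square_integrable :: "'a measure \<Rightarrow> ('a \<Rightarrow> real) \<Rightarrow> bool" where
  "square_integrable M f \<longleftrightarrow> f \<in> borel_measurable M \<and> integrable M (\<lambda>x. (f x)\<^sup>2)"

definition L2_tendsto :: "'a measure \<Rightarrow> (nat \<Rightarrow> 'a \<Rightarrow> real) \<Rightarrow> ('a \<Rightarrow> real) \<Rightarrow> bool" where
  "L2_tendsto M g f \<longleftrightarrow> (\<forall>n. square_integrable M (g n)) \<and> square_integrable M f \<and>
    (\<lambda>n. \<integral>x. (g n x - f x)\<^sup>2 \<partial>M) \<longlonglongrightarrow> 0"

text \<open>
  A kernel of order \<open>k\<close> for \<open>d\<close>-dimensional Brownian motion is a real function of \<open>k\<close> points of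
  \<open>[0,1] \<times> {1,\<dots>,d}\<close>: a point is a time together with the coordinate of the Brownian motion that is
  integrated against at that time.
\<close>

definition kernel_space :: "'d itself \<Rightarrow> nat \<Rightarrow> (nat \<Rightarrow> real \<times> 'd) measure" where
  "kernel_space _ k =
    (\<Pi>\<^sub>M i\<in>{..<k}. restrict_space lborel {0..1} \<Otimes>\<^sub>M count_space (UNIV :: 'd set))"

text \<open>
  The cell \<open>(s, t, c)\<close> stands for \<open>(s,t] \<times> {c}\<close>, whose Wiener integral is \<open>w\<^sup>c(t) - w\<^sup>c(s)\<close>.
  A list of weighted families of \<open>k\<close> pairwise disjoint cells stands for a
  step kernel vanishing on the diagonals.
\<close>

type_synonym 'd cell = "real \<times> real \<times> 'd"
type_synonym 'd step_kernel = "(real \<times> 'd cell list) list"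

fun cell_set :: "'d cell \<Rightarrow> (real \<times> 'd) set" where
  "cell_set (s, t, c) = {s<..t} \<times> {c}"

fun cell_incr :: "('d::finite) cell \<Rightarrow> 'd wiener \<Rightarrow> real" where
  "cell_incr (s, t, c) \<omega> = (path \<omega> t - path \<omega> s) $ c"

definition step_kernel :: "nat \<Rightarrow> 'd step_kernel \<Rightarrow> bool" where
  "step_kernel k S \<longleftrightarrow> (\<forall>(a, bs) \<in> set S. length bs = k \<and>
    (\<forall>(s, t, c) \<in> set bs. 0 \<le> s \<and> s < t \<and> t \<le> 1) \<and>
    (\<forall>i<k. \<forall>j<k. i \<noteq> j \<longrightarrow> cell_set (bs ! i) \<inter> cell_set (bs ! j) = {}))"

definition step_eval :: "'d step_kernel \<Rightarrow> (nat \<Rightarrow> real \<times> 'd) \<Rightarrow> real" where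
  "step_eval S x = (\<Sum>(a, bs)\<leftarrow>S. a * (\<Prod>i<length bs. indicator (cell_set (bs ! i)) (x i)))"

definition step_integral :: "('d::finite) step_kernel \<Rightarrow> 'd wiener \<Rightarrow> real" where
  "step_integral S \<omega> = (\<Sum>(a, bs)\<leftarrow>S. a * (\<Prod>i<length bs. cell_incr (bs ! i) \<omega>))"

text \<open>
  \<open>has_multiple_Ito_integral \<mu> k f X\<close> says \<open>X = I\<^sub>k(f)\<close> almost surely: the multiple integral is the
  extension by continuity in mean square of its values on step kernels vanishing on the diagonals.
\<close>

definition has_multiple_Ito_integral ::
    "('d::finite) wiener measure \<Rightarrow> nat \<Rightarrow> ((nat \<Rightarrow> real \<times> 'd) \<Rightarrow> real) \<Rightarrow> ('d wiener \<Rightarrow> real) \<Rightarrow> bool" where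
  "has_multiple_Ito_integral \<mu> k f X \<longleftrightarrow>
    (\<exists>S. (\<forall>n. step_kernel k (S n)) \<and>
      L2_tendsto (kernel_space TYPE('d) k) (\<lambda>n. step_eval (S n)) f \<and>
      L2_tendsto \<mu> (\<lambda>n. step_integral (S n)) X)"

definition chaos :: "('d::finite) wiener measure \<Rightarrow> nat \<Rightarrow> ('d wiener \<Rightarrow> real) set" where
  "chaos \<mu> k = {X. \<exists>f. has_multiple_Ito_integral \<mu> k f X}"

definition has_chaos_expansion ::
    "('d::finite) wiener measure \<Rightarrow> ('d wiener \<Rightarrow> real) \<Rightarrow> (nat \<Rightarrow> 'd wiener \<Rightarrow> real) \<Rightarrow> bool" where
  "has_chaos_expansion \<mu> \<eta> J \<longleftrightarrow> (\<forall>k. J k \<in> chaos \<mu> k) \<and>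
    L2_tendsto \<mu> (\<lambda>n \<omega>. \<Sum>k\<le>n. J k \<omega>) \<eta>"


section \<open>The spaces $\mathbb{D}^{2,\gamma}$\<close>

text \<open>
  Distinct chaoses are orthogonal, so the completion of the finite sums \<open>I\<^sub>0(f\<^sub>0) + \<dots> + I\<^sub>n(f\<^sub>n)\<close> for
  the norm of order \<open>\<gamma>\<close> is the weighted Hilbert sum of the chaoses. An element is therefore
  represented by its sequence of chaos components, for negative \<open>\<gamma>\<close> as well, when the series need
  not converge to a random variable. A square-integrable \<open>\<eta>\<close> is identified with any \<open>J\<close> such that
  \<open>has_chaos_expansion \<mu> \<eta> J\<close>; such a \<open>J\<close> is unique up to null sets.
\<close>

definition D2_norm :: "'a measure \<Rightarrow> real \<Rightarrow> (nat \<Rightarrow> 'a \<Rightarrow> real) \<Rightarrow> real" where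
  "D2_norm \<mu> \<gamma> \<Phi> = sqrt (\<Sum>k. real (k + 1) powr \<gamma> * (\<integral>\<omega>. (\<Phi> k \<omega>)\<^sup>2 \<partial>\<mu>))"

definition D2 :: "('d::finite) wiener measure \<Rightarrow> real \<Rightarrow> (nat \<Rightarrow> 'd wiener \<Rightarrow> real) set" where
  "D2 \<mu> \<gamma> = {\<Phi>. (\<forall>k. \<Phi> k \<in> chaos \<mu> k) \<and>
    summable (\<lambda>k. real (k + 1) powr \<gamma> * (\<integral>\<omega>. (\<Phi> k \<omega>)\<^sup>2 \<partial>\<mu>))}"

definition D2_plus_inf :: "('d::finite) wiener measure \<Rightarrow> (nat \<Rightarrow> 'd wiener \<Rightarrow> real) set" where
  "D2_plus_inf \<mu> = (\<Inter>\<alpha>\<in>{0<..}. D2 \<mu> \<alpha>)"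

definition D2_minus_inf :: "('d::finite) wiener measure \<Rightarrow> (nat \<Rightarrow> 'd wiener \<Rightarrow> real) set" where
  "D2_minus_inf \<mu> = (\<Union>\<alpha>\<in>{0<..}. D2 \<mu> (- \<alpha>))"

definition D2_tendsto ::
    "('d::finite) wiener measure \<Rightarrow> real \<Rightarrow> ('b \<Rightarrow> nat \<Rightarrow> 'd wiener \<Rightarrow> real) \<Rightarrow>
      (nat \<Rightarrow> 'd wiener \<Rightarrow> real) \<Rightarrow> 'b filter \<Rightarrow> bool" where
  "D2_tendsto \<mu> \<gamma> \<Psi> \<Phi> G \<longleftrightarrow> (\<forall>\<^sub>F x in G. \<Psi> x \<in> D2 \<mu> \<gamma>) \<and> \<Phi> \<in> D2 \<mu> \<gamma> \<and>
    ((\<lambda>x. D2_norm \<mu> \<gamma> (\<lambda>k \<omega>. \<Psi> x k \<omega> - \<Phi> k \<omega>)) \<longlongrightarrow> 0) G"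

text \<open>
  By orthogonality of the chaoses this is \<open>E(\<Phi> F)\<close> when \<open>\<Phi>\<close> and \<open>F\<close> are square-integrable.
\<close>

definition D2_pairing :: "'a measure \<Rightarrow> (nat \<Rightarrow> 'a \<Rightarrow> real) \<Rightarrow> (nat \<Rightarrow> 'a \<Rightarrow> real) \<Rightarrow> real" where
  "D2_pairing \<mu> \<Phi> F = (\<Sum>k. \<integral>\<omega>. \<Phi> k \<omega> * F k \<omega> \<partial>\<mu>)"


section \<open>Capacities and quasi-continuous versions\<close>

definition capacity :: "('d::finite) wiener measure \<Rightarrow> real \<Rightarrow> 'd wiener set \<Rightarrow> real" where
  "capacity \<mu> r U = Inf {(D2_norm \<mu> r J)\<^sup>2 | f J.
    has_chaos_expansion \<mu> f J \<and> J \<in> D2 \<mu> r \<and> (AE \<omega> in \<mu>. indicator U \<omega> \<le> f \<omega>)}"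

text \<open>
  Quasi-continuity determines a function only up to sets of capacity 0, on which it could fail to
  be measurable; Borel versions are required so that they can be integrated against Borel measures.
\<close>

definition quasi_continuous_version ::
    "('d::finite) wiener measure \<Rightarrow> ('d wiener \<Rightarrow> real) \<Rightarrow> ('d wiener \<Rightarrow> real) \<Rightarrow> bool" where
  "quasi_continuous_version \<mu> F F' \<longleftrightarrow> F' \<in> borel_measurable borel \<and> (AE \<omega> in \<mu>. F' \<omega> = F \<omega>) \<and>
    (\<forall>r>0. \<forall>\<delta>>0. \<exists>U. open U \<and> capacity \<mu> r U < \<delta> \<and> continuous_on (- U) F')"


section \<open>The functional $\rho_2(u)$ and the measure $\theta_u$\<close>

definition heat_kernel :: "real \<Rightarrow> real ^ 'd \<Rightarrow> real" where
  "heat_kernel \<epsilon> z = (2 * pi * \<epsilon>) powr (- real CARD('d) / 2) * exp (- (norm z)\<^sup>2 / (2 * \<epsilon>))"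

definition rho2_approx :: "real ^ 'd \<Rightarrow> real \<Rightarrow> ('d::finite) wiener \<Rightarrow> real" where
  "rho2_approx u \<epsilon> \<omega> =
    (LINT (s, t) : {(s, t). 0 \<le> s \<and> s < t \<and> t \<le> 1} | lborel.
      heat_kernel \<epsilon> (path \<omega> t - path \<omega> s - u))"

definition is_rho2 ::
    "('d::finite) wiener measure \<Rightarrow> real ^ 'd \<Rightarrow> (nat \<Rightarrow> 'd wiener \<Rightarrow> real) \<Rightarrow> bool" where
  "is_rho2 \<mu> u \<rho> \<longleftrightarrow> (\<exists>\<Psi>. (\<forall>\<epsilon>>0. has_chaos_expansion \<mu> (rho2_approx u \<epsilon>) (\<Psi> \<epsilon>)) \<and>
    (\<forall>\<gamma> < (4 - real CARD('d)) / 2. D2_tendsto \<mu> \<gamma> \<Psi> \<rho> (at_right 0)))"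

text \<open>
  Integration against \<open>\<theta>\<close> has to give the right value for every quasi-continuous version:
  with an arbitrary choice of one version for each \<open>F\<close>, the condition would not determine \<open>\<theta>\<close>,
  because versions may be modified freely on a set of capacity 0, e.g. at a single path.
\<close>

definition represents ::
    "('d::finite) wiener measure \<Rightarrow> (nat \<Rightarrow> 'd wiener \<Rightarrow> real) \<Rightarrow> 'd wiener measure \<Rightarrow> bool" where
  "represents \<mu> \<Phi> \<theta> \<longleftrightarrow> \<Phi> \<in> D2_minus_inf \<mu> \<and> finite_measure \<theta> \<and> sets \<theta> = sets borel \<and>
    (\<forall>F J F'. has_chaos_expansion \<mu> F J \<and> J \<in> D2_plus_inf \<mu> \<and> quasi_continuous_version \<mu> F F' \<longrightarrow>
      integrable \<theta> F' \<and> D2_pairing \<mu> \<Phi> J = (\<integral>\<omega>. F' \<omega> \<partial>\<theta>))"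

definition E_set :: "real ^ 'd \<Rightarrow> ('d::finite) wiener set" where
  "E_set u = {\<phi>. \<exists>s t. 0 \<le> s \<and> s < t \<and> t \<le> 1 \<and> path \<phi> t - path \<phi> s = u}"

end

theory Submission
  imports Defs
begin

text \<open>
  The measure \<open>\<theta>\<^sub>u\<close> is identified as a mixture of pinned Wiener measures,
  \<open>\<theta>\<^sub>u = \<integral> p\<^sub>t\<^sub>-\<^sub>s(u) \<mu>(w \<in> \<cdot> | w(t) - w(s) = u) ds dt\<close>, which is carried by \<open>E\<^sub>u\<close> by construction: under the
  conditional law the path is \<open>w\<close> corrected by an affine drift on \<open>[s,t]\<close>. Finite measures on Wiener space
  are determined by the integrals of \<open>F = cos (L + b)\<close>, where \<open>L\<close> is a linear combination of coordinates at
  dyadic times. Such an \<open>F\<close> is continuous, hence its own quasi-continuous version, and lies in \<open>D\<^sup>2\<^sup>,\<^sup>\<infinity>\<close>: if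
  \<open>\<xi>\<^sub>i\<close> are the increments over a dyadic grid, of variances \<open>v\<^sub>i\<close>, and \<open>L = \<Sum> a\<^sub>i \<xi>\<^sub>i\<close>, then the products
  \<open>\<Prod> (1 + \<i> a\<^sub>i \<xi>\<^sub>i)\<close> converge in \<open>L\<^sup>2\<close> to \<open>exp (\<i> L + (\<Sum> a\<^sub>i\<^sup>2 v\<^sub>i) / 2)\<close>, and their homogeneous parts are
  multiple integrals of step kernels whose norms decay geometrically in the order. Therefore \<open>\<integral> F d\<theta>\<^sub>u\<close> is
  the limit of \<open>E (F \<integral>\<integral> p\<^sub>\<epsilon>(w(t) - w(s) - u) ds dt)\<close>, which is computed from the independence of \<open>w(t) - w(s)\<close>
  and the bridge.
\<close>

section \<open>Square-integrable functions\<close>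

text \<open>Membership in a chaos is witnessed by step kernels that vanish on the diagonals and
  converge together with their integrals, so Hermite polynomials do not fit directly: powers of a
  single increment are diagonal terms. Keeping only square-free monomials in the increments of a
  fine grid makes every homogeneous part literally a step integral. Kernels and integrals are then
  shown to converge separately: the kernels pointwise under a constant bound, the integrals because
  distinct orders are orthogonal and the whole product converges. Cosines with a free phase replace
  exponentials since the functionals in \<open>D2\<close> are real. Independence of increment and
  bridge enters as a factorisation of characteristic functions. The hypothesis
  \<open>u \<noteq> 0\<close> bounds the heat kernel at u uniformly in time, which gives the mixture
  finite mass and dominates the limit near s = t; it also keeps the two times apart in the
  closedness of \<open>E_set u\<close>.\<close>

lemma square_integrableD:
  assumes "square_integrable M f"
  shows "f \<in> borel_measurable M" "integrable M (\<lambda>x. (f x)\<^sup>2)"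
  using assms by (auto simp: square_integrable_def)

lemma square_integrable_mult:
  assumes "square_integrable M f" "square_integrable M g"
  shows "integrable M (\<lambda>x. f x * g x)"
proof (rule Bochner_Integration.integrable_bound)
  note [measurable] = assms [THEN square_integrableD(1)]
  show "integrable M (\<lambda>x. (f x)\<^sup>2 + (g x)\<^sup>2)"
    using assms [THEN square_integrableD(2)] by simp
  show "(\<lambda>x. f x * g x) \<in> borel_measurable M" by measurable
  have "\<bar>a * b\<bar> \<le> a\<^sup>2 + b\<^sup>2" for a b :: real
    using sum_squares_bound [of "\<bar>a\<bar>" "\<bar>b\<bar>"] mult_nonneg_nonneg [of "\<bar>a\<bar>" "\<bar>b\<bar>"]
    unfolding abs_mult power2_abs by linarith
  then show "AE x in M. norm (f x * g x) \<le> norm ((f x)\<^sup>2 + (g x)\<^sup>2)" by simp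
qed

lemma square_integrable_cmult:
  assumes "square_integrable M f"
  shows "square_integrable M (\<lambda>x. c * f x)"
  using assms by (auto simp: square_integrable_def power_mult_distrib)

lemma square_integrable_add:
  assumes "square_integrable M f" "square_integrable M g"
  shows "square_integrable M (\<lambda>x. f x + g x)"
  using assms square_integrable_mult [OF assms]
  by (auto simp: square_integrable_def power2_sum mult.assoc)

lemma square_integrable_diff:
  assumes "square_integrable M f" "square_integrable M g"
  shows "square_integrable M (\<lambda>x. f x - g x)"
  using square_integrable_add [OF assms(1) square_integrable_cmult [OF assms(2), of "-1"]] by simp

lemma square_integrable_zero: "square_integrable M (\<lambda>_. 0)"
  by (simp add: square_integrable_def)

lemma square_integrable_sum:
  assumes "\<And>i. i \<in> I \<Longrightarrow> square_integrable M (f i)"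
  shows "square_integrable M (\<lambda>x. \<Sum>i\<in>I. f i x)"
  using assms
  by (induction I rule: infinite_finite_induct)
    (auto intro: square_integrable_add square_integrable_zero)

lemma (in finite_measure) square_integrable_bounded:
  assumes "f \<in> borel_measurable M" "\<And>x. \<bar>f x\<bar> \<le> B"
  shows "square_integrable M f"
  unfolding square_integrable_def
proof
  show "integrable M (\<lambda>x. (f x)\<^sup>2)"
  proof (rule integrable_const_bound)
    show "AE x in M. norm ((f x)\<^sup>2) \<le> B\<^sup>2"
      using assms(2) by (auto intro: abs_le_square_iff [THEN iffD1] order_trans [OF _ abs_ge_self])
  qed (use assms(1) in measurable)
qed fact

lemma Cauchy_Schwarz_square_integrable:
  assumes f: "square_integrable M f" and g: "square_integrable M g"
  shows "\<bar>\<integral>x. f x * g x \<partial>M\<bar> \<le> sqrt (\<integral>x. (f x)\<^sup>2 \<partial>M) * sqrt (\<integral>x. (g x)\<^sup>2 \<partial>M)"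
proof -
  note [measurable] = f [THEN square_integrableD(1)] g [THEN square_integrableD(1)]
  let ?F = "\<lambda>x. ennreal \<bar>f x\<bar>" and ?G = "\<lambda>x. ennreal \<bar>g x\<bar>"
  have "(\<integral>\<^sup>+x. ?F x * ?G x \<partial>M)\<^sup>2 \<le> (\<integral>\<^sup>+x. ?F x ^ 2 \<partial>M) * (\<integral>\<^sup>+x. ?G x ^ 2 \<partial>M)"
    by (rule Cauchy_Schwarz_nn_integral) auto
  moreover have "(\<integral>\<^sup>+x. ?F x * ?G x \<partial>M) = ennreal (\<integral>x. \<bar>f x * g x\<bar> \<partial>M)"
    using integrable_abs [OF square_integrable_mult [OF f g]]
    by (subst nn_integral_eq_integral [symmetric]) (auto simp: ennreal_mult abs_mult)
  moreover have "(\<integral>\<^sup>+x. ?F x ^ 2 \<partial>M) = ennreal (\<integral>x. (f x)\<^sup>2 \<partial>M)"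
    "(\<integral>\<^sup>+x. ?G x ^ 2 \<partial>M) = ennreal (\<integral>x. (g x)\<^sup>2 \<partial>M)"
    using f g by (auto simp: nn_integral_eq_integral [symmetric] square_integrable_def ennreal_power)
  ultimately have "(\<integral>x. \<bar>f x * g x\<bar> \<partial>M)\<^sup>2 \<le> (\<integral>x. (f x)\<^sup>2 \<partial>M) * (\<integral>x. (g x)\<^sup>2 \<partial>M)"
    by (simp add: ennreal_power ennreal_mult [symmetric])
  then have "(\<integral>x. \<bar>f x * g x\<bar> \<partial>M) \<le> sqrt ((\<integral>x. (f x)\<^sup>2 \<partial>M) * (\<integral>x. (g x)\<^sup>2 \<partial>M))"
    by (rule real_le_rsqrt)
  then show ?thesis
    using integral_abs_bound [of M "\<lambda>x. f x * g x"] unfolding real_sqrt_mult by linarith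
qed

lemma integral_square_le_double:
  assumes f: "square_integrable M f" and g: "square_integrable M g"
  shows "(\<integral>x. (f x + g x)\<^sup>2 \<partial>M) \<le> 2 * (\<integral>x. (f x)\<^sup>2 \<partial>M) + 2 * (\<integral>x. (g x)\<^sup>2 \<partial>M)"
proof -
  have "(\<integral>x. (f x + g x)\<^sup>2 \<partial>M) \<le> (\<integral>x. 2 * (f x)\<^sup>2 + 2 * (g x)\<^sup>2 \<partial>M)"
  proof (rule integral_mono)
    show "integrable M (\<lambda>x. (f x + g x)\<^sup>2)"
      using square_integrable_add [OF f g] by (rule square_integrableD)
    show "integrable M (\<lambda>x. 2 * (f x)\<^sup>2 + 2 * (g x)\<^sup>2)"
      using f g by (auto simp: square_integrable_def)
    show "(f x + g x)\<^sup>2 \<le> 2 * (f x)\<^sup>2 + 2 * (g x)\<^sup>2" for x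
      using sum_squares_bound [of "f x" "g x"] by (simp add: power2_sum)
  qed
  also have "\<dots> = 2 * (\<integral>x. (f x)\<^sup>2 \<partial>M) + 2 * (\<integral>x. (g x)\<^sup>2 \<partial>M)"
    using f g by (auto simp: square_integrable_def)
  finally show ?thesis .
qed

lemma L2_tendstoD:
  assumes "L2_tendsto M g f"
  shows "square_integrable M (g n)" "square_integrable M f" "(\<lambda>n. \<integral>x. (g n x - f x)\<^sup>2 \<partial>M) \<longlonglongrightarrow> 0"
  using assms by (auto simp: L2_tendsto_def)

lemma L2_tendsto_const: "square_integrable M f \<Longrightarrow> L2_tendsto M (\<lambda>_. f) f"
  by (simp add: L2_tendsto_def)

lemma L2_tendsto_cmult:
  assumes "L2_tendsto M g f"
  shows "L2_tendsto M (\<lambda>n x. c * g n x) (\<lambda>x. c * f x)"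
proof -
  have "(\<integral>x. (c * g n x - c * f x)\<^sup>2 \<partial>M) = c\<^sup>2 * (\<integral>x. (g n x - f x)\<^sup>2 \<partial>M)" for n
    by (subst integral_mult_right_zero [symmetric]) (simp add: power_mult_distrib flip: right_diff_distrib)
  then show ?thesis
    using assms by (auto simp: L2_tendsto_def intro!: square_integrable_cmult tendsto_mult_right_zero)
qed

lemma L2_tendsto_add:
  assumes g: "L2_tendsto M g f" and g': "L2_tendsto M g' f'"
  shows "L2_tendsto M (\<lambda>n x. g n x + g' n x) (\<lambda>x. f x + f' x)"
proof -
  have "(\<lambda>n. \<integral>x. ((g n x + g' n x) - (f x + f' x))\<^sup>2 \<partial>M) \<longlonglongrightarrow> 0"
  proof (rule tendsto_sandwich)
    show "\<forall>\<^sub>F n in sequentially. 0 \<le> (\<integral>x. ((g n x + g' n x) - (f x + f' x))\<^sup>2 \<partial>M)" by simp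
    show "\<forall>\<^sub>F n in sequentially. (\<integral>x. ((g n x + g' n x) - (f x + f' x))\<^sup>2 \<partial>M)
        \<le> 2 * (\<integral>x. (g n x - f x)\<^sup>2 \<partial>M) + 2 * (\<integral>x. (g' n x - f' x)\<^sup>2 \<partial>M)"
    proof
      show "(\<integral>x. ((g n x + g' n x) - (f x + f' x))\<^sup>2 \<partial>M)
          \<le> 2 * (\<integral>x. (g n x - f x)\<^sup>2 \<partial>M) + 2 * (\<integral>x. (g' n x - f' x)\<^sup>2 \<partial>M)" for n
        using integral_square_le_double
          [OF square_integrable_diff [OF L2_tendstoD(1,2) [OF g]] square_integrable_diff [OF L2_tendstoD(1,2) [OF g']], of n n]
        by (simp add: algebra_simps)
    qed
    show "(\<lambda>n. 2 * (\<integral>x. (g n x - f x)\<^sup>2 \<partial>M) + 2 * (\<integral>x. (g' n x - f' x)\<^sup>2 \<partial>M)) \<longlonglongrightarrow> 0"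
      using tendsto_add [OF tendsto_mult_right_zero [OF L2_tendstoD(3) [OF g], of 2]
          tendsto_mult_right_zero [OF L2_tendstoD(3) [OF g'], of 2]] by simp
  qed simp
  with g g' show ?thesis by (auto simp: L2_tendsto_def intro: square_integrable_add)
qed

lemma L2_tendsto_diff:
  assumes "L2_tendsto M g f" "L2_tendsto M g' f'"
  shows "L2_tendsto M (\<lambda>n x. g n x - g' n x) (\<lambda>x. f x - f' x)"
  using L2_tendsto_add [OF assms(1) L2_tendsto_cmult [OF assms(2), of "-1"]] by simp

lemma L2_tendsto_sum:
  assumes "\<And>i. i \<in> I \<Longrightarrow> L2_tendsto M (g i) (f i)"
  shows "L2_tendsto M (\<lambda>n x. \<Sum>i\<in>I. g i n x) (\<lambda>x. \<Sum>i\<in>I. f i x)"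
  using assms
  by (induction I rule: infinite_finite_induct)
    (auto intro: L2_tendsto_add L2_tendsto_const square_integrable_zero)

lemma tendsto_integral_mult_L2:
  assumes g: "L2_tendsto M g f" and g': "L2_tendsto M g' f'"
  shows "(\<lambda>n. \<integral>x. g n x * g' n x \<partial>M) \<longlonglongrightarrow> (\<integral>x. f x * f' x \<partial>M)"
proof -
  let ?N = "\<lambda>h. sqrt (\<integral>x. (h x)\<^sup>2 \<partial>M)"
  note sq = L2_tendstoD(1,2) [OF g] L2_tendstoD(1,2) [OF g']
  note sd = square_integrable_diff [OF sq(1,2)] square_integrable_diff [OF sq(3,4)]
  \<comment> \<open>Each error term contains a difference and otherwise only the fixed limits, so
    Cauchy-Schwarz applies without a prior bound on the norms of \<open>g n\<close> and
    \<open>g' n\<close>.\<close>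
  have eq: "(\<integral>x. g n x * g' n x \<partial>M) - (\<integral>x. f x * f' x \<partial>M) =
      (\<integral>x. (g n x - f x) * (g' n x - f' x) \<partial>M) + (\<integral>x. (g n x - f x) * f' x \<partial>M) + (\<integral>x. f x * (g' n x - f' x) \<partial>M)" for n
  proof -
    have "(\<integral>x. g n x * g' n x \<partial>M) = (\<integral>x. ((g n x - f x) * (g' n x - f' x) + (g n x - f x) * f' x
        + f x * (g' n x - f' x)) + f x * f' x \<partial>M)"
      by (simp add: algebra_simps)
    then show ?thesis
      by (simp add: square_integrable_mult sd sq)
  qed
  have "norm ((\<integral>x. g n x * g' n x \<partial>M) - (\<integral>x. f x * f' x \<partial>M)) \<le>
      ?N (\<lambda>x. g n x - f x) * ?N (\<lambda>x. g' n x - f' x) + ?N (\<lambda>x. g n x - f x) * ?N f' + ?N f * ?N (\<lambda>x. g' n x - f' x)" for n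
    unfolding eq real_norm_def
    using Cauchy_Schwarz_square_integrable [OF sd(1) sd(2), of n n]
      Cauchy_Schwarz_square_integrable [OF sd(1) sq(4), of n]
      Cauchy_Schwarz_square_integrable [OF sq(2) sd(2), of n] by linarith
  moreover have "(\<lambda>n. ?N (\<lambda>x. g n x - f x) * ?N (\<lambda>x. g' n x - f' x) + ?N (\<lambda>x. g n x - f x) * ?N f'
      + ?N f * ?N (\<lambda>x. g' n x - f' x)) \<longlonglongrightarrow> sqrt 0 * sqrt 0 + sqrt 0 * ?N f' + ?N f * sqrt 0"
    by (intro tendsto_intros L2_tendstoD(3) g g')
  ultimately have "(\<lambda>n. (\<integral>x. g n x * g' n x \<partial>M) - (\<integral>x. f x * f' x \<partial>M)) \<longlonglongrightarrow> 0"
    unfolding real_sqrt_zero mult_zero_left mult_zero_right add_0_left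
    by (rule Lim_null_comparison [OF always_eventually [OF allI]])
  then show ?thesis by (rule LIM_zero_cancel)
qed

lemma tendsto_integral_square_L2:
  assumes "L2_tendsto M g f"
  shows "(\<lambda>n. \<integral>x. (g n x)\<^sup>2 \<partial>M) \<longlonglongrightarrow> (\<integral>x. (f x)\<^sup>2 \<partial>M)"
  using tendsto_integral_mult_L2 [OF assms assms] by (simp add: power2_eq_square)

lemma integral_square_sum_orthogonal:
  assumes "finite I" and sq: "\<And>i. i \<in> I \<Longrightarrow> square_integrable M (f i)"
    and orth: "\<And>i j. i \<in> I \<Longrightarrow> j \<in> I \<Longrightarrow> i \<noteq> j \<Longrightarrow> (\<integral>x. f i x * f j x \<partial>M) = 0"
  shows "(\<integral>x. (\<Sum>i\<in>I. f i x)\<^sup>2 \<partial>M) = (\<Sum>i\<in>I. \<integral>x. (f i x)\<^sup>2 \<partial>M)"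
proof -
  have "(\<integral>x. (\<Sum>i\<in>I. f i x)\<^sup>2 \<partial>M) = (\<integral>x. (\<Sum>i\<in>I. \<Sum>j\<in>I. f i x * f j x) \<partial>M)"
    by (simp add: power2_eq_square sum_product)
  also have "\<dots> = (\<Sum>i\<in>I. \<Sum>j\<in>I. \<integral>x. f i x * f j x \<partial>M)"
    by (simp add: square_integrable_mult sq)
  also have "\<dots> = (\<Sum>i\<in>I. \<Sum>j\<in>I. if j = i then \<integral>x. (f i x)\<^sup>2 \<partial>M else 0)"
    by (intro sum.cong refl) (auto simp: orth power2_eq_square)
  also have "\<dots> = (\<Sum>i\<in>I. \<integral>x. (f i x)\<^sup>2 \<partial>M)" using assms(1) by simp
  finally show ?thesis .
qed

text \<open>Riesz-Fischer: Cauchy-Schwarz against the constant 1 turns the L2 Cauchy property into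
  the L1 one, which yields an almost everywhere convergent subsequence; Fatou's lemma then gives
  convergence in mean square of the whole sequence.\<close>

lemma (in prob_space) L2_complete:
  assumes sq: "\<And>n. square_integrable M (f n)"
    and Cauchy: "\<And>e. e > 0 \<Longrightarrow> \<exists>N. \<forall>m\<ge>N. \<forall>n\<ge>N. (\<integral>x. (f m x - f n x)\<^sup>2 \<partial>M) < e"
  shows "\<exists>g. L2_tendsto M f g"
proof -
  note [measurable] = sq [THEN square_integrableD(1)]
  have one: "square_integrable M (\<lambda>_. 1)" by (simp add: square_integrable_def)
  have int: "integrable M (f n)" for n
    using square_integrable_mult [OF sq one] by simp
  have sd: "square_integrable M (\<lambda>x. f m x - f n x)" for m n by (intro square_integrable_diff sq)
  have "\<exists>N. \<forall>i\<ge>N. \<forall>j\<ge>N. (LINT x|M. norm (f i x - f j x)) < e" if e: "e > 0" for e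
  proof -
    obtain N where N: "\<forall>m\<ge>N. \<forall>n\<ge>N. (\<integral>x. (f m x - f n x)\<^sup>2 \<partial>M) < e\<^sup>2"
      using Cauchy [OF zero_less_power [OF e]] by blast
    have "(LINT x|M. norm (f i x - f j x)) < e" if "i \<ge> N" "j \<ge> N" for i j
    proof -
      have sa: "square_integrable M (\<lambda>x. \<bar>f i x - f j x\<bar>)"
        using sd [of i j] by (auto simp: square_integrable_def)
      have "(LINT x|M. norm (f i x - f j x)) \<le> sqrt (\<integral>x. (f i x - f j x)\<^sup>2 \<partial>M)"
        using Cauchy_Schwarz_square_integrable [OF sa one] by (simp add: prob_space)
      also have "\<dots> < sqrt (e\<^sup>2)" using N that by (intro real_sqrt_less_mono) blast
      finally show ?thesis using \<open>e > 0\<close> by simp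
    qed
    then show ?thesis by blast
  qed
  then obtain r where r: "strict_mono r" "AE x in M. Cauchy (\<lambda>i. f (r i) x)"
    using cauchy_L1_AE_cauchy_subseq [of M f, OF int] by blast
  define g where "g x = lim (\<lambda>i. f (r i) x)" for x
  have [measurable]: "g \<in> borel_measurable M" unfolding g_def by measurable
  have lim: "AE x in M. (\<lambda>i. f (r i) x) \<longlonglongrightarrow> g x"
    using r(2) unfolding g_def by eventually_elim (simp add: Cauchy_convergent_iff convergent_LIMSEQ_iff)
  \<comment> \<open>Fatou along \<open>f (r i)\<close> transfers the Cauchy estimate for
    \<open>f m\<close> to the limit \<open>g\<close>. With \<open>e = 1\<close> it also shows that
    \<open>f N1 - g\<close>, hence \<open>g\<close>, is square integrable.\<close>
  have bound: "integrable M (\<lambda>x. (f m x - g x)\<^sup>2) \<and> (\<integral>x. (f m x - g x)\<^sup>2 \<partial>M) \<le> e"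
    if N: "\<And>n. n \<ge> N \<Longrightarrow> (\<integral>x. (f m x - f n x)\<^sup>2 \<partial>M) < e" for m N e
  proof -
    have "0 \<le> (\<integral>x. (f m x - f N x)\<^sup>2 \<partial>M)" by simp
    with N [of N] have "e \<ge> 0" by linarith
    have "(\<integral>\<^sup>+x. ennreal ((f m x - g x)\<^sup>2) \<partial>M) = (\<integral>\<^sup>+x. liminf (\<lambda>i. ennreal ((f m x - f (r i) x)\<^sup>2)) \<partial>M)"
    proof (rule nn_integral_cong_AE, use lim in eventually_elim)
      fix x assume "(\<lambda>i. f (r i) x) \<longlonglongrightarrow> g x"
      then have "(\<lambda>i. ennreal ((f m x - f (r i) x)\<^sup>2)) \<longlonglongrightarrow> ennreal ((f m x - g x)\<^sup>2)"
        by (intro tendsto_intros)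
      then show "ennreal ((f m x - g x)\<^sup>2) = liminf (\<lambda>i. ennreal ((f m x - f (r i) x)\<^sup>2))"
        by (rule lim_imp_Liminf [OF sequentially_bot, symmetric])
    qed
    also have "\<dots> \<le> liminf (\<lambda>i. \<integral>\<^sup>+x. ennreal ((f m x - f (r i) x)\<^sup>2) \<partial>M)"
      by (rule nn_integral_liminf) simp
    also have "\<dots> \<le> ennreal e"
    proof -
      have "(\<integral>\<^sup>+x. ennreal ((f m x - f (r i) x)\<^sup>2) \<partial>M) \<le> ennreal e" if "i \<ge> N" for i
      proof -
        have "r i \<ge> N" using that seq_suble [OF r(1), of i] by linarith
        then show ?thesis
          using N [of "r i"] sd [of m "r i", THEN square_integrableD(2)]
          by (subst nn_integral_eq_integral) (auto intro: ennreal_leI)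
      qed
      then have "liminf (\<lambda>i. \<integral>\<^sup>+x. ennreal ((f m x - f (r i) x)\<^sup>2) \<partial>M) \<le> liminf (\<lambda>i. ennreal e)"
        by (intro Liminf_mono eventually_sequentiallyI [of N])
      then show ?thesis by (simp add: Liminf_const)
    qed
    finally have le: "(\<integral>\<^sup>+x. ennreal ((f m x - g x)\<^sup>2) \<partial>M) \<le> ennreal e" .
    then have int: "integrable M (\<lambda>x. (f m x - g x)\<^sup>2)"
      by (intro integrableI_bounded) (auto simp: le_less_trans)
    then show ?thesis
      using le nn_integral_eq_integral [OF int] \<open>e \<ge> 0\<close> by simp
  qed
  obtain N1 where N1: "\<forall>m\<ge>N1. \<forall>n\<ge>N1. (\<integral>x. (f m x - f n x)\<^sup>2 \<partial>M) < 1"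
    using Cauchy [OF zero_less_one] by blast
  have "square_integrable M (\<lambda>x. f N1 x - g x)"
    using bound [of N1 N1 1] N1 by (auto simp: square_integrable_def)
  from square_integrable_diff [OF sq [of N1] this] have "square_integrable M g" by simp
  moreover have "(\<lambda>n. \<integral>x. (f n x - g x)\<^sup>2 \<partial>M) \<longlonglongrightarrow> 0"
  proof (rule LIMSEQ_I)
    fix e :: real assume "e > 0"
    then obtain N where "\<forall>m\<ge>N. \<forall>n\<ge>N. (\<integral>x. (f m x - f n x)\<^sup>2 \<partial>M) < e / 2"
      using Cauchy [OF half_gt_zero] by blast
    then have "(\<integral>x. (f m x - g x)\<^sup>2 \<partial>M) \<le> e / 2" if "m \<ge> N" for m using bound [of N m "e / 2"] that by blast
    with \<open>e > 0\<close> have "\<forall>m\<ge>N. norm ((\<integral>x. (f m x - g x)\<^sup>2 \<partial>M) - 0) < e" by (force simp: field_simps)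
    then show "\<exists>N. \<forall>m\<ge>N. norm ((\<integral>x. (f m x - g x)\<^sup>2 \<partial>M) - 0) < e" by blast
  qed
  ultimately show ?thesis unfolding L2_tendsto_def using sq by blast
qed

section \<open>Products of independent Gaussian variables\<close>

lemma exp_i_of_real_eq_cis: "iexp x = cis x"
  by (simp add: cis_conv_exp)

lemma tendsto_std_normal_density_0:
  "(std_normal_density \<longlongrightarrow> 0) at_top" "(std_normal_density \<longlongrightarrow> 0) at_bot"
  unfolding std_normal_density_def by real_asymp+

lemma has_vector_derivative_std_normal_iexp:
  "((\<lambda>x. complex_of_real (std_normal_density x) * iexp (a * x)) has_vector_derivative
    (\<i> * a - x) * (std_normal_density x * iexp (a * x))) (at x)"
proof -
  have "(std_normal_density has_real_derivative - x * std_normal_density x) (at x)"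
    unfolding std_normal_density_def by (rule derivative_eq_intros refl | simp)+
  then have d: "((\<lambda>x. complex_of_real (std_normal_density x)) has_vector_derivative
      complex_of_real (- x * std_normal_density x)) (at x)"
    by (intro has_vector_derivative_of_real) (simp add: has_real_derivative_iff_has_vector_derivative)
  have e: "((\<lambda>x. iexp (a * x)) has_vector_derivative (\<i> * a) * iexp (a * x)) (at x)"
  proof -
    have "((\<lambda>x. a * x) has_vector_derivative a) (at x)"
      by (auto intro!: derivative_eq_intros simp flip: has_real_derivative_iff_has_vector_derivative)
    from vector_diff_chain_at [OF this has_vector_derivative_iexp] show ?thesis
      by (simp add: comp_def scaleR_conv_of_real mult_ac)
  qed
  show ?thesis
    using has_vector_derivative_mult [OF d e] by (rule has_vector_derivative_eq_rhs) (simp add: algebra_simps)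
qed

text \<open>Integration by parts: the derivative of density times character is integrable and the
  product vanishes at both infinities, so its integral over the line is 0. This evaluates E(\<xi>
  exp(i a \<xi>)), the mixed moment in the cross term of \<open>wick_approx\<close>.\<close>

lemma integral_std_normal_mult_iexp:
  "(CLBINT x. complex_of_real (std_normal_density x * x) * iexp (a * x)) =
    \<i> * a * (CLBINT x. complex_of_real (std_normal_density x) * iexp (a * x))"
proof -
  let ?F = "\<lambda>x. complex_of_real (std_normal_density x) * iexp (a * x)"
  let ?f = "\<lambda>x. (\<i> * a - x) * ?F x"
  have iF: "complex_integrable lborel ?F"
    by (rule Bochner_Integration.integrable_bound [of _ std_normal_density]) (auto simp: norm_mult)
  have iG: "complex_integrable lborel (\<lambda>x. complex_of_real (std_normal_density x * x) * iexp (a * x))"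
    using integrable_std_normal_moment_abs [of 1]
    by (rule Bochner_Integration.integrable_bound) (auto simp: norm_mult)
  have fe: "?f x = \<i> * a * ?F x - complex_of_real (std_normal_density x * x) * iexp (a * x)" for x
    by (simp add: algebra_simps)
  have "complex_integrable lborel ?f" unfolding fe using iF iG by simp
  then have sf: "set_integrable lborel (einterval (- \<infinity>) \<infinity>) ?f"
    by (simp add: set_integrable_def einterval_def)
  have norm_F: "norm (?F x) = std_normal_density x" for x by (simp add: norm_mult)
  have "(?F \<longlongrightarrow> 0) at_top" "(?F \<longlongrightarrow> 0) at_bot"
    using tendsto_std_normal_density_0 by (auto intro: tendsto_norm_zero_cancel simp only: norm_F)
  then have lim: "((?F \<circ> real_of_ereal) \<longlongrightarrow> 0) (at_right (- \<infinity>))" "((?F \<circ> real_of_ereal) \<longlongrightarrow> 0) (at_left \<infinity>)"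
    by (simp_all only: ereal_tendsto_simps)
  have "(LBINT x=-\<infinity>..\<infinity>. ?f x) = 0 - 0"
  proof (rule interval_integral_FTC_integrable [where F = ?F])
    show "(?F has_vector_derivative ?f x) (at x)" for x
      by (rule has_vector_derivative_std_normal_iexp)
    show "isCont ?f x" for x
      unfolding std_normal_density_def by (intro continuous_intros) auto
  qed (use sf lim in auto)
  then have "(CLBINT x. ?f x) = 0"
    by (simp add: interval_lebesgue_integral_def set_lebesgue_integral_def einterval_def)
  then show ?thesis unfolding fe using iF iG by simp
qed

lemma integral_std_normal_iexp:
  "(CLBINT x. complex_of_real (std_normal_density x) * iexp (a * x)) = complex_of_real (exp (- a\<^sup>2 / 2))"
proof -
  have "char std_normal_distribution a = (CLBINT x. complex_of_real (std_normal_density x) * iexp (a * x))"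
    unfolding char_def by (subst integral_density) (auto simp: scaleR_conv_of_real)
  then show ?thesis by (simp add: char_std_normal_distribution exp_of_real [symmetric])
qed

context prob_space
begin

lemma expectation_normal_scaled:
  fixes g :: "real \<Rightarrow> 'c :: {banach, second_countable_topology}"
  assumes "v > 0" and X: "distributed M lborel X (normal_density 0 (sqrt v))"
    and [measurable]: "g \<in> borel_measurable borel"
  shows "(\<integral>x. g (X x) \<partial>M) = (\<integral>y. std_normal_density y *\<^sub>R g (sqrt v * y) \<partial>lborel)"
    and "integrable M (\<lambda>x. g (X x)) \<longleftrightarrow> integrable lborel (\<lambda>y. std_normal_density y *\<^sub>R g (sqrt v * y))"
proof -
  have Y: "distributed M lborel (\<lambda>x. (X x - 0) / sqrt v) std_normal_density"
    using normal_standard_normal_convert [of "sqrt v" X 0] assms by simp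
  then have [measurable]: "(\<lambda>x. X x / sqrt v) \<in> borel_measurable M"
    by (auto simp: distributed_def)
  have D: "distr M lborel (\<lambda>x. X x / sqrt v) = density lborel std_normal_density"
    using Y by (simp add: distributed_def)
  have e: "g (X x) = g (sqrt v * (X x / sqrt v))" for x using assms(1) by simp
  have "(\<integral>x. g (X x) \<partial>M) = (\<integral>y. g (sqrt v * y) \<partial>distr M lborel (\<lambda>x. X x / sqrt v))"
    by (subst integral_distr) (use e in auto)
  then show "(\<integral>x. g (X x) \<partial>M) = (\<integral>y. std_normal_density y *\<^sub>R g (sqrt v * y) \<partial>lborel)"
    unfolding D by (subst (asm) integral_density) auto
  have "integrable M (\<lambda>x. g (X x)) \<longleftrightarrow> integrable (distr M lborel (\<lambda>x. X x / sqrt v)) (\<lambda>y. g (sqrt v * y))"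
    by (subst integrable_distr_eq) (use e in auto)
  then show "integrable M (\<lambda>x. g (X x)) \<longleftrightarrow> integrable lborel (\<lambda>y. std_normal_density y *\<^sub>R g (sqrt v * y))"
    unfolding D by (subst (asm) integrable_density) auto
qed

lemma normal_moments:
  fixes a v :: real
  assumes v: "v > 0" and X: "distributed M lborel X (normal_density 0 (sqrt v))"
  shows "integrable M X" "expectation X = 0" "integrable M (\<lambda>x. (X x)\<^sup>2)" "expectation (\<lambda>x. (X x)\<^sup>2) = v"
    "complex_integrable M (\<lambda>x. iexp (a * X x))" "(CLINT x|M. iexp (a * X x)) = complex_of_real (exp (- a\<^sup>2 * v / 2))"
    "complex_integrable M (\<lambda>x. X x * iexp (a * X x))"
    "(CLINT x|M. X x * iexp (a * X x)) = \<i> * a * v * complex_of_real (exp (- a\<^sup>2 * v / 2))"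
proof -
  note E = expectation_normal_scaled [OF v X]
  have sv: "sqrt v * sqrt v = v" "(sqrt v)\<^sup>2 = v" using v by auto
  show "integrable M X"
    using E(2) [of "\<lambda>x. x"] integrable_std_normal_moment [of 1] by (simp add: mult.left_commute [of _ "sqrt v"])
  show "expectation X = 0"
    using E(1) [of "\<lambda>x. x"] integral_std_normal_moment_odd [of 0] by (simp add: mult.left_commute [of _ "sqrt v"])
  show "integrable M (\<lambda>x. (X x)\<^sup>2)"
    using E(2) [of "\<lambda>x. x\<^sup>2"] integrable_std_normal_moment [of 2] v
    by (simp add: mult.left_commute [of _ v] power_mult_distrib)
  show "expectation (\<lambda>x. (X x)\<^sup>2) = v"
    using E(1) [of "\<lambda>x. x\<^sup>2"] integral_std_normal_moment_even [of 1] v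
    by (simp add: mult.left_commute [of _ v] power_mult_distrib)
  have [measurable]: "X \<in> borel_measurable M" using X by (auto simp: distributed_def)
  show "complex_integrable M (\<lambda>x. iexp (a * X x))"
    by (rule integrable_const_bound [of _ 1]) auto
  have m: "a * (sqrt v * y) = (a * sqrt v) * y" for y by simp
  show "(CLINT x|M. iexp (a * X x)) = complex_of_real (exp (- a\<^sup>2 * v / 2))"
    using E(1) [of "\<lambda>x. iexp (a * x)"] integral_std_normal_iexp [of "a * sqrt v"] v
    by (simp add: scaleR_conv_of_real m power_mult_distrib)
  show "complex_integrable M (\<lambda>x. X x * iexp (a * X x))"
    using \<open>integrable M X\<close> by (rule Bochner_Integration.integrable_bound) (auto simp: norm_mult)
  have "(CLINT x|M. X x * iexp (a * X x)) =
      (CLBINT y. complex_of_real (sqrt v) * (complex_of_real (std_normal_density y * y) * iexp (a * sqrt v * y)))"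
    using E(1) [of "\<lambda>x. x * iexp (a * x)"] by (simp add: scaleR_conv_of_real m mult_ac)
  also have "\<dots> = sqrt v * (\<i> * (a * sqrt v) * complex_of_real (exp (- (a * sqrt v)\<^sup>2 / 2)))"
    by (simp only: integral_mult_right_zero integral_std_normal_mult_iexp integral_std_normal_iexp)
  also have "\<dots> = \<i> * a * v * complex_of_real (exp (- a\<^sup>2 * v / 2))"
    using sv by (simp add: power_mult_distrib mult_ac flip: of_real_mult)
  finally show "(CLINT x|M. X x * iexp (a * X x)) = \<i> * a * v * complex_of_real (exp (- a\<^sup>2 * v / 2))" .
qed

end

section \<open>Square-free polynomials in independent centred normal variables\<close>

locale gaussian_family = prob_space M for M :: "'a measure" +
  fixes A :: "'i set" and \<xi> :: "'i \<Rightarrow> 'a \<Rightarrow> real" and v :: "'i \<Rightarrow> real"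
  assumes finite_A: "finite A"
    and indep: "indep_vars (\<lambda>_. borel) \<xi> A"
    and v_pos: "i \<in> A \<Longrightarrow> v i > 0"
    and normal: "i \<in> A \<Longrightarrow> distributed M lborel (\<xi> i) (normal_density 0 (sqrt (v i)))"
begin

lemmas moments = normal_moments [OF v_pos normal]

lemma measurable_\<xi>: "i \<in> A \<Longrightarrow> \<xi> i \<in> borel_measurable M"
  using normal by (auto simp: distributed_def)

lemma char_linear:
  "(CLINT x|M. iexp (\<Sum>i\<in>A. a i * \<xi> i x)) = complex_of_real (exp (- (\<Sum>i\<in>A. (a i)\<^sup>2 * v i) / 2))"
proof -
  have "(CLINT x|M. iexp (\<Sum>i\<in>A. a i * \<xi> i x)) = (CLINT x|M. \<Prod>i\<in>A. iexp (a i * \<xi> i x))"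
    by (simp add: sum_distrib_left exp_sum [OF finite_A])
  also have "\<dots> = (\<Prod>i\<in>A. CLINT x|M. iexp (a i * \<xi> i x))"
  proof (rule indep_vars_lebesgue_integral [OF finite_A])
    show "indep_vars (\<lambda>_. borel) (\<lambda>i x. iexp (a i * \<xi> i x)) A"
      by (rule indep_vars_compose2 [OF indep]) measurable
  qed (rule moments)
  also have "\<dots> = (\<Prod>i\<in>A. complex_of_real (exp (- (a i)\<^sup>2 * v i / 2)))"
    by (intro prod.cong refl moments)
  also have "\<dots> = complex_of_real (exp (- (\<Sum>i\<in>A. (a i)\<^sup>2 * v i) / 2))"
    by (simp add: exp_sum [OF finite_A] sum_negf [symmetric] sum_divide_distrib)
  finally show ?thesis .
qed

text \<open>By independence an index lying in exactly one of \<open>B\<close> and \<open>C\<close>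
  contributes the factor E \<xi> = 0, and an index in both contributes its variance.\<close>

lemma prod_\<xi>_orthogonal:
  assumes "B \<subseteq> A" "C \<subseteq> A"
  shows "integrable M (\<lambda>x. (\<Prod>i\<in>B. \<xi> i x) * (\<Prod>i\<in>C. \<xi> i x))"
    and "(\<integral>x. (\<Prod>i\<in>B. \<xi> i x) * (\<Prod>i\<in>C. \<xi> i x) \<partial>M) = (if B = C then \<Prod>i\<in>B. v i else 0)"
proof -
  \<comment> \<open>Padding with factors 1 writes both products as one product over
    \<open>A\<close>, the form to which independence applies.\<close>
  define g where "g i y = (if i \<in> B then y else 1) * (if i \<in> C then y else (1::real))" for i y
  have eq: "(\<Prod>i\<in>B. \<xi> i x) * (\<Prod>i\<in>C. \<xi> i x) = (\<Prod>i\<in>A. g i (\<xi> i x))" for x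
    using assms finite_A by (simp add: g_def prod.distrib prod.If_cases Int_absorb1)
  have ind: "indep_vars (\<lambda>_. borel) (\<lambda>i x. g i (\<xi> i x)) A"
    by (rule indep_vars_compose2 [OF indep]) (simp add: g_def)
  have int: "integrable M (\<lambda>x. g i (\<xi> i x))" if "i \<in> A" for i
    using moments(1,3) [OF that that]
    by (cases "i \<in> B"; cases "i \<in> C") (simp_all add: g_def power2_eq_square)
  show "integrable M (\<lambda>x. (\<Prod>i\<in>B. \<xi> i x) * (\<Prod>i\<in>C. \<xi> i x))"
    unfolding eq by (rule indep_vars_integrable [OF finite_A ind int])
  have "(\<integral>x. (\<Prod>i\<in>B. \<xi> i x) * (\<Prod>i\<in>C. \<xi> i x) \<partial>M) = (\<Prod>i\<in>A. \<integral>x. g i (\<xi> i x) \<partial>M)"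
    unfolding eq by (rule indep_vars_lebesgue_integral [OF finite_A ind int])
  also have "\<dots> = (\<Prod>i\<in>A. if i \<in> B \<and> i \<in> C then v i else if i \<in> B \<or> i \<in> C then 0 else 1)"
    using moments(2,4) by (intro prod.cong refl) (auto simp: g_def prob_space power2_eq_square)
  also have "\<dots> = (if B = C then \<Prod>i\<in>B. v i else 0)"
  proof (cases "B = C")
    case True
    then show ?thesis using assms finite_A by (simp add: prod.If_cases Int_absorb1)
  next
    case False
    then obtain i where "i \<in> A" "i \<in> B \<longleftrightarrow> i \<notin> C" using assms by blast
    then show ?thesis using False by (auto intro!: prod_zero [OF finite_A] bexI [of _ i])
  qed
  finally show "(\<integral>x. (\<Prod>i\<in>B. \<xi> i x) * (\<Prod>i\<in>C. \<xi> i x) \<partial>M) = (if B = C then \<Prod>i\<in>B. v i else 0)" .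
qed

lemma square_integrable_prod_\<xi>: "B \<subseteq> A \<Longrightarrow> square_integrable M (\<lambda>x. \<Prod>i\<in>B. \<xi> i x)"
  using prod_\<xi>_orthogonal(1) [of B B] measurable_\<xi>
  by (auto simp: square_integrable_def power2_eq_square intro!: borel_measurable_prod)

lemma finite_subsets: "finite {B. B \<subseteq> A \<and> card B = k}"
  by (rule finite_subset [of _ "Pow A"]) (use finite_A in auto)

definition homogeneous :: "nat \<Rightarrow> ('a \<Rightarrow> real) \<Rightarrow> bool" where
  "homogeneous k X \<longleftrightarrow> (\<exists>w. X = (\<lambda>x. \<Sum>B | B \<subseteq> A \<and> card B = k. w B * (\<Prod>i\<in>B. \<xi> i x)))"

lemma homogeneous_prod:
  assumes "B \<subseteq> A" "card B = k"
  shows "homogeneous k (\<lambda>x. \<Prod>i\<in>B. \<xi> i x)"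
proof -
  have "(\<Sum>C | C \<subseteq> A \<and> card C = k. (if C = B then 1 else 0) * (\<Prod>i\<in>C. \<xi> i x)) = (\<Prod>i\<in>B. \<xi> i x)" for x
    using assms by (subst sum.mono_neutral_right [of _ "{B}"]) (auto simp: finite_subsets)
  then show ?thesis unfolding homogeneous_def by (intro exI [of _ "\<lambda>C. if C = B then 1 else 0"]) auto
qed

lemma homogeneous_zero: "homogeneous k (\<lambda>_. 0)"
  unfolding homogeneous_def by (rule exI [of _ "\<lambda>_. 0"]) simp

lemma homogeneous_add:
  assumes "homogeneous k X" "homogeneous k Y"
  shows "homogeneous k (\<lambda>x. X x + Y x)"
proof -
  from assms obtain w w' where
    "X = (\<lambda>x. \<Sum>B | B \<subseteq> A \<and> card B = k. w B * (\<Prod>i\<in>B. \<xi> i x))"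
    "Y = (\<lambda>x. \<Sum>B | B \<subseteq> A \<and> card B = k. w' B * (\<Prod>i\<in>B. \<xi> i x))"
    unfolding homogeneous_def by blast
  then show ?thesis
    unfolding homogeneous_def by (intro exI [of _ "\<lambda>B. w B + w' B"]) (simp add: sum.distrib distrib_right)
qed

lemma homogeneous_cmult:
  assumes "homogeneous k X"
  shows "homogeneous k (\<lambda>x. c * X x)"
proof -
  from assms obtain w where "X = (\<lambda>x. \<Sum>B | B \<subseteq> A \<and> card B = k. w B * (\<Prod>i\<in>B. \<xi> i x))"
    unfolding homogeneous_def by blast
  then show ?thesis
    unfolding homogeneous_def by (intro exI [of _ "\<lambda>B. c * w B"]) (simp add: sum_distrib_left mult.assoc)
qed

lemma homogeneous_sum:
  "(\<And>j. j \<in> J \<Longrightarrow> homogeneous k (X j)) \<Longrightarrow> homogeneous k (\<lambda>x. \<Sum>j\<in>J. X j x)"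
  by (induction J rule: infinite_finite_induct) (auto intro: homogeneous_add homogeneous_zero)

lemma square_integrable_homogeneous:
  assumes "homogeneous k X"
  shows "square_integrable M X"
  using assms unfolding homogeneous_def
  by (auto intro!: square_integrable_sum square_integrable_cmult square_integrable_prod_\<xi>)

text \<open>Sets of different cardinality are different, so every product of two monomials has mean
  0 by \<open>prod_\<xi>_orthogonal\<close>.\<close>

lemma homogeneous_orthogonal:
  assumes "homogeneous k X" "homogeneous l Y" "k \<noteq> l"
  shows "(\<integral>x. X x * Y x \<partial>M) = 0"
proof -
  from assms obtain w w' where
    X: "X = (\<lambda>x. \<Sum>B | B \<subseteq> A \<and> card B = k. w B * (\<Prod>i\<in>B. \<xi> i x))" and
    Y: "Y = (\<lambda>x. \<Sum>B | B \<subseteq> A \<and> card B = l. w' B * (\<Prod>i\<in>B. \<xi> i x))"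
    unfolding homogeneous_def by blast
  have "(\<integral>x. X x * Y x \<partial>M) = (\<integral>x. (\<Sum>B | B \<subseteq> A \<and> card B = k. \<Sum>C | C \<subseteq> A \<and> card C = l.
      (w B * w' C) * ((\<Prod>i\<in>B. \<xi> i x) * (\<Prod>i\<in>C. \<xi> i x))) \<partial>M)"
    unfolding X Y sum_product by (simp only: mult_ac)
  also have "\<dots> = 0"
    using assms by (subst Bochner_Integration.integral_sum
        | auto simp: prod_\<xi>_orthogonal intro!: Bochner_Integration.integrable_sum integrable_mult_right sum.neutral)+
  finally show ?thesis .
qed

text \<open>The k-th elementary symmetric polynomial in the variables \<open>a i * \<xi> i\<close>.
  It will be the integral of the k-fold tensor power of a kernel, divided by k!, with the diagonal
  cells removed.\<close>

definition elem :: "('i \<Rightarrow> real) \<Rightarrow> nat \<Rightarrow> 'a \<Rightarrow> real" where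
  "elem a k x = (\<Sum>B | B \<subseteq> A \<and> card B = k. \<Prod>i\<in>B. a i * \<xi> i x)"

lemma elem_alt: "elem a k x = (\<Sum>B | B \<subseteq> A \<and> card B = k. (\<Prod>i\<in>B. a i) * (\<Prod>i\<in>B. \<xi> i x))"
  by (simp add: elem_def prod.distrib)

lemma homogeneous_elem: "homogeneous k (elem a k)"
  unfolding homogeneous_def elem_alt [abs_def] by blast

lemmas square_integrable_elem = square_integrable_homogeneous [OF homogeneous_elem]

lemma integral_elem_square:
  "(\<integral>x. (elem a k x)\<^sup>2 \<partial>M) = (\<Sum>B | B \<subseteq> A \<and> card B = k. \<Prod>i\<in>B. (a i)\<^sup>2 * v i)"
proof -
  have "(\<integral>x. (elem a k x)\<^sup>2 \<partial>M) = (\<Sum>B | B \<subseteq> A \<and> card B = k. \<integral>x. ((\<Prod>i\<in>B. a i) * (\<Prod>i\<in>B. \<xi> i x))\<^sup>2 \<partial>M)"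
    unfolding elem_alt
  proof (rule integral_square_sum_orthogonal [OF finite_subsets])
    show "(\<integral>x. (\<Prod>i\<in>B. a i) * (\<Prod>i\<in>B. \<xi> i x) * ((\<Prod>i\<in>C. a i) * (\<Prod>i\<in>C. \<xi> i x)) \<partial>M) = 0"
      if "B \<in> {B. B \<subseteq> A \<and> card B = k}" "C \<in> {B. B \<subseteq> A \<and> card B = k}" "B \<noteq> C" for B C
    proof -
      have "(\<integral>x. (\<Prod>i\<in>B. a i) * (\<Prod>i\<in>B. \<xi> i x) * ((\<Prod>i\<in>C. a i) * (\<Prod>i\<in>C. \<xi> i x)) \<partial>M) =
          (\<integral>x. ((\<Prod>i\<in>B. a i) * (\<Prod>i\<in>C. a i)) * ((\<Prod>i\<in>B. \<xi> i x) * (\<Prod>i\<in>C. \<xi> i x)) \<partial>M)"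
        by (simp add: mult_ac)
      also have "\<dots> = 0" using prod_\<xi>_orthogonal(2) [of B C] that by simp
      finally show ?thesis .
    qed
  qed (auto intro: square_integrable_cmult square_integrable_prod_\<xi>)
  also have "\<dots> = (\<Sum>B | B \<subseteq> A \<and> card B = k. \<Prod>i\<in>B. (a i)\<^sup>2 * v i)"
  proof (rule sum.cong [OF refl])
    fix B assume "B \<in> {B. B \<subseteq> A \<and> card B = k}"
    then show "(\<integral>x. ((\<Prod>i\<in>B. a i) * (\<Prod>i\<in>B. \<xi> i x))\<^sup>2 \<partial>M) = (\<Prod>i\<in>B. (a i)\<^sup>2 * v i)"
      using prod_\<xi>_orthogonal(2) [of B B]
      by (simp add: power_mult_distrib prod.distrib prod_power_distrib [symmetric])
         (simp add: power2_eq_square)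
  qed
  finally show ?thesis .
qed

text \<open>The series of symmetric functions at 2 is bounded by the product, whence the geometric decay.\<close>
lemma integral_elem_square_le:
  "(\<integral>x. (elem a k x)\<^sup>2 \<partial>M) \<le> exp (2 * (\<Sum>i\<in>A. (a i)\<^sup>2 * v i)) / 2 ^ k"
proof -
  let ?y = "\<lambda>i. (a i)\<^sup>2 * v i"
  have y: "?y i \<ge> 0" if "i \<in> A" for i using v_pos [OF that] by simp
  have "2 ^ k * (\<integral>x. (elem a k x)\<^sup>2 \<partial>M) = (\<Sum>B | B \<subseteq> A \<and> card B = k. \<Prod>i\<in>B. 2 * ?y i)"
    unfolding integral_elem_square sum_distrib_left by (intro sum.cong refl) (auto simp: prod.distrib)
  also have "\<dots> \<le> (\<Sum>B\<in>Pow A. \<Prod>i\<in>B. 2 * ?y i)"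
    using y finite_A by (intro sum_mono2) (auto intro!: prod_nonneg simp: less_imp_le [OF v_pos] subset_iff)
  also have "\<dots> = (\<Prod>i\<in>A. 2 * ?y i + 1)"
    using prod_add [OF finite_A, of "\<lambda>i. 2 * ?y i" "\<lambda>_. 1"] by simp
  also have "\<dots> \<le> (\<Prod>i\<in>A. exp (2 * ?y i))"
  proof (intro prod_mono conjI)
    fix i assume "i \<in> A"
    then show "0 \<le> 2 * ?y i + 1" using y [of i] by linarith
    show "2 * ?y i + 1 \<le> exp (2 * ?y i)" using exp_ge_add_one_self [of "2 * ?y i"] by linarith
  qed
  also have "\<dots> = exp (2 * (\<Sum>i\<in>A. ?y i))"
    by (simp add: exp_sum [OF finite_A] sum_distrib_left)
  finally show ?thesis by (simp add: field_simps)
qed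

text \<open>With L the sum of \<open>a i * \<xi> i\<close> and s its variance, the product is the
  part of the Wick exponential exp(i L + s / 2) of degree at most one in each variable.\<close>

definition wick :: "('i \<Rightarrow> real) \<Rightarrow> real \<Rightarrow> 'a \<Rightarrow> real" where
  "wick a b x = Re (cis b * (\<Prod>i\<in>A. 1 + \<i> * (a i * \<xi> i x)))"

lemma elem_eq_0:
  assumes "k > card A"
  shows "elem a k x = 0"
proof -
  have "{B. B \<subseteq> A \<and> card B = k} = {}" using assms by (auto dest: card_mono [OF finite_A])
  then show ?thesis by (simp only: elem_def sum.empty)
qed

text \<open>The upper limit may exceed \<open>card A\<close>, so that expansions over different
  grids can be written over a common range of orders.\<close>

lemma wick_eq_sum:
  assumes "card A \<le> m"
  shows "wick a b x = (\<Sum>k\<le>m. Re (cis b * \<i> ^ k) * elem a k x)"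
proof -
  have "(\<Prod>i\<in>A. 1 + \<i> * (a i * \<xi> i x)) = (\<Sum>B\<in>Pow A. \<i> ^ card B * of_real (\<Prod>i\<in>B. a i * \<xi> i x))"
    using prod_add [OF finite_A, of "\<lambda>i. \<i> * (a i * \<xi> i x)" "\<lambda>_. 1"]
    by (simp add: add.commute prod.distrib)
  also have "\<dots> = (\<Sum>k\<le>card A. \<Sum>B | B \<in> Pow A \<and> card B = k. \<i> ^ card B * of_real (\<Prod>i\<in>B. a i * \<xi> i x))"
    using finite_A by (subst sum.group) (auto intro: card_mono)
  also have "\<dots> = (\<Sum>k\<le>card A. \<i> ^ k * of_real (elem a k x))"
    unfolding elem_def of_real_sum sum_distrib_left by (intro sum.cong refl) auto
  finally have "wick a b x = (\<Sum>k\<le>card A. Re (cis b * \<i> ^ k * of_real (elem a k x)))"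
    by (simp add: wick_def sum_distrib_left mult.assoc)
  also have "\<dots> = (\<Sum>k\<le>card A. Re (cis b * \<i> ^ k) * elem a k x)" by simp
  also have "\<dots> = (\<Sum>k\<le>m. Re (cis b * \<i> ^ k) * elem a k x)"
    using assms by (intro sum.mono_neutral_left) (auto simp: elem_eq_0)
  finally show ?thesis .
qed

lemma square_integrable_wick: "square_integrable M (wick a b)"
  unfolding wick_eq_sum [OF order_refl]
  by (intro square_integrable_sum square_integrable_cmult square_integrable_elem)

text \<open>Orthogonality of the orders reduces the tail to a geometric series. The bound sees the
  family only through the sum of \<open>(a i)\<^sup>2 * v i\<close>, hence is uniform over grid
  refinements that preserve this sum.\<close>

lemma wick_partial_sum:
  "(\<integral>x. (wick a b x - (\<Sum>k\<le>n. Re (cis b * \<i> ^ k) * elem a k x))\<^sup>2 \<partial>M)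
    \<le> exp (2 * (\<Sum>i\<in>A. (a i)\<^sup>2 * v i)) / 2 ^ n"
proof -
  let ?c = "\<lambda>k. Re (cis b * \<i> ^ k)" and ?E = "exp (2 * (\<Sum>i\<in>A. (a i)\<^sup>2 * v i))"
  let ?m = "max n (card A)"
  have "wick a b x = (\<Sum>k\<le>?m. ?c k * elem a k x)" for x by (rule wick_eq_sum) simp
  moreover have "{..?m} = {..n} \<union> {n<..?m}" by auto
  ultimately have eq: "wick a b x - (\<Sum>k\<le>n. ?c k * elem a k x) = (\<Sum>k\<in>{n<..?m}. ?c k * elem a k x)" for x
    by (simp add: sum.union_disjoint Int_def del: max.bounded_iff)
  have "(\<integral>x. (wick a b x - (\<Sum>k\<le>n. ?c k * elem a k x))\<^sup>2 \<partial>M) = (\<Sum>k\<in>{n<..?m}. \<integral>x. (?c k * elem a k x)\<^sup>2 \<partial>M)"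
    unfolding eq
  proof (rule integral_square_sum_orthogonal)
    show "(\<integral>x. ?c k * elem a k x * (?c l * elem a l x) \<partial>M) = 0" if "k \<noteq> l" for k l
    proof -
      have "(\<integral>x. ?c k * elem a k x * (?c l * elem a l x) \<partial>M) = (\<integral>x. (?c k * ?c l) * (elem a k x * elem a l x) \<partial>M)"
        by (rule Bochner_Integration.integral_cong) (simp_all only: mult_ac)
      then show ?thesis by (simp only: integral_mult_right_zero homogeneous_orthogonal [OF homogeneous_elem homogeneous_elem that])
    qed
  qed (auto intro: square_integrable_cmult square_integrable_elem)
  also have "\<dots> \<le> (\<Sum>k\<in>{n<..?m}. ?E * (1 / 2) ^ k)"
  proof (rule sum_mono)
    fix k
    have "\<bar>?c k\<bar> \<le> 1" using abs_Re_le_cmod [of "cis b * \<i> ^ k"] by (simp add: norm_mult norm_power)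
    then have "(?c k)\<^sup>2 \<le> 1" by (simp only: abs_square_le_1)
    have "(\<integral>x. (?c k * elem a k x)\<^sup>2 \<partial>M) = (?c k)\<^sup>2 * (\<integral>x. (elem a k x)\<^sup>2 \<partial>M)"
      by (simp only: power_mult_distrib integral_mult_right_zero)
    also have "\<dots> \<le> 1 * (\<integral>x. (elem a k x)\<^sup>2 \<partial>M)"
      using \<open>(?c k)\<^sup>2 \<le> 1\<close> by (intro mult_right_mono) simp_all
    also have "\<dots> \<le> ?E * (1 / 2) ^ k" using integral_elem_square_le [of a k] by (simp add: power_divide)
    finally show "(\<integral>x. (?c k * elem a k x)\<^sup>2 \<partial>M) \<le> ?E * (1 / 2) ^ k" .
  qed
  also have "\<dots> = ?E * (\<Sum>k\<in>{n<..?m}. (1 / 2) ^ k)" by (simp only: sum_distrib_left)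
  also have "(\<Sum>k\<in>{n<..?m}. (1 / 2) ^ k) \<le> (1 / 2 :: real) ^ n"
  proof -
    \<comment> \<open>The negative term is what carries the induction on \<open>m\<close>.\<close>
    have "(\<Sum>k\<in>{n<..m}. (1 / 2) ^ k) \<le> (1 / 2 :: real) ^ n - (1 / 2) ^ m" if "n \<le> m" for m
      using that
    proof (induction m rule: dec_induct)
      case (step m)
      then have "{n<..Suc m} = insert (Suc m) {n<..m}" by auto
      with step show ?case by simp
    qed simp
    from this [of ?m] show ?thesis
      by (meson diff_le_eq le_add_same_cancel1 max.cobounded1 order_trans zero_le_power zero_le_divide_1_iff zero_le_numeral)
  qed
  finally show ?thesis by (simp add: power_divide)
qed

text \<open>Since \<open>E((1 + i a \<xi>) e\<^bsup>- i a \<xi>\<^esup>) = (1 + a\<^sup>2 v) e\<^bsup>- a\<^sup>2 v / 2\<^esup>\<close>, the cross term of the square equals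
  the second moment of the product.\<close>
lemma wick_approx:
  fixes a :: "'i \<Rightarrow> real" and b :: real
  defines "s \<equiv> (\<Sum>i\<in>A. (a i)\<^sup>2 * v i)"
  shows "(\<integral>x. (wick a b x - exp (s / 2) * cos ((\<Sum>i\<in>A. a i * \<xi> i x) + b))\<^sup>2 \<partial>M)
    \<le> exp s - (\<Prod>i\<in>A. 1 + (a i)\<^sup>2 * v i)"
proof -
  define P where "P x = (\<Prod>i\<in>A. 1 + \<i> * (a i * \<xi> i x))" for x
  define G where "G x = complex_of_real (exp (s / 2)) * iexp (\<Sum>i\<in>A. a i * \<xi> i x)" for x
  note [measurable] = measurable_\<xi>
  have [measurable]: "P \<in> borel_measurable M" "G \<in> borel_measurable M"
    unfolding P_def G_def by measurable
  have ind1: "indep_vars (\<lambda>_. borel) (\<lambda>i x. 1 + (a i)\<^sup>2 * (\<xi> i x)\<^sup>2) A"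
    by (rule indep_vars_compose2 [OF indep]) simp
  have int1: "integrable M (\<lambda>x. 1 + (a i)\<^sup>2 * (\<xi> i x)\<^sup>2)" if "i \<in> A" for i using moments(3) [OF that that] by simp
  have normP: "(cmod (P x))\<^sup>2 = (\<Prod>i\<in>A. 1 + (a i)\<^sup>2 * (\<xi> i x)\<^sup>2)" for x
    by (simp add: P_def prod_power_distrib cmod_power2 power_mult_distrib flip: prod_norm)
  have intP: "integrable M (\<lambda>x. (cmod (P x))\<^sup>2)"
    unfolding normP by (rule indep_vars_integrable [OF finite_A ind1 int1])
  have EP: "(\<integral>x. (cmod (P x))\<^sup>2 \<partial>M) = (\<Prod>i\<in>A. 1 + (a i)\<^sup>2 * v i)"
  proof -
    have "(\<integral>x. (cmod (P x))\<^sup>2 \<partial>M) = (\<Prod>i\<in>A. \<integral>x. 1 + (a i)\<^sup>2 * (\<xi> i x)\<^sup>2 \<partial>M)"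
      unfolding normP by (rule indep_vars_lebesgue_integral [OF finite_A ind1 int1])
    also have "\<dots> = (\<Prod>i\<in>A. 1 + (a i)\<^sup>2 * v i)"
      using moments(3,4) by (intro prod.cong refl) (simp add: prob_space)
    finally show ?thesis .
  qed
  have normG: "(cmod (G x))\<^sup>2 = exp s" for x
    by (simp add: G_def norm_mult power_mult_distrib flip: exp_of_nat_mult)
  let ?h = "\<lambda>i x. iexp (- a i * \<xi> i x) + \<i> * a i * (\<xi> i x * iexp (- a i * \<xi> i x))"
  have ind2: "indep_vars (\<lambda>_. borel) ?h A"
    by (rule indep_vars_compose2 [OF indep]) measurable
  have int2: "complex_integrable M (?h i)" if "i \<in> A" for i
    using moments(5,7) [OF that that, of "- a i"] by (intro Bochner_Integration.integrable_add integrable_mult_right)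
  have PG: "P x * cnj (G x) = complex_of_real (exp (s / 2)) * (\<Prod>i\<in>A. ?h i x)" for x
  proof -
    have "cnj (iexp (\<Sum>i\<in>A. a i * \<xi> i x)) = (\<Prod>i\<in>A. iexp (- a i * \<xi> i x))"
      by (simp add: exp_cnj sum_distrib_left exp_sum [OF finite_A, symmetric] sum_negf)
    then show ?thesis
      by (simp add: P_def G_def prod.distrib [symmetric] algebra_simps)
  qed
  have intPG: "complex_integrable M (\<lambda>x. P x * cnj (G x))"
    unfolding PG by (intro integrable_mult_right indep_vars_integrable [OF finite_A ind2 int2])
  have "(CLINT x|M. P x * cnj (G x)) = complex_of_real (exp (s / 2)) * (\<Prod>i\<in>A. CLINT x|M. ?h i x)"
    unfolding PG integral_mult_right_zero
    by (rule arg_cong2 [OF refl indep_vars_lebesgue_integral [OF finite_A ind2 int2]])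
  also have "(\<Prod>i\<in>A. CLINT x|M. ?h i x) = (\<Prod>i\<in>A. complex_of_real ((1 + (a i)\<^sup>2 * v i) * exp (- (a i)\<^sup>2 * v i / 2)))"
  proof (rule prod.cong [OF refl])
    fix i assume i: "i \<in> A"
    have "(CLINT x|M. ?h i x) = (CLINT x|M. iexp (- a i * \<xi> i x)) + \<i> * a i * (CLINT x|M. \<xi> i x * iexp (- a i * \<xi> i x))"
      using moments(5,7) [OF i i, of "- a i"]
      by (subst Bochner_Integration.integral_add) (auto simp del: of_real_minus of_real_mult)
    also have "\<dots> = complex_of_real ((1 + (a i)\<^sup>2 * v i) * exp (- (a i)\<^sup>2 * v i / 2))"
      unfolding moments(6,8) [OF i i] by (simp add: algebra_simps power2_eq_square)
    finally show "(CLINT x|M. ?h i x) = complex_of_real ((1 + (a i)\<^sup>2 * v i) * exp (- (a i)\<^sup>2 * v i / 2))" .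
  qed
  also have "complex_of_real (exp (s / 2)) * \<dots> = complex_of_real (\<Prod>i\<in>A. 1 + (a i)\<^sup>2 * v i)"
  proof -
    have "exp (s / 2) * (\<Prod>i\<in>A. exp (- (a i)\<^sup>2 * v i / 2)) = 1"
      by (simp add: s_def sum_divide_distrib sum_negf flip: exp_sum [OF finite_A] exp_add)
    then have "exp (s / 2) * ((\<Prod>i\<in>A. 1 + (a i)\<^sup>2 * v i) * (\<Prod>i\<in>A. exp (- (a i)\<^sup>2 * v i / 2)))
        = (\<Prod>i\<in>A. 1 + (a i)\<^sup>2 * v i)"
      by (simp only: mult.left_commute [of "exp _"] mult_1_right)
    then show ?thesis
      by (simp only: of_real_mult [symmetric] of_real_prod [symmetric] prod.distrib)
  qed
  finally have EPG: "(CLINT x|M. P x * cnj (G x)) = complex_of_real (\<Prod>i\<in>A. 1 + (a i)\<^sup>2 * v i)" .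
  have exp2: "(cmod (P x - G x))\<^sup>2 = (cmod (P x))\<^sup>2 + exp s - 2 * Re (P x * cnj (G x))" for x
    unfolding normG [of x, symmetric] cmod_power2 by (simp add: power2_eq_square algebra_simps)
  have intD: "integrable M (\<lambda>x. (cmod (P x - G x))\<^sup>2)"
    unfolding exp2 using intP intPG
    by (intro Bochner_Integration.integrable_diff Bochner_Integration.integrable_add integrable_mult_right
        integrable_Re) auto
  have "(\<integral>x. (cmod (P x - G x))\<^sup>2 \<partial>M) = exp s - (\<Prod>i\<in>A. 1 + (a i)\<^sup>2 * v i)"
  proof -
    have "integrable M (\<lambda>x. Re (P x * cnj (G x)))" "(\<integral>x. Re (P x * cnj (G x)) \<partial>M) = (\<Prod>i\<in>A. 1 + (a i)\<^sup>2 * v i)"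
      using intPG EPG by (simp_all only: integral_Re integrable_Re Re_complex_of_real)
    then show ?thesis unfolding exp2 using intP EP by (simp add: prob_space del: times_complex.sel)
  qed
  \<comment> \<open>Multiplication by \<open>cis b\<close> is an isometry and taking real parts a
    contraction, so one complex estimate serves all phases.\<close>
  moreover have "(\<integral>x. (wick a b x - exp (s / 2) * cos ((\<Sum>i\<in>A. a i * \<xi> i x) + b))\<^sup>2 \<partial>M) \<le> (\<integral>x. (cmod (P x - G x))\<^sup>2 \<partial>M)"
  proof (rule integral_mono')
    fix x
    have "exp (s / 2) * cos ((\<Sum>i\<in>A. a i * \<xi> i x) + b) = Re (cis b * G x)"
      by (simp add: G_def exp_i_of_real_eq_cis cos_add del: of_real_sum of_real_mult) (simp add: algebra_simps)
    then have "wick a b x - exp (s / 2) * cos ((\<Sum>i\<in>A. a i * \<xi> i x) + b) = Re (cis b * (P x - G x))"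
      by (simp add: wick_def P_def algebra_simps)
    moreover have "\<bar>Re (cis b * (P x - G x))\<bar> \<le> cmod (P x - G x)"
      using abs_Re_le_cmod [of "cis b * (P x - G x)"] by (simp add: norm_mult)
    ultimately show "(wick a b x - exp (s / 2) * cos ((\<Sum>i\<in>A. a i * \<xi> i x) + b))\<^sup>2 \<le> (cmod (P x - G x))\<^sup>2"
      by (metis abs_le_square_iff abs_norm_cancel)
  qed (use intD in auto)
  ultimately show ?thesis by linarith
qed

end

section \<open>Chaos orthogonality\<close>

lemma continuous_on_path: "continuous_on S (\<lambda>\<omega>. path \<omega> t)"
proof (cases "t \<in> {0..1}")
  case True
  then have "dist (path \<omega> t) (path \<eta> t) \<le> dist \<omega> \<eta>" for \<omega> \<eta> :: "'a wiener" by (rule dist_path_le)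
  then show ?thesis unfolding continuous_on_iff by (meson le_less_trans)
qed (simp add: path_outside)

lemma measurable_path [measurable]: "(\<lambda>\<omega>. path \<omega> t) \<in> borel_measurable borel"
  by (intro borel_measurable_continuous_onI continuous_on_path)

lemma measurable_vec_nth [measurable]: "(\<lambda>x :: real ^ 'n. x $ i) \<in> borel_measurable borel"
  by (intro borel_measurable_continuous_onI continuous_intros)

lemma chaos_square_integrable: "X \<in> chaos \<mu> k \<Longrightarrow> square_integrable \<mu> X"
  by (auto simp: chaos_def has_multiple_Ito_integral_def L2_tendsto_def)

text \<open>Paths vanish at 0, so on a grid starting at 0 the path values at grid times are sums of
  increments.\<close>

definition grid :: "nat \<Rightarrow> (nat \<Rightarrow> real) \<Rightarrow> bool" where
  "grid n \<tau> \<longleftrightarrow> \<tau> 0 = 0 \<and> (\<forall>i<n. \<tau> i < \<tau> (Suc i)) \<and> \<tau> n \<le> 1"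

text \<open>The pair \<open>(i, c)\<close> names the cell \<open>(\<tau> i, \<tau> (Suc i)]\<close>
  in coordinate c. Its Wiener integral is \<open>incr\<close>, and its length \<open>gap\<close> is
  the variance of that integral.\<close>

definition atoms :: "nat \<Rightarrow> (nat \<times> 'd::finite) set" where
  "atoms n = {..<n} \<times> UNIV"

definition incr :: "(nat \<Rightarrow> real) \<Rightarrow> nat \<times> 'd \<Rightarrow> ('d::finite) wiener \<Rightarrow> real" where
  "incr \<tau> \<alpha> \<omega> = (path \<omega> (\<tau> (Suc (fst \<alpha>))) - path \<omega> (\<tau> (fst \<alpha>))) $ snd \<alpha>"

definition gap :: "(nat \<Rightarrow> real) \<Rightarrow> nat \<times> 'd \<Rightarrow> real" where
  "gap \<tau> \<alpha> = \<tau> (Suc (fst \<alpha>)) - \<tau> (fst \<alpha>)"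

lemma grid_mono:
  assumes "grid n \<tau>" "j \<le> n" "i \<le> j"
  shows "\<tau> i \<le> \<tau> j"
  using assms(3,2)
proof (induction j)
  case (Suc j)
  then have "\<tau> j < \<tau> (Suc j)" using assms(1) by (simp add: grid_def)
  with Suc show ?case by (cases "i = Suc j") auto
qed simp

lemma grid_strict_mono:
  assumes "grid n \<tau>" "j \<le> n" "i < j"
  shows "\<tau> i < \<tau> j"
proof -
  have "\<tau> i < \<tau> (Suc i)" using assms by (auto simp: grid_def)
  also have "\<dots> \<le> \<tau> j" using assms by (intro grid_mono [OF assms(1)]) auto
  finally show ?thesis .
qed

lemma grid_less_iff:
  assumes "grid n \<tau>" "i \<le> n" "j \<le> n"
  shows "\<tau> i < \<tau> j \<longleftrightarrow> i < j"
  using grid_strict_mono [OF assms(1), of j i] grid_strict_mono [OF assms(1), of i j] assms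
  by (metis less_asym linorder_neqE_nat)

lemma grid_le_iff:
  assumes "grid n \<tau>" "i \<le> n" "j \<le> n"
  shows "\<tau> i \<le> \<tau> j \<longleftrightarrow> i \<le> j"
  using grid_less_iff [OF assms(1,3,2)] by (simp add: not_less [symmetric])

lemma grid_range:
  assumes "grid n \<tau>" "i \<le> n"
  shows "0 \<le> \<tau> i" "\<tau> i \<le> 1"
  using grid_mono [OF assms(1) assms(2), of 0] grid_mono [OF assms(1) order_refl assms(2)] assms(1)
  by (auto simp: grid_def)

text \<open>The grid is the sorted list of T with 0 inserted; it has n = 0 steps when T has no
  positive element.\<close>

lemma grid_exists:
  assumes "finite T" "T \<subseteq> {0..1}"
  shows "\<exists>n \<tau>. grid n \<tau> \<and> T \<subseteq> \<tau> ` {..n}"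
proof -
  define xs where "xs = sorted_list_of_set (insert 0 T)"
  have xs: "set xs = insert 0 T" "sorted_wrt (<) xs"
    using assms(1) unfolding xs_def
    by (simp_all only: finite_insert set_sorted_list_of_set strict_sorted_list_of_set)
  then have len: "length xs > 0" by (cases xs) auto
  define n where "n = length xs - 1"
  have "xs ! 0 = 0"
  proof -
    obtain i where i: "i < length xs" "xs ! i = 0" using xs(1) by (metis in_set_conv_nth insertI1)
    have "xs ! 0 \<in> insert 0 T" using len xs(1) by (metis nth_mem)
    then have "xs ! 0 \<ge> 0" using assms(2) by auto
    moreover have "xs ! 0 \<le> 0"
      using sorted_wrt_nth_less [OF xs(2), of 0 i] i by (cases "i = 0") auto
    ultimately show ?thesis by simp
  qed
  moreover have "xs ! i < xs ! Suc i" if "i < n" for i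
    using that by (intro sorted_wrt_nth_less [OF xs(2)]) (auto simp: n_def)
  moreover have "xs ! n \<le> 1"
  proof -
    have "xs ! n \<in> insert 0 T" using len xs(1) by (metis diff_less n_def nth_mem zero_less_one)
    then show ?thesis using assms(2) by auto
  qed
  moreover have "T \<subseteq> (!) xs ` {..n}"
  proof
    fix t assume "t \<in> T"
    then obtain i where "i < length xs" "xs ! i = t" using xs(1) by (metis in_set_conv_nth insertI2)
    then show "t \<in> (!) xs ` {..n}" by (auto simp: n_def)
  qed
  ultimately show ?thesis unfolding grid_def by blast
qed

lemma incr_telescope:
  assumes "i \<le> j"
  shows "(path \<omega> (\<tau> j) - path \<omega> (\<tau> i)) $ c = (\<Sum>k\<in>{i..<j}. incr \<tau> (k, c) \<omega>)"
  using sum_Suc_diff' [OF assms, of "\<lambda>k. path \<omega> (\<tau> k) $ c"] by (simp add: incr_def)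

text \<open>Cells are open on the left, so an atom lies in the cell exactly when its right end point
  does; the increments then telescope.\<close>

lemma cell_incr_grid:
  assumes g: "grid n \<tau>" and st: "s \<in> \<tau> ` {..n}" "t \<in> \<tau> ` {..n}" "s \<le> t"
  shows "cell_incr (s, t, c) \<omega> =
    (\<Sum>\<alpha> | \<alpha> \<in> atoms n \<and> (\<tau> (Suc (fst \<alpha>)), snd \<alpha>) \<in> cell_set (s, t, c). incr \<tau> \<alpha> \<omega>)"
proof -
  obtain i j where ij: "i \<le> n" "j \<le> n" "s = \<tau> i" "t = \<tau> j" using st by auto
  have "i \<le> j" using st(3) grid_le_iff [OF g ij(1,2)] ij by simp
  have "{\<alpha>. \<alpha> \<in> atoms n \<and> (\<tau> (Suc (fst \<alpha>)), snd \<alpha>) \<in> cell_set (s, t, c)} = (\<lambda>k. (k, c)) ` {i..<j}"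
    using ij by (auto simp: atoms_def image_iff grid_less_iff [OF g] grid_le_iff [OF g])
  then show ?thesis
    using incr_telescope [OF \<open>i \<le> j\<close>, of \<omega> \<tau> c] ij by (simp add: sum.reindex inj_on_def)
qed

section \<open>Step integrals over a grid and orthogonality of different orders\<close>

locale wiener_process =
  fixes \<mu> :: "('d::finite) wiener measure"
  assumes wiener: "wiener_measure \<mu>"
begin

sublocale prob_space \<mu>
  using wiener by (simp add: wiener_measure_def)

lemma sets_\<mu> [simp, measurable_cong]: "sets \<mu> = sets borel"
  using wiener by (simp add: wiener_measure_def)

lemma space_\<mu> [simp]: "space \<mu> = UNIV"
  using sets_eq_imp_space_eq [OF sets_\<mu>] by simp

lemma gaussian_grid:
  assumes "grid n \<tau>"
  shows "gaussian_family \<mu> (atoms n) (incr \<tau>) (gap \<tau>)"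
proof
  have w: "indep_vars (\<lambda>_. borel) (\<lambda>(i, c) \<omega>. (path \<omega> (\<tau> (Suc i)) - path \<omega> (\<tau> i)) $ c) ({..<n} \<times> (UNIV :: 'd set))"
    "\<And>i c. i < n \<Longrightarrow> distributed \<mu> lborel (\<lambda>\<omega>. (path \<omega> (\<tau> (Suc i)) - path \<omega> (\<tau> i)) $ c)
        (normal_density 0 (sqrt (\<tau> (Suc i) - \<tau> i)))"
    using wiener assms unfolding wiener_measure_def grid_def by auto
  show "finite (atoms n :: (nat \<times> 'd) set)" by (simp add: atoms_def)
  have "incr \<tau> = (\<lambda>(i, c) \<omega>. (path \<omega> (\<tau> (Suc i)) - path \<omega> (\<tau> i)) $ (c :: 'd))"
    by (auto simp: incr_def fun_eq_iff)
  then show "indep_vars (\<lambda>_. borel) (incr \<tau>) (atoms n :: (nat \<times> 'd) set)" using w(1) by (simp add: atoms_def)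
  fix \<alpha> :: "nat \<times> 'd" assume "\<alpha> \<in> atoms n"
  then obtain i c where "\<alpha> = (i, c)" "i < n" by (auto simp: atoms_def)
  then show "0 < gap \<tau> \<alpha>" "distributed \<mu> lborel (incr \<tau> \<alpha>) (normal_density 0 (sqrt (gap \<tau> \<alpha>)))"
    using assms w(2) [of i c] by (simp_all add: incr_def [abs_def] gap_def grid_def)
qed

definition endpoints :: "'d step_kernel \<Rightarrow> real set" where
  "endpoints S = (\<Union>(a, bs)\<in>set S. \<Union>(s, t, c)\<in>set bs. {s, t})"

lemma endpoints:
  assumes "step_kernel k S"
  shows "finite (endpoints S)" "endpoints S \<subseteq> {0..1}"
  using assms unfolding endpoints_def step_kernel_def by fastforce+

text \<open>Expanding the product of sums gives one monomial per choice of an atom from each cell.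
  Disjointness of the cells makes each choice injective, so the monomial is square-free of degree
  exactly k.\<close>

lemma prod_cell_incr_homogeneous:
  fixes bs :: "'d cell list"
  assumes g: "grid n \<tau>" and len: "length bs = k"
    and cells: "\<And>s t c. (s, t, c) \<in> set bs \<Longrightarrow> s < t \<and> s \<in> \<tau> ` {..n} \<and> t \<in> \<tau> ` {..n}"
    and disj: "\<And>i j. i < k \<Longrightarrow> j < k \<Longrightarrow> i \<noteq> j \<Longrightarrow> cell_set (bs ! i) \<inter> cell_set (bs ! j) = {}"
  shows "gaussian_family.homogeneous (atoms n) (incr \<tau>) k (\<lambda>\<omega>. \<Prod>i<k. cell_incr (bs ! i) \<omega>)"
proof -
  interpret G: gaussian_family \<mu> "atoms n" "incr \<tau>" "gap \<tau>" by (rule gaussian_grid [OF g])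
  define C where "C i = {\<alpha>. \<alpha> \<in> atoms n \<and> (\<tau> (Suc (fst \<alpha>)), snd \<alpha>) \<in> cell_set (bs ! i)}" for i
  have fin: "finite (C i)" for i by (rule finite_subset [OF _ G.finite_A]) (auto simp: C_def)
  have eq: "(\<Prod>i<k. cell_incr (bs ! i) \<omega>) = (\<Sum>f\<in>PiE {..<k} C. \<Prod>\<alpha>\<in>f ` {..<k}. incr \<tau> \<alpha> \<omega>)" for \<omega>
  proof -
    have "(\<Prod>i<k. cell_incr (bs ! i) \<omega>) = (\<Prod>i<k. \<Sum>\<alpha>\<in>C i. incr \<tau> \<alpha> \<omega>)"
    proof (rule prod.cong [OF refl])
      fix i assume "i \<in> {..<k}"
      then have "bs ! i \<in> set bs" using len by simp
      moreover obtain s t c where stc: "bs ! i = (s, t, c)" by (cases "bs ! i")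
      ultimately have "s < t" "s \<in> \<tau> ` {..n}" "t \<in> \<tau> ` {..n}" using cells [of s t c] by auto
      then show "cell_incr (bs ! i) \<omega> = (\<Sum>\<alpha>\<in>C i. incr \<tau> \<alpha> \<omega>)"
        unfolding C_def stc by (intro cell_incr_grid [OF g]) auto
    qed
    also have "\<dots> = (\<Sum>f\<in>PiE {..<k} C. \<Prod>i<k. incr \<tau> (f i) \<omega>)"
      by (rule prod_sum_PiE) (auto simp: fin)
    also have "\<dots> = (\<Sum>f\<in>PiE {..<k} C. \<Prod>\<alpha>\<in>f ` {..<k}. incr \<tau> \<alpha> \<omega>)"
    proof (rule sum.cong [OF refl])
      fix f assume "f \<in> PiE {..<k} C"
      then have "inj_on f {..<k}" using disj by (fastforce simp: inj_on_def PiE_iff C_def)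
      then show "(\<Prod>i<k. incr \<tau> (f i) \<omega>) = (\<Prod>\<alpha>\<in>f ` {..<k}. incr \<tau> \<alpha> \<omega>)"
        by (simp add: prod.reindex)
    qed
    finally show ?thesis .
  qed
  show ?thesis
    unfolding eq
  proof (rule G.homogeneous_sum)
    fix f assume f: "f \<in> PiE {..<k} C"
    then have "inj_on f {..<k}" using disj by (fastforce simp: inj_on_def PiE_iff C_def)
    then show "G.homogeneous k (\<lambda>\<omega>. \<Prod>\<alpha>\<in>f ` {..<k}. incr \<tau> \<alpha> \<omega>)"
      using f by (intro G.homogeneous_prod) (auto simp: card_image C_def PiE_iff)
  qed
qed

lemma step_integral_homogeneous:
  fixes S :: "'d step_kernel"
  assumes g: "grid n \<tau>" and S: "step_kernel k S" "endpoints S \<subseteq> \<tau> ` {..n}"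
  shows "gaussian_family.homogeneous (atoms n) (incr \<tau>) k (step_integral S)"
proof -
  interpret G: gaussian_family \<mu> "atoms n" "incr \<tau>" "gap \<tau>" by (rule gaussian_grid [OF g])
  have "G.homogeneous k (\<lambda>\<omega>. a * (\<Prod>i<length bs. cell_incr (bs ! i) \<omega>))" if "(a, bs) \<in> set S" for a bs
  proof -
    have "length bs = k" "\<forall>i<k. \<forall>j<k. i \<noteq> j \<longrightarrow> cell_set (bs ! i) \<inter> cell_set (bs ! j) = {}"
      "\<forall>(s, t, c) \<in> set bs. 0 \<le> s \<and> s < t \<and> t \<le> 1"
      using bspec [OF S(1) [unfolded step_kernel_def] that] by auto
    moreover have "s < t \<and> s \<in> \<tau> ` {..n} \<and> t \<in> \<tau> ` {..n}" if "(s, t, c) \<in> set bs" for s t c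
      using that \<open>(a, bs) \<in> set S\<close> S(2) calculation(3) unfolding endpoints_def by fastforce
    ultimately show ?thesis
      by (intro G.homogeneous_cmult) (simp, intro prod_cell_incr_homogeneous [OF g], auto)
  qed
  then show ?thesis
    unfolding step_integral_def [abs_def]
    by (induction S) (auto intro: G.homogeneous_add G.homogeneous_zero)
qed

text \<open>A common grid containing the end points of both kernels turns the two integrals into
  homogeneous forms of different degrees.\<close>

lemma step_integral_orthogonal:
  assumes S: "step_kernel k S" "step_kernel l S'" and "k \<noteq> l"
  shows "(\<integral>\<omega>. step_integral S \<omega> * step_integral S' \<omega> \<partial>\<mu>) = 0"
proof -
  obtain n \<tau> where g: "grid n \<tau>" "endpoints S \<union> endpoints S' \<subseteq> \<tau> ` {..n}"
    using grid_exists [of "endpoints S \<union> endpoints S'"] endpoints S by (metis Un_least finite_Un)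
  interpret G: gaussian_family \<mu> "atoms n" "incr \<tau>" "gap \<tau>" by (rule gaussian_grid [OF g(1)])
  show ?thesis
    using g S by (intro G.homogeneous_orthogonal [OF _ _ \<open>k \<noteq> l\<close>] step_integral_homogeneous) auto
qed

lemma chaos_orthogonal:
  assumes "X \<in> chaos \<mu> k" "Y \<in> chaos \<mu> l" "k \<noteq> l"
  shows "(\<integral>\<omega>. X \<omega> * Y \<omega> \<partial>\<mu>) = 0"
proof -
  obtain S S' where S: "\<And>n. step_kernel k (S n)" "\<And>n. step_kernel l (S' n)"
    and lim: "L2_tendsto \<mu> (\<lambda>n. step_integral (S n)) X" "L2_tendsto \<mu> (\<lambda>n. step_integral (S' n)) Y"
    using assms unfolding chaos_def has_multiple_Ito_integral_def by blast
  have "(\<lambda>n. 0) \<longlonglongrightarrow> (\<integral>\<omega>. X \<omega> * Y \<omega> \<partial>\<mu>)"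
    using tendsto_integral_mult_L2 [OF lim] step_integral_orthogonal [OF S \<open>k \<noteq> l\<close>] by simp
  then show ?thesis by (simp add: LIMSEQ_const_iff)
qed

end

section \<open>Wiener integrals and their dyadic kernels\<close>

lemma step_eval_cmult: "step_eval (map (\<lambda>(a, bs). (c * a, bs)) S) = (\<lambda>x. c * step_eval S x)"
proof
  show "step_eval (map (\<lambda>(a, bs). (c * a, bs)) S) x = c * step_eval S x" for x
    unfolding step_eval_def by (induction S) (auto simp: distrib_left)
qed

lemma step_integral_cmult: "step_integral (map (\<lambda>(a, bs). (c * a, bs)) S) = (\<lambda>\<omega>. c * step_integral S \<omega>)"
proof
  show "step_integral (map (\<lambda>(a, bs). (c * a, bs)) S) \<omega> = c * step_integral S \<omega>" for \<omega>
    unfolding step_integral_def by (induction S) (auto simp: distrib_left)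
qed

lemma chaos_cmult:
  assumes "X \<in> chaos \<mu> k"
  shows "(\<lambda>\<omega>. c * X \<omega>) \<in> chaos \<mu> k"
proof -
  from assms obtain f S where S: "\<And>n. step_kernel k (S n)"
    and lim: "L2_tendsto (kernel_space TYPE('a) k) (\<lambda>n. step_eval (S n)) f" "L2_tendsto \<mu> (\<lambda>n. step_integral (S n)) X"
    unfolding chaos_def has_multiple_Ito_integral_def by blast
  let ?S = "\<lambda>n. map (\<lambda>(a, bs). (c * a, bs)) (S n)"
  have "step_kernel k (?S n)" for n using S [of n] by (simp add: step_kernel_def case_prod_unfold)
  moreover have "L2_tendsto (kernel_space TYPE('a) k) (\<lambda>n. step_eval (?S n)) (\<lambda>x. c * f x)"
    "L2_tendsto \<mu> (\<lambda>n. step_integral (?S n)) (\<lambda>\<omega>. c * X \<omega>)"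
    using lim [THEN L2_tendsto_cmult, of c] by (simp_all add: step_eval_cmult step_integral_cmult)
  ultimately have "has_multiple_Ito_integral \<mu> k (\<lambda>x. c * f x) (\<lambda>\<omega>. c * X \<omega>)"
    unfolding has_multiple_Ito_integral_def by (intro exI [of _ ?S] conjI allI)
  then show ?thesis unfolding chaos_def by blast
qed

definition lin :: "(real \<times> 'd) set \<Rightarrow> (real \<times> 'd \<Rightarrow> real) \<Rightarrow> ('d::finite) wiener \<Rightarrow> real" where
  "lin I \<kappa> \<omega> = (\<Sum>p\<in>I. \<kappa> p * path \<omega> (fst p) $ snd p)"

text \<open>The \<open>L\<^sup>2\<close> kernel of the linear functional: \<open>lin I \<kappa>\<close> is the Wiener integral of \<open>lin_kernel I \<kappa>\<close>.\<close>
definition lin_kernel :: "(real \<times> 'd) set \<Rightarrow> (real \<times> 'd \<Rightarrow> real) \<Rightarrow> real \<times> 'd \<Rightarrow> real" where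
  "lin_kernel I \<kappa> q = (\<Sum>p\<in>I. if snd p = snd q \<and> fst q \<le> fst p then \<kappa> p else 0)"

lemma measurable_lin [measurable]: "lin I \<kappa> \<in> borel_measurable borel"
  unfolding lin_def [abs_def] by measurable

lemma continuous_on_lin: "continuous_on S (lin I \<kappa>)"
  unfolding lin_def [abs_def] by (intro continuous_intros continuous_on_path)

lemma abs_lin_kernel_le: "\<bar>lin_kernel I \<kappa> q\<bar> \<le> (\<Sum>p\<in>I. \<bar>\<kappa> p\<bar>)"
  unfolding lin_kernel_def by (rule order_trans [OF sum_abs]) (auto intro!: sum_mono)

lemma finite_atoms: "finite (atoms n)"
  by (simp add: atoms_def)

text \<open>A path value is the sum of the increments up to its time; exchanging the two sums
  collects at each atom the kernel value at the right end point.\<close>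

lemma lin_grid:
  assumes g: "grid n \<tau>" and I: "fst ` I \<subseteq> \<tau> ` {..n}"
  shows "lin I \<kappa> \<omega> = (\<Sum>\<alpha>\<in>atoms n. lin_kernel I \<kappa> (\<tau> (Suc (fst \<alpha>)), snd \<alpha>) * incr \<tau> \<alpha> \<omega>)"
proof -
  have *: "path \<omega> (fst p) $ snd p =
      (\<Sum>\<alpha>\<in>atoms n. if snd p = snd \<alpha> \<and> \<tau> (Suc (fst \<alpha>)) \<le> fst p then incr \<tau> \<alpha> \<omega> else 0)" if "p \<in> I" for p
  proof -
    have 0: "0 \<in> \<tau> ` {..n}" using g by (auto simp: grid_def image_iff intro!: bexI [of _ 0])
    have p: "fst p \<in> \<tau> ` {..n}" "0 \<le> fst p" using that I grid_range(1) [OF g] by auto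
    have "path \<omega> (fst p) $ snd p = cell_incr (0, fst p, snd p) \<omega>"
      by (simp add: path_0 del: prod.collapse)
    also have "\<dots> = (\<Sum>\<alpha> | \<alpha> \<in> atoms n \<and> (\<tau> (Suc (fst \<alpha>)), snd \<alpha>) \<in> cell_set (0, fst p, snd p). incr \<tau> \<alpha> \<omega>)"
      by (rule cell_incr_grid [OF g 0 p])
    also have "\<dots> = (\<Sum>\<alpha>\<in>atoms n. if (\<tau> (Suc (fst \<alpha>)), snd \<alpha>) \<in> cell_set (0, fst p, snd p) then incr \<tau> \<alpha> \<omega> else 0)"
      by (rule sum.inter_filter [OF finite_atoms])
    also have "\<dots> = (\<Sum>\<alpha>\<in>atoms n. if snd p = snd \<alpha> \<and> \<tau> (Suc (fst \<alpha>)) \<le> fst p then incr \<tau> \<alpha> \<omega> else 0)"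
    proof (rule sum.cong [OF refl])
      \<comment> \<open>The cell \<open>(0, fst p]\<close> excludes time 0 while the kernel
        condition does not; right end points of atoms are positive, so the two tests agree.\<close>
      fix \<alpha> :: "nat \<times> 'a" assume "\<alpha> \<in> atoms n"
      then have "0 < \<tau> (Suc (fst \<alpha>))"
        using grid_strict_mono [OF g, of "Suc (fst \<alpha>)" 0] g by (auto simp: atoms_def grid_def)
      then show "(if (\<tau> (Suc (fst \<alpha>)), snd \<alpha>) \<in> cell_set (0, fst p, snd p) then incr \<tau> \<alpha> \<omega> else 0) =
          (if snd p = snd \<alpha> \<and> \<tau> (Suc (fst \<alpha>)) \<le> fst p then incr \<tau> \<alpha> \<omega> else 0)"
        by (auto simp del: prod.collapse)
    qed
    finally show ?thesis .
  qed
  have "lin I \<kappa> \<omega> = (\<Sum>p\<in>I. \<Sum>\<alpha>\<in>atoms n.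
      (if snd p = snd \<alpha> \<and> \<tau> (Suc (fst \<alpha>)) \<le> fst p then \<kappa> p else 0) * incr \<tau> \<alpha> \<omega>)"
    by (simp add: lin_def * sum_distrib_left if_distrib [of "\<lambda>y. _ * y"] if_distrib [of "\<lambda>y. y * _"] cong: if_cong)
  also have "\<dots> = (\<Sum>\<alpha>\<in>atoms n. lin_kernel I \<kappa> (\<tau> (Suc (fst \<alpha>)), snd \<alpha>) * incr \<tau> \<alpha> \<omega>)"
    by (subst sum.swap) (simp add: lin_kernel_def sum_distrib_right)
  finally show ?thesis .
qed

section \<open>Dyadic grids\<close>

definition dyad :: "nat \<Rightarrow> nat \<Rightarrow> real" where
  "dyad n i = real i / 2 ^ n"

definition dyadics :: "real set" where
  "dyadics = (\<Union>n. dyad n ` {..2 ^ n})"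

lemma grid_dyad: "grid (2 ^ n) (dyad n)"
  by (auto simp: grid_def dyad_def field_simps)

lemma gap_dyad: "gap (dyad n) \<alpha> = 1 / 2 ^ n"
  by (simp add: gap_def dyad_def field_simps)

lemma dyad_mono:
  assumes "m \<le> n"
  shows "dyad m ` {..2 ^ m} \<subseteq> dyad n ` {..2 ^ n}"
proof
  fix t assume "t \<in> dyad m ` {..2 ^ m}"
  then obtain i where i: "i \<le> 2 ^ m" "t = dyad m i" by auto
  obtain k where n: "n = m + k" using assms le_Suc_ex by blast
  have "t = dyad n (i * 2 ^ k)" using i by (simp add: dyad_def n power_add)
  moreover have "i * 2 ^ k \<le> 2 ^ n" using i by (simp add: n power_add)
  ultimately show "t \<in> dyad n ` {..2 ^ n}" by blast
qed

lemma dyadics_level: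
  assumes "finite T" "T \<subseteq> dyadics"
  shows "\<exists>N. \<forall>n\<ge>N. T \<subseteq> dyad n ` {..2 ^ n}"
  using assms
proof (induction T)
  case (insert t T)
  then obtain N where "\<forall>n\<ge>N. T \<subseteq> dyad n ` {..2 ^ n}" by auto
  moreover obtain m where "t \<in> dyad m ` {..2 ^ m}" using insert.prems by (auto simp: dyadics_def)
  ultimately have "\<forall>n\<ge>max N m. insert t T \<subseteq> dyad n ` {..2 ^ n}"
    using dyad_mono [of m] by (meson insert_subset max.boundedE subsetD)
  then show ?case by blast
qed simp

text \<open>All times in \<open>I\<close> are grid points, so none of them separates two points of
  the same left-open cell, and the right end point can represent the cell.\<close>

lemma lin_kernel_cell:
  assumes I: "fst ` I \<subseteq> dyad n ` {..2 ^ n}" and x: "dyad n i < x" "x \<le> dyad n (Suc i)"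
  shows "lin_kernel I \<kappa> (x, c) = lin_kernel I \<kappa> (dyad n (Suc i), c)"
proof -
  have "x \<le> fst p \<longleftrightarrow> dyad n (Suc i) \<le> fst p" if p: "p \<in> I" for p
  proof -
    obtain j where j: "fst p = dyad n j" using p I by auto
    have "dyad n (Suc i) \<le> dyad n j" if "x \<le> dyad n j"
    proof -
      have "dyad n i < dyad n j" using x that by simp
      then have "i < j" by (simp add: dyad_def divide_less_cancel)
      then show ?thesis by (simp add: dyad_def divide_right_mono)
    qed
    then show ?thesis using x j by auto
  qed
  then show ?thesis unfolding lin_kernel_def by (intro sum.cong refl) auto
qed

lemma finite_measure_kernel_space: "finite_measure (kernel_space TYPE('d::finite) k)"
proof
  interpret R: finite_measure "restrict_space lborel {0..1::real}"
    by (rule finite_measureI) (simp add: emeasure_restrict_space space_restrict_space)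
  interpret C: finite_measure "count_space (UNIV :: 'd set)"
    by (rule finite_measure_count_space) simp
  interpret P: finite_measure "restrict_space lborel {0..1::real} \<Otimes>\<^sub>M count_space (UNIV :: 'd set)"
    by (rule finite_measure_pair_measure) unfold_locales
  interpret finite_product_sigma_finite "\<lambda>_. restrict_space lborel {0..1::real} \<Otimes>\<^sub>M count_space (UNIV :: 'd set)" "{..<k}"
    by unfold_locales auto
  show "emeasure (kernel_space TYPE('d::finite) k) (space (kernel_space TYPE('d) k)) \<noteq> \<infinity>"
    unfolding kernel_space_def space_PiM
    using P.emeasure_finite by (subst measure_times) (auto simp: power_eq_top_ennreal)
qed

lemma measurable_step_eval:
  assumes "step_kernel k S"
  shows "step_eval S \<in> borel_measurable (kernel_space TYPE('d::finite) k)"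
proof -
  have "(\<lambda>x. \<Prod>i<length bs. indicator (cell_set (bs ! i)) (x i) :: real)
      \<in> borel_measurable (kernel_space TYPE('d) k)" if "(a, bs) \<in> set S" for a and bs :: "'d cell list"
  proof (rule borel_measurable_prod)
    have bs: "length bs = k" "\<forall>(s, t, c) \<in> set bs. 0 \<le> s \<and> s < t \<and> t \<le> 1"
      using bspec [OF assms [unfolded step_kernel_def] that] by auto
    fix i assume i: "i \<in> {..<length bs}"
    obtain s t c where stc: "bs ! i = (s, t, c)" by (cases "bs ! i")
    then have "(s, t, c) \<in> set bs" using i by (metis lessThan_iff nth_mem)
    then have "0 \<le> s" "t \<le> 1" using bs by auto
    \<comment> \<open>Measurable sets of the kernel space are traces on [0,1]; the bounds on s and t
      make the interval its own trace.\<close>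
    then have "{s<..t} \<in> sets (restrict_space lborel {0..1})"
      by (auto simp: sets_restrict_space image_iff intro!: bexI [of _ "{s<..t}"])
    then have "cell_set (bs ! i) \<in> sets (restrict_space lborel {0..1} \<Otimes>\<^sub>M count_space UNIV)"
      unfolding stc cell_set.simps by (intro pair_measureI) auto
    then show "(\<lambda>x. indicator (cell_set (bs ! i)) (x i)) \<in> borel_measurable (kernel_space TYPE('d) k)"
      unfolding kernel_space_def using i bs
      by (intro measurable_compose [OF measurable_component_singleton borel_measurable_indicator]) auto
  qed
  then show ?thesis
    unfolding step_eval_def [abs_def]
    by (induction S) (auto intro!: borel_measurable_add borel_measurable_times)
qed

text \<open>\<open>N\<close> is a level from which on every dyadic grid contains the times of
  \<open>I\<close>. The interpretation \<open>G\<close> below is indexed by the level, so that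
  functionals of two levels can be compared on the same space.\<close>

locale dyadic_functional = wiener_process \<mu> for \<mu> :: "('d::finite) wiener measure" +
  fixes I :: "(real \<times> 'd) set" and \<kappa> :: "real \<times> 'd \<Rightarrow> real" and N :: nat
  assumes level: "n \<ge> N \<Longrightarrow> fst ` I \<subseteq> dyad n ` {..2 ^ n}"
begin

sublocale G: gaussian_family \<mu> "atoms (2 ^ n)" "incr (dyad n)" "gap (dyad n)" for n :: nat
  by (rule gaussian_grid [OF grid_dyad])

definition coef :: "nat \<Rightarrow> nat \<times> 'd \<Rightarrow> real" where
  "coef n \<alpha> = lin_kernel I \<kappa> (dyad n (Suc (fst \<alpha>)), snd \<alpha>)"

lemma lin_eq: "n \<ge> N \<Longrightarrow> lin I \<kappa> \<omega> = (\<Sum>\<alpha>\<in>atoms (2 ^ n). coef n \<alpha> * incr (dyad n) \<alpha> \<omega>)"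
  unfolding coef_def by (rule lin_grid [OF grid_dyad level])

definition dyad_cell :: "nat \<Rightarrow> nat \<times> 'd \<Rightarrow> 'd cell" where
  "dyad_cell n \<alpha> = (dyad n (fst \<alpha>), dyad n (Suc (fst \<alpha>)), snd \<alpha>)"

text \<open>Ordered lists rather than sets, because a kernel is a function of ordered
  points.\<close>

definition atom_lists :: "nat \<Rightarrow> nat \<Rightarrow> (nat \<times> 'd) list set" where
  "atom_lists n k = {as. length as = k \<and> distinct as \<and> set as \<subseteq> atoms (2 ^ n)}"

lemma finite_atom_lists: "finite (atom_lists n k)"
  by (rule finite_subset [OF _ finite_lists_length_eq [OF finite_atoms, of "2 ^ n" k]]) (auto simp: atom_lists_def)

definition atom_enum :: "nat \<Rightarrow> nat \<Rightarrow> (nat \<times> 'd) list list" where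
  "atom_enum n k = (SOME xs. distinct xs \<and> set xs = atom_lists n k)"

lemma atom_enum: "distinct (atom_enum n k)" "set (atom_enum n k) = atom_lists n k"
  using someI_ex [of "\<lambda>xs. distinct xs \<and> set xs = atom_lists n k"] finite_distinct_list [OF finite_atom_lists, of n k]
  unfolding atom_enum_def by blast+

text \<open>The kernel \<open>h(x\<^sub>1) \<dots> h(x\<^sub>k) / k!\<close> with \<open>h = lin_kernel I \<kappa>\<close>, restricted to the products of pairwise
  different cells; each set of \<open>k\<close> cells is listed \<open>k!\<close> times.\<close>
definition dyad_kernel :: "nat \<Rightarrow> nat \<Rightarrow> 'd step_kernel" where
  "dyad_kernel n k = map (\<lambda>as. ((\<Prod>\<alpha>\<leftarrow>as. coef n \<alpha>) / fact k, map (dyad_cell n) as)) (atom_enum n k)"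

lemma step_kernel_dyad_kernel: "step_kernel k (dyad_kernel n k)"
  unfolding step_kernel_def
proof (intro ballI, clarify)
  fix a bs assume "(a, bs) \<in> set (dyad_kernel n k)"
  then obtain as where as: "as \<in> atom_lists n k" "bs = map (dyad_cell n) as"
    using atom_enum(2) [of n k] by (auto simp: dyad_kernel_def)
  have disj: "cell_set (dyad_cell n \<alpha>) \<inter> cell_set (dyad_cell n \<beta>) = {}" if "\<alpha> \<noteq> \<beta>" for \<alpha> \<beta>
  proof (cases "fst \<alpha> = fst \<beta>")
    case True
    then show ?thesis using that by (auto simp: dyad_cell_def prod_eq_iff)
  next
    case False
    then have "dyad n (Suc (fst \<alpha>)) \<le> dyad n (fst \<beta>) \<or> dyad n (Suc (fst \<beta>)) \<le> dyad n (fst \<alpha>)"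
      by (auto simp: dyad_def divide_le_cancel)
    then show ?thesis by (auto simp: dyad_cell_def)
  qed
  have "0 \<le> s \<and> s < t \<and> t \<le> 1" if stc: "(s, t, c) \<in> set bs" for s t c
  proof -
    obtain \<alpha> where \<alpha>: "\<alpha> \<in> set as" "(s, t, c) = dyad_cell n \<alpha>" using stc as(2) by auto
    then have "Suc (fst \<alpha>) \<le> 2 ^ n" using as(1) by (auto simp: atom_lists_def atoms_def)
    then show ?thesis
      using \<alpha> grid_range [OF grid_dyad, of "Suc (fst \<alpha>)" n] by (auto simp: dyad_cell_def dyad_def divide_strict_right_mono)
  qed
  then have "\<forall>(s, t, c)\<in>set bs. 0 \<le> s \<and> s < t \<and> t \<le> 1" by auto
  moreover have "cell_set (bs ! i) \<inter> cell_set (bs ! j) = {}" if "i < k" "j < k" "i \<noteq> j" for i j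
    using that as by (auto simp: atom_lists_def nth_eq_iff_index_eq intro!: disj)
  ultimately show "length bs = k \<and> (\<forall>(s, t, c)\<in>set bs. 0 \<le> s \<and> s < t \<and> t \<le> 1) \<and>
      (\<forall>i<k. \<forall>j<k. i \<noteq> j \<longrightarrow> cell_set (bs ! i) \<inter> cell_set (bs ! j) = {})"
    using as by (simp add: atom_lists_def)
qed

text \<open>The lists with a given underlying set contribute k! equal terms, which cancels the
  factor \<open>1 / fact k\<close>. Thus the symmetric polynomials of the grid are multiple
  integrals of explicit kernels.\<close>

lemma step_integral_dyad_kernel: "step_integral (dyad_kernel n k) = G.elem n (coef n) k"
proof
  fix \<omega>
  let ?y = "\<lambda>\<alpha>. coef n \<alpha> * incr (dyad n) \<alpha> \<omega>"
  have ci: "cell_incr (dyad_cell n \<alpha>) \<omega> = incr (dyad n) \<alpha> \<omega>" for \<alpha> by (simp add: dyad_cell_def incr_def)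
  have lists: "atom_lists n k = (\<Union>B\<in>{B. B \<subseteq> atoms (2 ^ n) \<and> card B = k}. permutations_of_set B)"
    by (auto simp: atom_lists_def permutations_of_set_def distinct_card)
  have "step_integral (dyad_kernel n k) \<omega> =
      (\<Sum>as\<in>atom_lists n k. (\<Prod>\<alpha>\<leftarrow>as. coef n \<alpha>) / fact k * (\<Prod>i<length as. cell_incr (map (dyad_cell n) as ! i) \<omega>))"
    by (simp add: step_integral_def dyad_kernel_def comp_def case_prod_beta
        sum_list_distinct_conv_sum_set atom_enum)
  also have "\<dots> = (\<Sum>as\<in>atom_lists n k. (\<Prod>\<alpha>\<in>set as. ?y \<alpha>) / fact k)"
  proof (rule sum.cong [OF refl])
    fix as assume "as \<in> atom_lists n k"
    then have d: "distinct as" by (simp add: atom_lists_def)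
    have "(\<Prod>i<length as. cell_incr (map (dyad_cell n) as ! i) \<omega>) = (\<Prod>i<length as. incr (dyad n) (as ! i) \<omega>)"
      by (intro prod.cong refl) (simp add: ci)
    also have "\<dots> = (\<Prod>\<alpha>\<leftarrow>as. incr (dyad n) \<alpha> \<omega>)"
      by (simp add: prod.list_conv_set_nth atLeast0LessThan)
    finally show "(\<Prod>\<alpha>\<leftarrow>as. coef n \<alpha>) / fact k * (\<Prod>i<length as. cell_incr (map (dyad_cell n) as ! i) \<omega>) =
        (\<Prod>\<alpha>\<in>set as. ?y \<alpha>) / fact k"
      using d by (simp add: prod.distinct_set_conv_list [symmetric] prod.distrib)
  qed
  also have "\<dots> = (\<Sum>B | B \<subseteq> atoms (2 ^ n) \<and> card B = k. \<Sum>as\<in>permutations_of_set B. (\<Prod>\<alpha>\<in>set as. ?y \<alpha>) / fact k)"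
    unfolding lists
  proof (rule sum.UNION_disjoint)
    show "\<forall>B\<in>{B. B \<subseteq> atoms (2 ^ n) \<and> card B = k}. finite (permutations_of_set B)" by simp
    show "\<forall>B\<in>{B. B \<subseteq> atoms (2 ^ n) \<and> card B = k}. \<forall>C\<in>{B. B \<subseteq> atoms (2 ^ n) \<and> card B = k}.
        B \<noteq> C \<longrightarrow> permutations_of_set B \<inter> permutations_of_set C = {}"
      by (auto simp: permutations_of_set_def)
  qed (rule G.finite_subsets)
  also have "\<dots> = (\<Sum>B | B \<subseteq> atoms (2 ^ n) \<and> card B = k. \<Prod>\<alpha>\<in>B. ?y \<alpha>)"
  proof (rule sum.cong [OF refl])
    fix B :: "(nat \<times> 'd) set" assume "B \<in> {B. B \<subseteq> atoms (2 ^ n) \<and> card B = k}"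
    then have B: "finite B" "card B = k" using finite_subset [OF _ finite_atoms] by auto
    have "(\<Sum>as\<in>permutations_of_set B. (\<Prod>\<alpha>\<in>set as. ?y \<alpha>) / fact k) = (\<Sum>as\<in>permutations_of_set B. (\<Prod>\<alpha>\<in>B. ?y \<alpha>) / fact k)"
      by (intro sum.cong refl) (simp add: permutations_of_set_def)
    then show "(\<Sum>as\<in>permutations_of_set B. (\<Prod>\<alpha>\<in>set as. ?y \<alpha>) / fact k) = (\<Prod>\<alpha>\<in>B. ?y \<alpha>)"
      using B by simp
  qed
  finally show "step_integral (dyad_kernel n k) \<omega> = G.elem n (coef n) k \<omega>" by (simp add: G.elem_def)
qed

text \<open>The atom containing q: cells are open on the left, so its index is a ceiling minus 1. At
  time 0 truncated subtraction returns the index 0, whose cell misses q; hence the positivity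
  assumptions below.\<close>

definition dyad_index :: "nat \<Rightarrow> real \<times> 'd \<Rightarrow> nat \<times> 'd" where
  "dyad_index n q = (nat \<lceil>fst q * 2 ^ n\<rceil> - 1, snd q)"

lemma in_dyad_cell_iff:
  assumes "fst q > 0"
  shows "q \<in> cell_set (dyad_cell n \<alpha>) \<longleftrightarrow> \<alpha> = dyad_index n q"
proof -
  let ?y = "fst q * 2 ^ n"
  have "?y > 0" using assms by simp
  then have c: "\<lceil>?y\<rceil> \<ge> 1" by linarith
  have "dyad n (fst \<alpha>) < fst q \<and> fst q \<le> dyad n (Suc (fst \<alpha>)) \<longleftrightarrow> real (fst \<alpha>) < ?y \<and> ?y \<le> real (fst \<alpha>) + 1"
    by (simp add: dyad_def field_simps)
  also have "\<dots> \<longleftrightarrow> \<lceil>?y\<rceil> = int (fst \<alpha>) + 1" by (simp add: ceiling_eq_iff)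
  also have "\<dots> \<longleftrightarrow> fst \<alpha> = nat \<lceil>?y\<rceil> - 1" using c by linarith
  finally show ?thesis by (cases q; cases \<alpha>) (auto simp: dyad_cell_def dyad_index_def)
qed

lemma dyad_index_in_atoms:
  assumes "0 < fst q" "fst q \<le> 1"
  shows "dyad_index n q \<in> atoms (2 ^ n)"
proof -
  have "0 < fst q * 2 ^ n" "fst q * 2 ^ n \<le> 2 ^ n" using assms by auto
  then have "\<lceil>fst q * 2 ^ n\<rceil> \<ge> 1" "\<lceil>fst q * 2 ^ n\<rceil> \<le> 2 ^ n" by (simp_all add: ceiling_le_iff)
  then have "nat \<lceil>fst q * 2 ^ n\<rceil> - 1 < nat (2 ^ n)" by linarith
  then show ?thesis by (simp add: dyad_index_def atoms_def nat_power_eq)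
qed

lemma coef_dyad_index:
  assumes "n \<ge> N" "0 < fst q"
  shows "coef n (dyad_index n q) = lin_kernel I \<kappa> q"
proof -
  obtain x c where q: "q = (x, c)" by (cases q)
  have "q \<in> cell_set (dyad_cell n (dyad_index n q))" using in_dyad_cell_iff assms by blast
  then have "dyad n (fst (dyad_index n q)) < x" "x \<le> dyad n (Suc (fst (dyad_index n q)))" "snd (dyad_index n q) = c"
    by (auto simp: q dyad_cell_def)
  then show ?thesis
    using lin_kernel_cell [OF level [OF assms(1)]] by (simp add: coef_def q)
qed

text \<open>At a given point at most one list of atoms contributes, the list \<open>js\<close> of
  the atoms containing the coordinates of the point; it is admissible when these atoms are distinct
  and the times lie in (0,1]. For \<open>n \<ge> N\<close> the linear kernel is constant on cells,
  so the coefficient is computed at the point itself.\<close>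

lemma step_eval_dyad_kernel:
  assumes "n \<ge> N"
  shows "step_eval (dyad_kernel n k) x =
    (if (\<forall>i<k. 0 < fst (x i) \<and> fst (x i) \<le> 1) \<and> inj_on (\<lambda>i. dyad_index n (x i)) {..<k}
     then (\<Prod>i<k. lin_kernel I \<kappa> (x i)) / fact k else 0)"
proof -
  define js where "js = map (\<lambda>i. dyad_index n (x i)) [0..<k]"
  let ?pos = "\<forall>i<k. 0 < fst (x i) \<and> fst (x i) \<le> 1"
  let ?val = "(\<Prod>i<k. lin_kernel I \<kappa> (x i)) / fact k"
  let ?term = "\<lambda>as. (\<Prod>\<alpha>\<leftarrow>as. coef n \<alpha>) / fact k * (\<Prod>i<k. indicator (cell_set (dyad_cell n (as ! i))) (x i))"
  have mem: "0 < fst q \<and> fst q \<le> 1" if "q \<in> cell_set (dyad_cell n \<alpha>)" "\<alpha> \<in> atoms (2 ^ n)" for q \<alpha>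
  proof -
    have "Suc (fst \<alpha>) \<le> 2 ^ n" using that by (auto simp: atoms_def)
    then have "0 \<le> dyad n (fst \<alpha>)" "dyad n (Suc (fst \<alpha>)) \<le> 1"
      using grid_range [OF grid_dyad] by auto
    then show ?thesis using that(1) by (auto simp: dyad_cell_def)
  qed
  have t: "?term as = (if as = js \<and> ?pos then ?val else 0)" if as: "as \<in> atom_lists n k" for as
  proof (cases "as = js \<and> ?pos")
    case True
    have "(\<Prod>\<alpha>\<leftarrow>js. coef n \<alpha>) = (\<Prod>i<k. coef n (js ! i))"
      by (simp add: prod.list_conv_set_nth atLeast0LessThan js_def)
    also have "\<dots> = (\<Prod>i<k. lin_kernel I \<kappa> (x i))"
      using True by (intro prod.cong refl) (simp add: js_def coef_dyad_index assms)
    finally have "(\<Prod>\<alpha>\<leftarrow>js. coef n \<alpha>) = (\<Prod>i<k. lin_kernel I \<kappa> (x i))" .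
    moreover have "(\<Prod>i<k. indicator (cell_set (dyad_cell n (js ! i))) (x i)) = (1::real)"
      using True by (intro prod.neutral) (simp add: js_def in_dyad_cell_iff)
    ultimately show ?thesis using True by simp
  next
    case False
    have "\<exists>i<k. x i \<notin> cell_set (dyad_cell n (as ! i))"
    proof (rule ccontr)
      assume "\<not> ?thesis"
      then have a: "\<And>i. i < k \<Longrightarrow> x i \<in> cell_set (dyad_cell n (as ! i))" by auto
      have pos: "0 < fst (x i) \<and> fst (x i) \<le> 1" if "i < k" for i
        using a [OF that] by (rule mem) (use as that in \<open>auto simp: atom_lists_def\<close>)
      then have "as ! i = dyad_index n (x i)" if "i < k" for i
        using a [OF that] in_dyad_cell_iff that by blast
      then have "as = js" using as by (intro nth_equalityI) (auto simp: js_def atom_lists_def)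
      then show False using False pos by blast
    qed
    then obtain i where i: "i < k" "x i \<notin> cell_set (dyad_cell n (as ! i))" by blast
    then have "(\<Prod>i<k. indicator (cell_set (dyad_cell n (as ! i))) (x i)) = (0::real)"
      by (intro prod_zero) (auto intro!: bexI [of _ i])
    then show ?thesis using False by (simp only: if_False mult_zero_right)
  qed
  have "step_eval (dyad_kernel n k) x = (\<Sum>as\<in>atom_lists n k. (\<Prod>\<alpha>\<leftarrow>as. coef n \<alpha>) / fact k *
      (\<Prod>i<length as. indicator (cell_set (map (dyad_cell n) as ! i)) (x i)))"
    by (simp add: step_eval_def dyad_kernel_def comp_def case_prod_beta sum_list_distinct_conv_sum_set atom_enum)
  also have "\<dots> = (\<Sum>as\<in>atom_lists n k. ?term as)"
    by (intro sum.cong refl arg_cong2 [of _ _ _ _ "(*)"] prod.cong) (auto simp: atom_lists_def)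
  also have "\<dots> = (\<Sum>as\<in>atom_lists n k. if as = js then if ?pos then ?val else 0 else 0)"
    by (intro sum.cong refl) (simp only: t, simp)
  also have "\<dots> = (if js \<in> atom_lists n k then if ?pos then ?val else 0 else 0)"
    by (simp add: finite_atom_lists)
  also have "\<dots> = (if ?pos \<and> inj_on (\<lambda>i. dyad_index n (x i)) {..<k} then ?val else 0)"
  proof -
    have "dyad_index n (x i) \<in> atoms (2 ^ n)" if "0 < fst (x i)" "fst (x i) \<le> 1" for i
      using that by (rule dyad_index_in_atoms)
    then show ?thesis by (auto simp: atom_lists_def js_def distinct_map atLeast0LessThan)
  qed
  finally show ?thesis .
qed

text \<open>Points in one coordinate are separated once the mesh is below their distance, points in
  different coordinates at every level.\<close>

lemma eventually_dyad_index_neq: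
  assumes "p \<noteq> q" "0 < fst p" "0 < fst q"
  shows "\<forall>\<^sub>F n in sequentially. dyad_index n p \<noteq> dyad_index n q"
proof (cases "snd p = snd q")
  case True
  then have "fst p \<noteq> fst q" using assms by (auto simp: prod_eq_iff)
  then have d: "\<bar>fst p - fst q\<bar> > 0" by simp
  have "(\<lambda>n. 1 / 2 ^ n :: real) \<longlonglongrightarrow> 0" by real_asymp
  then have "\<forall>\<^sub>F n in sequentially. 1 / 2 ^ n < \<bar>fst p - fst q\<bar>" by (rule order_tendstoD(2) [OF _ d])
  then show ?thesis
  proof eventually_elim
    case (elim n)
    show ?case
    proof
      assume eq: "dyad_index n p = dyad_index n q"
      define \<alpha> where "\<alpha> = dyad_index n p"
      have "p \<in> cell_set (dyad_cell n \<alpha>)" "q \<in> cell_set (dyad_cell n \<alpha>)"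
        using in_dyad_cell_iff [of p n \<alpha>] in_dyad_cell_iff [of q n \<alpha>] assms eq by (auto simp: \<alpha>_def)
      then have "\<bar>fst p - fst q\<bar> \<le> dyad n (Suc (fst \<alpha>)) - dyad n (fst \<alpha>)"
        by (cases p; cases q) (auto simp: dyad_cell_def)
      also have "\<dots> = 1 / 2 ^ n" by (simp add: dyad_def field_simps)
      finally show False using elim by simp
    qed
  qed
qed (simp add: dyad_index_def)

text \<open>Off the diagonals the kernels are eventually constant in the level, by separation of the
  points; a common bound and the finite measure of the kernel space give convergence in mean square.
  The shift by \<open>N\<close> keeps to levels where \<open>step_eval_dyad_kernel\<close>
  applies.\<close>

lemma step_eval_dyad_kernel_converges:
  "\<exists>f. L2_tendsto (kernel_space TYPE('d) k) (\<lambda>n. step_eval (dyad_kernel (n + N) k)) f"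
proof -
  interpret K: finite_measure "kernel_space TYPE('d) k" by (rule finite_measure_kernel_space)
  \<comment> \<open>The value 0 on the diagonals and at times outside (0,1] makes the convergence
    pointwise everywhere, so that \<open>f\<close> is measurable as a limit.\<close>
  define f where "f x = (if (\<forall>i<k. 0 < fst (x i) \<and> fst (x i) \<le> 1) \<and> inj_on x {..<k}
     then (\<Prod>i<k. lin_kernel I \<kappa> (x i)) / fact k else 0)" for x
  define B where "B = (\<Sum>p\<in>I. \<bar>\<kappa> p\<bar>) ^ k"
  have bd: "\<bar>(\<Prod>i<k. lin_kernel I \<kappa> (x i)) / fact k\<bar> \<le> B" for x
  proof -
    have "\<bar>\<Prod>i<k. lin_kernel I \<kappa> (x i)\<bar> \<le> (\<Prod>i<k. \<Sum>p\<in>I. \<bar>\<kappa> p\<bar>)"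
      unfolding abs_prod by (intro prod_mono) (auto intro: abs_lin_kernel_le)
    moreover have "\<bar>y\<bar> / fact k \<le> \<bar>y\<bar>" for y :: real
      using fact_ge_1 [of k, where 'a = real] by (simp add: divide_le_eq mult_le_cancel_left1)
    moreover have "\<bar>a / fact k\<bar> = \<bar>a\<bar> / fact k" for a :: real by (simp add: abs_divide)
    ultimately show ?thesis unfolding B_def prod_constant card_lessThan by (metis order_trans)
  qed
  have "B \<ge> 0" unfolding B_def by (intro zero_le_power sum_nonneg) simp
  have bds: "\<bar>step_eval (dyad_kernel (n + N) k) x\<bar> \<le> B" for n x
    using bd [of x] \<open>B \<ge> 0\<close> by (simp add: step_eval_dyad_kernel)
  have bdf: "\<bar>f x\<bar> \<le> B" for x using bd [of x] \<open>B \<ge> 0\<close> by (simp add: f_def)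
  have ev: "\<forall>\<^sub>F n in sequentially. step_eval (dyad_kernel (n + N) k) x = f x" for x
  proof (cases "(\<forall>i<k. 0 < fst (x i)) \<and> inj_on x {..<k}")
    case True
    have "\<forall>\<^sub>F n in sequentially. \<forall>i\<in>{..<k}. \<forall>j\<in>{..<k}. i \<noteq> j \<longrightarrow> dyad_index n (x i) \<noteq> dyad_index n (x j)"
      using True by (intro eventually_ball_finite ballI) (auto intro!: eventually_dyad_index_neq simp: inj_on_def)
    then have "\<forall>\<^sub>F n in sequentially. \<forall>i\<in>{..<k}. \<forall>j\<in>{..<k}. i \<noteq> j \<longrightarrow> dyad_index (n + N) (x i) \<noteq> dyad_index (n + N) (x j)"
      by (rule eventually_sequentially_seg [THEN iffD2])
    then show ?thesis
    proof eventually_elim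
      case (elim n)
      then have "inj_on (\<lambda>i. dyad_index (n + N) (x i)) {..<k}" unfolding inj_on_def by blast
      then show ?case using True by (simp add: step_eval_dyad_kernel f_def)
    qed
  next
    case False
    then have "\<not> inj_on (\<lambda>i. dyad_index (n + N) (x i)) {..<k}" if "\<forall>i<k. 0 < fst (x i)" for n
      using that unfolding inj_on_def by metis
    then show ?thesis
      using False by (intro always_eventually allI) (auto simp: step_eval_dyad_kernel f_def)
  qed
  note [measurable] = measurable_step_eval [OF step_kernel_dyad_kernel]
  have lim: "(\<lambda>n. step_eval (dyad_kernel (n + N) k) x) \<longlonglongrightarrow> f x" for x
    using ev [of x] by (rule tendsto_eventually)
  have [measurable]: "f \<in> borel_measurable (kernel_space TYPE('d) k)"
    by (rule borel_measurable_LIMSEQ_real [OF lim]) simp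
  have "(\<lambda>n. \<integral>x. (step_eval (dyad_kernel (n + N) k) x - f x)\<^sup>2 \<partial>kernel_space TYPE('d) k)
      \<longlonglongrightarrow> (\<integral>x. 0 \<partial>kernel_space TYPE('d) k)"
  proof (rule integral_dominated_convergence [where w = "\<lambda>_. (2 * B)\<^sup>2"])
    show "AE x in kernel_space TYPE('d) k. (\<lambda>n. (step_eval (dyad_kernel (n + N) k) x - f x)\<^sup>2) \<longlonglongrightarrow> 0"
      using tendsto_power [OF LIM_zero [OF lim], of _ 2] by simp
    show "AE x in kernel_space TYPE('d) k. norm ((step_eval (dyad_kernel (n + N) k) x - f x)\<^sup>2) \<le> (2 * B)\<^sup>2" for n
    proof (rule AE_I2)
      fix x
      have "\<bar>step_eval (dyad_kernel (n + N) k) x - f x\<bar> \<le> \<bar>2 * B\<bar>"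
        using bds [of n x] bdf [of x] \<open>B \<ge> 0\<close> by linarith
      then show "norm ((step_eval (dyad_kernel (n + N) k) x - f x)\<^sup>2) \<le> (2 * B)\<^sup>2"
        by (simp add: abs_le_square_iff)
    qed
  qed auto
  then have "L2_tendsto (kernel_space TYPE('d) k) (\<lambda>n. step_eval (dyad_kernel (n + N) k)) f"
    unfolding L2_tendsto_def
    using K.square_integrable_bounded [OF _ bds] K.square_integrable_bounded [OF _ bdf] by simp
  then show ?thesis by blast
qed

end

section \<open>Chaos expansion of trigonometric functionals\<close>

context dyadic_functional
begin

text \<open>The variance of \<open>lin I \<kappa>\<close>, equivalently the squared norm of its
  kernel.\<close>

definition ker_norm :: real where
  "ker_norm = (\<Sum>\<alpha>\<in>atoms (2 ^ N). (coef N \<alpha>)\<^sup>2 * gap (dyad N) \<alpha>)"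

text \<open>Both sums are the variance of the same Gaussian functional and are read off its
  characteristic function, without comparing the grids.\<close>

lemma ker_norm_eq:
  assumes "n \<ge> N"
  shows "(\<Sum>\<alpha>\<in>atoms (2 ^ n). (coef n \<alpha>)\<^sup>2 * gap (dyad n) \<alpha>) = ker_norm"
proof -
  have "complex_of_real (exp (- (\<Sum>\<alpha>\<in>atoms (2 ^ n). (coef n \<alpha>)\<^sup>2 * gap (dyad n) \<alpha>) / 2)) =
      (CLINT \<omega>|\<mu>. iexp (lin I \<kappa> \<omega>))"
    unfolding lin_eq [OF assms] by (rule G.char_linear [symmetric])
  also have "\<dots> = complex_of_real (exp (- ker_norm / 2))"
    unfolding lin_eq [OF order_refl] ker_norm_def by (rule G.char_linear)
  finally show ?thesis by (simp only: of_real_eq_iff exp_inj_iff)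
qed

lemma coef_bound: "(coef n \<alpha>)\<^sup>2 \<le> (\<Sum>p\<in>I. \<bar>\<kappa> p\<bar>)\<^sup>2"
  using abs_lin_kernel_le [of I \<kappa>] unfolding coef_def
  by (intro abs_le_square_iff [THEN iffD1]) (meson abs_ge_self order_trans)

text \<open>The real part of \<open>cis b\<close> times the Wick exponential of i
  \<open>lin I \<kappa>\<close>; with this normalisation it is the limit of
  \<open>G.wick\<close>.\<close>

definition expo :: "real \<Rightarrow> 'd wiener \<Rightarrow> real" where
  "expo b \<omega> = exp (ker_norm / 2) * cos (lin I \<kappa> \<omega> + b)"

lemma square_integrable_expo: "square_integrable \<mu> (expo b)"
  by (rule square_integrable_bounded [where B = "exp (ker_norm / 2)"])
    (auto simp: expo_def [abs_def] abs_mult mult_le_cancel_left1)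

text \<open>By \<open>wick_approx\<close> the squared error is at most exp s minus a product of
  factors 1 + y, where s is the sum of the y. On the uniform grid every y is at most R / 2^n, and ln
  (1 + y) \<ge> y - y^2 bounds the product below by exp (s - s R / 2^n) once R / 2^n \<le>
  1.\<close>

lemma L2_tendsto_wick: "L2_tendsto \<mu> (\<lambda>n. G.wick (n + N) (coef (n + N)) b) (expo b)"
proof -
  define R where "R = (\<Sum>p\<in>I. \<bar>\<kappa> p\<bar>)\<^sup>2"
  have lower: "exp (ker_norm - ker_norm * (R / 2 ^ n)) \<le> (\<Prod>\<alpha>\<in>atoms (2 ^ n). 1 + (coef n \<alpha>)\<^sup>2 * gap (dyad n) \<alpha>)"
    if n: "n \<ge> N" "R / 2 ^ n \<le> 1" for n
  proof -
    let ?y = "\<lambda>\<alpha>. (coef n \<alpha>)\<^sup>2 * gap (dyad n) \<alpha>"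
    have y0: "?y \<alpha> \<ge> 0" and yR: "?y \<alpha> \<le> R / 2 ^ n" for \<alpha>
      using coef_bound [of n \<alpha>] by (auto simp: gap_dyad R_def divide_right_mono)
    have "exp (ker_norm - ker_norm * (R / 2 ^ n)) = exp (\<Sum>\<alpha>\<in>atoms (2 ^ n). ?y \<alpha> - ?y \<alpha> * (R / 2 ^ n))"
      by (simp only: ker_norm_eq [OF n(1), symmetric] sum_subtractf sum_distrib_right)
    also have "\<dots> = (\<Prod>\<alpha>\<in>atoms (2 ^ n). exp (?y \<alpha> - ?y \<alpha> * (R / 2 ^ n)))"
      by (rule exp_sum [OF finite_atoms])
    also have "\<dots> \<le> (\<Prod>\<alpha>\<in>atoms (2 ^ n). 1 + ?y \<alpha>)"
    proof (intro prod_mono conjI)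
      fix \<alpha>
      have "?y \<alpha> * ?y \<alpha> \<le> ?y \<alpha> * (R / 2 ^ n)" using y0 yR by (intro mult_left_mono)
      then have "?y \<alpha> - ?y \<alpha> * (R / 2 ^ n) \<le> ?y \<alpha> - (?y \<alpha>)\<^sup>2" unfolding power2_eq_square [of "?y \<alpha>"] by linarith
      also have "\<dots> \<le> ln (1 + ?y \<alpha>)"
        by (rule ln_one_plus_pos_lower_bound [OF y0]) (use yR [of \<alpha>] n(2) in linarith)
      finally have "exp (?y \<alpha> - ?y \<alpha> * (R / 2 ^ n)) \<le> exp (ln (1 + ?y \<alpha>))" by simp
      also have "\<dots> = 1 + ?y \<alpha>" using y0 [of \<alpha>] by (intro exp_ln) linarith
      finally show "exp (?y \<alpha> - ?y \<alpha> * (R / 2 ^ n)) \<le> 1 + ?y \<alpha>" .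
    qed simp
    finally show ?thesis .
  qed
  have R0: "(\<lambda>n. R / 2 ^ (n + N)) \<longlonglongrightarrow> 0" by real_asymp
  have "(\<lambda>n. \<integral>\<omega>. (G.wick (n + N) (coef (n + N)) b \<omega> - expo b \<omega>)\<^sup>2 \<partial>\<mu>) \<longlonglongrightarrow> 0"
  proof (rule tendsto_sandwich [of "\<lambda>_. 0"])
    from R0 have "\<forall>\<^sub>F n in sequentially. R / 2 ^ (n + N) < 1" by (rule order_tendstoD(2)) simp
    then show "\<forall>\<^sub>F n in sequentially. (\<integral>\<omega>. (G.wick (n + N) (coef (n + N)) b \<omega> - expo b \<omega>)\<^sup>2 \<partial>\<mu>)
        \<le> exp ker_norm - exp (ker_norm - ker_norm * (R / 2 ^ (n + N)))"
    proof eventually_elim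
      case (elim n)
      then show ?case
        using G.wick_approx [of "n + N" "coef (n + N)" b] lower [of "n + N"]
        by (simp add: ker_norm_eq lin_eq [of "n + N", symmetric] expo_def)
    qed
    have "(\<lambda>n. exp ker_norm - exp (ker_norm - ker_norm * (R / 2 ^ (n + N)))) \<longlonglongrightarrow>
        exp ker_norm - exp (ker_norm - ker_norm * 0)"
      by (intro tendsto_intros R0)
    then show "(\<lambda>n. exp ker_norm - exp (ker_norm - ker_norm * (R / 2 ^ (n + N)))) \<longlonglongrightarrow> 0" by simp
  qed auto
  then show ?thesis
    unfolding L2_tendsto_def using G.square_integrable_wick square_integrable_expo by blast
qed

text \<open>Both factors are step integrals, even when they come from different grids. In
  \<open>elem_diff_le\<close> this removes the mixed terms.\<close>

lemma elem_orthogonal_levels: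
  assumes "k \<noteq> l"
  shows "(\<integral>\<omega>. G.elem m (coef m) k \<omega> * G.elem n (coef n) l \<omega> \<partial>\<mu>) = 0"
  using step_integral_orthogonal [OF step_kernel_dyad_kernel step_kernel_dyad_kernel assms, of m n]
  by (simp add: step_integral_dyad_kernel)

text \<open>The angle \<open>\<pi> / 4\<close> makes the coefficients of all orders equal in modulus, so that no order is lost.\<close>
lemma Re_cis_pi_4_power: "(Re (cis (pi / 4) * \<i> ^ k))\<^sup>2 = 1 / 2"
proof -
  have "(Re (cis (pi / 4) * \<i> ^ k))\<^sup>2 = 1 / 2 \<and> (Im (cis (pi / 4) * \<i> ^ k))\<^sup>2 = 1 / 2"
  proof (induction k)
    case (Suc k)
    have "cis (pi / 4) * \<i> ^ Suc k = \<i> * (cis (pi / 4) * \<i> ^ k)" by (simp only: power_Suc mult.left_commute)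
    with Suc show ?case by (simp only: Re_i_times Im_i_times power2_minus)
  qed (simp add: cos_45 sin_45 power_divide)
  then show ?thesis ..
qed

text \<open>Differences of distinct orders are orthogonal, so a single order is bounded by the
  whole; its coefficient has square 1 / 2, whence the factor 2.\<close>

lemma elem_diff_le:
  "(\<integral>\<omega>. (G.elem m (coef m) k \<omega> - G.elem n (coef n) k \<omega>)\<^sup>2 \<partial>\<mu>)
    \<le> 2 * (\<integral>\<omega>. (G.wick m (coef m) (pi / 4) \<omega> - G.wick n (coef n) (pi / 4) \<omega>)\<^sup>2 \<partial>\<mu>)"
proof -
  let ?c = "\<lambda>k. Re (cis (pi / 4) * \<i> ^ k)"
  let ?D = "\<lambda>k \<omega>. G.elem m (coef m) k \<omega> - G.elem n (coef n) k \<omega>"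
  \<comment> \<open>Large enough to include the order k and all nonzero orders at both
    levels.\<close>
  define K where "K = k + card (atoms (2 ^ m) :: (nat \<times> 'd) set) + card (atoms (2 ^ n) :: (nat \<times> 'd) set)"
  have sq: "square_integrable \<mu> (?D k)" for k
    by (intro square_integrable_diff G.square_integrable_elem)
  have "G.wick m (coef m) (pi / 4) \<omega> - G.wick n (coef n) (pi / 4) \<omega> = (\<Sum>k\<le>K. ?c k * ?D k \<omega>)" for \<omega>
    by (simp only: G.wick_eq_sum [of m K] G.wick_eq_sum [of n K] K_def le_add1 le_add2 add.assoc add.left_commute
        trans_le_add2 right_diff_distrib sum_subtractf)
  then have "(\<integral>\<omega>. (G.wick m (coef m) (pi / 4) \<omega> - G.wick n (coef n) (pi / 4) \<omega>)\<^sup>2 \<partial>\<mu>) =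
      (\<integral>\<omega>. (\<Sum>k\<le>K. ?c k * ?D k \<omega>)\<^sup>2 \<partial>\<mu>)" by (simp only:)
  also have "\<dots> = (\<Sum>k\<le>K. \<integral>\<omega>. (?c k * ?D k \<omega>)\<^sup>2 \<partial>\<mu>)"
  proof (rule integral_square_sum_orthogonal)
    fix i j :: nat assume "i \<noteq> j"
    have eq: "?c i * ?D i \<omega> * (?c j * ?D j \<omega>) = ?c i * ?c j *
        (G.elem m (coef m) i \<omega> * G.elem m (coef m) j \<omega> - G.elem m (coef m) i \<omega> * G.elem n (coef n) j \<omega>
        - G.elem n (coef n) i \<omega> * G.elem m (coef m) j \<omega> + G.elem n (coef n) i \<omega> * G.elem n (coef n) j \<omega>)" for \<omega>
      by (simp only: ring_distribs mult_ac)
    show "(\<integral>\<omega>. ?c i * ?D i \<omega> * (?c j * ?D j \<omega>) \<partial>\<mu>) = 0"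
      unfolding eq
      by (simp add: square_integrable_mult G.square_integrable_elem elem_orthogonal_levels [OF \<open>i \<noteq> j\<close>])
  qed (auto intro: square_integrable_cmult sq)
  also have "\<dots> = (\<Sum>k\<le>K. (\<integral>\<omega>. (?D k \<omega>)\<^sup>2 \<partial>\<mu>) / 2)"
    by (simp only: power_mult_distrib Re_cis_pi_4_power integral_mult_right_zero) simp
  also have "\<dots> \<ge> (\<integral>\<omega>. (?D k \<omega>)\<^sup>2 \<partial>\<mu>) / 2"
    by (rule member_le_sum) (auto simp: K_def)
  finally show ?thesis by simp
qed

text \<open>The integrals are Cauchy because the products converge to \<open>expo (pi / 4)\<close>
  and \<open>elem_diff_le\<close> extracts a single order; the kernels converge by
  \<open>step_eval_dyad_kernel_converges\<close>. Together these are the two limits in the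
  definition of a multiple integral.\<close>

lemma chaos_component_exists:
  "\<exists>X. X \<in> chaos \<mu> k \<and> L2_tendsto \<mu> (\<lambda>n. G.elem (n + N) (coef (n + N)) k) X"
proof -
  let ?w = "\<lambda>n. G.wick (n + N) (coef (n + N)) (pi / 4)"
  let ?d = "\<lambda>n. \<integral>\<omega>. (?w n \<omega> - expo (pi / 4) \<omega>)\<^sup>2 \<partial>\<mu>"
  have "\<exists>X. L2_tendsto \<mu> (\<lambda>n. G.elem (n + N) (coef (n + N)) k) X"
  proof (rule L2_complete [OF G.square_integrable_elem])
    fix e :: real assume "e > 0"
    \<comment> \<open>Two doublings follow, one for the square of a sum and one in
      \<open>elem_diff_le\<close>: 2 (2 e / 8 + 2 e / 8) = e.\<close>
    then have "\<forall>\<^sub>F n in sequentially. ?d n < e / 8"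
      using L2_tendstoD(3) [OF L2_tendsto_wick] by (intro order_tendstoD(2)) auto
    then obtain n0 where n0: "\<And>n. n \<ge> n0 \<Longrightarrow> ?d n < e / 8" by (auto simp: eventually_sequentially)
    have "(\<integral>\<omega>. (G.elem (m + N) (coef (m + N)) k \<omega> - G.elem (n + N) (coef (n + N)) k \<omega>)\<^sup>2 \<partial>\<mu>) < e"
      if "m \<ge> n0" "n \<ge> n0" for m n
    proof -
      have "(\<integral>\<omega>. (?w m \<omega> - ?w n \<omega>)\<^sup>2 \<partial>\<mu>) =
          (\<integral>\<omega>. ((?w m \<omega> - expo (pi / 4) \<omega>) + (expo (pi / 4) \<omega> - ?w n \<omega>))\<^sup>2 \<partial>\<mu>)" by simp
      also have "\<dots> \<le> 2 * ?d m + 2 * (\<integral>\<omega>. (expo (pi / 4) \<omega> - ?w n \<omega>)\<^sup>2 \<partial>\<mu>)"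
        by (intro integral_square_le_double square_integrable_diff G.square_integrable_wick square_integrable_expo)
      also have "\<dots> = 2 * ?d m + 2 * ?d n" by (simp add: power2_commute)
      also have "\<dots> < e / 2" using n0 [OF that(1)] n0 [OF that(2)] by simp
      finally show ?thesis using elem_diff_le [of "m + N" k "n + N"] by linarith
    qed
    then show "\<exists>n0. \<forall>m\<ge>n0. \<forall>n\<ge>n0.
        (\<integral>\<omega>. (G.elem (m + N) (coef (m + N)) k \<omega> - G.elem (n + N) (coef (n + N)) k \<omega>)\<^sup>2 \<partial>\<mu>) < e" by blast
  qed
  then obtain X where X: "L2_tendsto \<mu> (\<lambda>n. G.elem (n + N) (coef (n + N)) k) X" ..
  obtain f where f: "L2_tendsto (kernel_space TYPE('d) k) (\<lambda>n. step_eval (dyad_kernel (n + N) k)) f"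
    using step_eval_dyad_kernel_converges by blast
  have "has_multiple_Ito_integral \<mu> k f X"
    unfolding has_multiple_Ito_integral_def
    using step_kernel_dyad_kernel f X
    by (intro exI [of _ "\<lambda>n. dyad_kernel (n + N) k"]) (simp add: step_integral_dyad_kernel)
  then show ?thesis using X unfolding chaos_def by blast
qed

definition component :: "nat \<Rightarrow> 'd wiener \<Rightarrow> real" where
  "component k = (SOME X. X \<in> chaos \<mu> k \<and> L2_tendsto \<mu> (\<lambda>n. G.elem (n + N) (coef (n + N)) k) X)"

lemma component:
  "component k \<in> chaos \<mu> k" "L2_tendsto \<mu> (\<lambda>n. G.elem (n + N) (coef (n + N)) k) (component k)"
  using someI_ex [OF chaos_component_exists] unfolding component_def by blast+

lemma component_square_le: "(\<integral>\<omega>. (component k \<omega>)\<^sup>2 \<partial>\<mu>) \<le> exp (2 * ker_norm) / 2 ^ k"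
proof (rule LIMSEQ_le_const2 [OF tendsto_integral_square_L2 [OF component(2)]], intro exI allI impI)
  show "(\<integral>\<omega>. (G.elem (n + N) (coef (n + N)) k \<omega>)\<^sup>2 \<partial>\<mu>) \<le> exp (2 * ker_norm) / 2 ^ k" for n
    using G.integral_elem_square_le [of "n + N" "coef (n + N)" k] by (simp add: ker_norm_eq)
qed

text \<open>The factor \<open>exp (- ker_norm / 2)\<close> undoes the normalisation of
  \<open>expo\<close>.\<close>

definition expansion :: "real \<Rightarrow> nat \<Rightarrow> 'd wiener \<Rightarrow> real" where
  "expansion b k \<omega> = exp (- ker_norm / 2) * Re (cis b * \<i> ^ k) * component k \<omega>"

lemma expansion_chaos: "expansion b k \<in> chaos \<mu> k"
  unfolding expansion_def [abs_def] by (intro chaos_cmult component)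

text \<open>The limit in the level is taken first, with the number n of orders fixed: the tail bound
  of \<open>wick_partial_sum\<close> is the same at every level, so it survives this limit and then
  tends to 0 in n.\<close>

lemma has_chaos_expansion_cos: "has_chaos_expansion \<mu> (\<lambda>\<omega>. cos (lin I \<kappa> \<omega> + b)) (expansion b)"
proof -
  let ?c = "\<lambda>k. Re (cis b * \<i> ^ k)"
  let ?P = "\<lambda>n \<omega>. \<Sum>k\<le>n. ?c k * component k \<omega>"
  have bound: "(\<integral>\<omega>. (?P n \<omega> - expo b \<omega>)\<^sup>2 \<partial>\<mu>) \<le> exp (2 * ker_norm) / 2 ^ n" for n
  proof -
    let ?Q = "\<lambda>m \<omega>. \<Sum>k\<le>n. ?c k * G.elem (m + N) (coef (m + N)) k \<omega>"
    have "L2_tendsto \<mu> (\<lambda>m \<omega>. ?Q m \<omega> - G.wick (m + N) (coef (m + N)) b \<omega>) (\<lambda>\<omega>. ?P n \<omega> - expo b \<omega>)"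
      by (intro L2_tendsto_diff L2_tendsto_sum L2_tendsto_cmult component L2_tendsto_wick)
    from tendsto_integral_square_L2 [OF this] show ?thesis
    proof (rule LIMSEQ_le_const2, intro exI allI impI)
      fix m
      show "(\<integral>\<omega>. (?Q m \<omega> - G.wick (m + N) (coef (m + N)) b \<omega>)\<^sup>2 \<partial>\<mu>) \<le> exp (2 * ker_norm) / 2 ^ n"
        using G.wick_partial_sum [of "m + N" "coef (m + N)" b n] by (simp add: ker_norm_eq power2_commute)
    qed
  qed
  have "(\<lambda>n. \<integral>\<omega>. (?P n \<omega> - expo b \<omega>)\<^sup>2 \<partial>\<mu>) \<longlonglongrightarrow> 0"
  proof (rule tendsto_sandwich [of "\<lambda>_. 0"])
    show "\<forall>\<^sub>F n in sequentially. (\<integral>\<omega>. (?P n \<omega> - expo b \<omega>)\<^sup>2 \<partial>\<mu>) \<le> exp (2 * ker_norm) / 2 ^ n"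
      using bound by (intro always_eventually allI)
    have "(\<lambda>n. C / 2 ^ n) \<longlonglongrightarrow> 0" for C :: real by real_asymp
    then show "(\<lambda>n. exp (2 * ker_norm) / 2 ^ n) \<longlonglongrightarrow> 0" .
  qed auto
  moreover have "square_integrable \<mu> (?P n)" for n
    by (intro square_integrable_sum square_integrable_cmult chaos_square_integrable [OF component(1)])
  ultimately have "L2_tendsto \<mu> ?P (expo b)"
    unfolding L2_tendsto_def using square_integrable_expo by blast
  from L2_tendsto_cmult [OF this, of "exp (- ker_norm / 2)"]
  have "L2_tendsto \<mu> (\<lambda>n \<omega>. \<Sum>k\<le>n. expansion b k \<omega>) (\<lambda>\<omega>. cos (lin I \<kappa> \<omega> + b))"
    by (simp add: expansion_def expo_def sum_distrib_left mult.assoc [symmetric] exp_add [symmetric])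
  then show ?thesis unfolding has_chaos_expansion_def using expansion_chaos by blast
qed

lemma expansion_D2_plus_inf: "expansion b \<in> D2_plus_inf \<mu>"
proof -
  have "summable (\<lambda>k. real (k + 1) powr r * (\<integral>\<omega>. (expansion b k \<omega>)\<^sup>2 \<partial>\<mu>))" for r
  proof (rule summable_comparison_test)
    define C where "C = exp (2 * ker_norm)"
    have "(\<integral>\<omega>. (expansion b k \<omega>)\<^sup>2 \<partial>\<mu>) \<le> (exp (- ker_norm / 2))\<^sup>2 * (C / 2 ^ k)" for k
    proof -
      have "(Re (cis b * \<i> ^ k))\<^sup>2 \<le> 1"
        using abs_Re_le_cmod [of "cis b * \<i> ^ k"] by (simp only: abs_square_le_1 norm_mult norm_cis norm_power) simp
      moreover have "(\<integral>\<omega>. (expansion b k \<omega>)\<^sup>2 \<partial>\<mu>) =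
          (exp (- ker_norm / 2))\<^sup>2 * ((Re (cis b * \<i> ^ k))\<^sup>2 * (\<integral>\<omega>. (component k \<omega>)\<^sup>2 \<partial>\<mu>))"
        by (simp only: expansion_def power_mult_distrib integral_mult_right_zero mult.assoc)
      moreover have "0 \<le> (\<integral>\<omega>. (component k \<omega>)\<^sup>2 \<partial>\<mu>)" by simp
      ultimately show ?thesis
        using component_square_le [of k] unfolding C_def
        by (simp only:) (intro mult_left_mono, simp_all add: mult_left_le_one_le order_trans [OF mult_left_le_one_le])
    qed
    then have "real (k + 1) powr r * (\<integral>\<omega>. (expansion b k \<omega>)\<^sup>2 \<partial>\<mu>) \<le>
        real (k + 1) powr r * ((exp (- ker_norm / 2))\<^sup>2 * (C / 2 ^ k))" for k
      by (intro mult_left_mono) auto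
    then show "\<exists>K. \<forall>k\<ge>K. norm (real (k + 1) powr r * (\<integral>\<omega>. (expansion b k \<omega>)\<^sup>2 \<partial>\<mu>)) \<le>
        (exp (- ker_norm / 2))\<^sup>2 * C * (real (k + 1) powr r * (1 / 2) ^ k)"
      by (auto simp: power_divide mult_ac)
    \<comment> \<open>Any ratio strictly between 1 / 2 and 1 absorbs the power of k + 1.\<close>
    have "(\<lambda>k. real (k + 1) powr r * (1 / 2) ^ k) \<in> O(\<lambda>k. (3 / 4) ^ k)" by real_asymp
    then have "summable (\<lambda>k. real (k + 1) powr r * (1 / 2) ^ k)"
      by (rule summable_comparison_test_bigo [rotated]) (simp add: summable_geometric)
    then show "summable (\<lambda>k. (exp (- ker_norm / 2))\<^sup>2 * C * (real (k + 1) powr r * (1 / 2) ^ k))"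
      by (rule summable_mult)
  qed
  then show ?thesis unfolding D2_plus_inf_def D2_def using expansion_chaos by auto
qed

end

text \<open>The exceptional open set can be taken empty: the competitor 0 shows that its capacity is
  at most 0.\<close>

lemma quasi_continuous_version_continuous:
  assumes "continuous_on UNIV F"
  shows "quasi_continuous_version \<mu> F F"
proof -
  have chaos_zero: "(\<lambda>_. 0) \<in> chaos \<mu> k" for k
  proof -
    have "has_multiple_Ito_integral \<mu> k (\<lambda>_. 0) (\<lambda>_. 0)"
      unfolding has_multiple_Ito_integral_def
      by (intro exI [of _ "\<lambda>_. []"])
        (simp add: step_kernel_def step_eval_def [abs_def] step_integral_def [abs_def] L2_tendsto_const square_integrable_zero)
    then show ?thesis unfolding chaos_def by blast
  qed
  have "capacity \<mu> r {} \<le> 0" for r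
    unfolding capacity_def
  proof (rule cInf_lower)
    have "has_chaos_expansion \<mu> (\<lambda>_. 0) (\<lambda>_ _. 0) \<and> (\<lambda>_ _. 0) \<in> D2 \<mu> r \<and> (AE \<omega> in \<mu>. indicator {} \<omega> \<le> (0::real))"
      by (auto simp: has_chaos_expansion_def D2_def chaos_zero L2_tendsto_const square_integrable_zero)
    moreover have "0 = (D2_norm \<mu> r (\<lambda>_ _. 0))\<^sup>2" by (simp add: D2_norm_def)
    ultimately show "0 \<in> {(D2_norm \<mu> r J)\<^sup>2 | f J.
        has_chaos_expansion \<mu> f J \<and> J \<in> D2 \<mu> r \<and> (AE \<omega> in \<mu>. indicator {} \<omega> \<le> f \<omega>)}"
      by blast
    show "bdd_below {(D2_norm \<mu> r J)\<^sup>2 | f J.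
        has_chaos_expansion \<mu> f J \<and> J \<in> D2 \<mu> r \<and> (AE \<omega> in \<mu>. indicator {} \<omega> \<le> f \<omega>)}"
      by (rule bdd_belowI [of _ 0]) auto
  qed
  then show ?thesis
    unfolding quasi_continuous_version_def using assms
    by (auto intro!: borel_measurable_continuous_onI exI [of _ "{}"] intro: le_less_trans)
qed

text \<open>The weights of orders r and - r are reciprocal, so each pairing term is bounded by a
  mean of two weighted squares. A free parameter c in this inequality of arithmetic and geometric
  means yields both summability and a small total.\<close>

lemma D2_pairing_tendsto:
  assumes r: "D2_tendsto \<mu> (- r) \<Psi> \<Phi> G" and J: "J \<in> D2 \<mu> r"
  shows "((\<lambda>x. D2_pairing \<mu> (\<Psi> x) J) \<longlongrightarrow> D2_pairing \<mu> \<Phi> J) G"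
proof -
  let ?w = "\<lambda>k. real (k + 1) powr r"
  have wpos: "?w k > 0" for k by simp
  define M where "M = (\<Sum>k. ?w k * (\<integral>\<omega>. (J k \<omega>)\<^sup>2 \<partial>\<mu>))"
  have sumJ: "summable (\<lambda>k. ?w k * (\<integral>\<omega>. (J k \<omega>)\<^sup>2 \<partial>\<mu>))" and sqJ: "square_integrable \<mu> (J k)" for k
    using J by (auto simp: D2_def intro: chaos_square_integrable)
  have "M \<ge> 0" unfolding M_def by (intro suminf_nonneg sumJ mult_nonneg_nonneg) auto
  have term_le: "\<bar>\<integral>\<omega>. A \<omega> * J k \<omega> \<partial>\<mu>\<bar> \<le>
      (?w k powr -1 * (\<integral>\<omega>. (A \<omega>)\<^sup>2 \<partial>\<mu>) / c + c * (?w k * (\<integral>\<omega>. (J k \<omega>)\<^sup>2 \<partial>\<mu>))) / 2"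
    if "square_integrable \<mu> A" "c > 0" for A k c
  proof -
    let ?a = "sqrt (\<integral>\<omega>. (A \<omega>)\<^sup>2 \<partial>\<mu>)" and ?j = "sqrt (\<integral>\<omega>. (J k \<omega>)\<^sup>2 \<partial>\<mu>)" and ?q = "sqrt (c * ?w k)"
    have q: "?q > 0" using that wpos by simp
    have "\<bar>\<integral>\<omega>. A \<omega> * J k \<omega> \<partial>\<mu>\<bar> \<le> ?a * ?j" by (rule Cauchy_Schwarz_square_integrable [OF that(1) sqJ])
    also have "\<dots> = (?a / ?q) * (?q * ?j)"
    proof -
      have "a * j = (a / q) * (q * j)" if "q > 0" for a j q :: real using that by simp
      from this [OF q] show ?thesis .
    qed
    also have "\<dots> \<le> ((?a / ?q)\<^sup>2 + (?q * ?j)\<^sup>2) / 2"     proof -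
      have "a * b \<le> (a\<^sup>2 + b\<^sup>2) / 2" for a b :: real using sum_squares_bound [of a b] by simp
      then show ?thesis .
    qed
    also have "\<dots> = (?w k powr -1 * (\<integral>\<omega>. (A \<omega>)\<^sup>2 \<partial>\<mu>) / c + c * (?w k * (\<integral>\<omega>. (J k \<omega>)\<^sup>2 \<partial>\<mu>))) / 2"
      using less_imp_neq [OF that(2), symmetric] less_imp_le [OF that(2)] less_imp_neq [OF wpos [of k], symmetric]
      by (simp add: power_divide power_mult_distrib powr_neg_one)
    finally show ?thesis .
  qed
  have wneg: "real (k + 1) powr (- r) = ?w k powr -1" for k
    unfolding powr_powr by simp
  have summ: "summable (\<lambda>k. \<integral>\<omega>. A k \<omega> * J k \<omega> \<partial>\<mu>)" and
    le: "c > 0 \<Longrightarrow> \<bar>\<Sum>k. \<integral>\<omega>. A k \<omega> * J k \<omega> \<partial>\<mu>\<bar> \<le> ((\<Sum>k. real (k + 1) powr (- r) * (\<integral>\<omega>. (A k \<omega>)\<^sup>2 \<partial>\<mu>)) / c + c * M) / 2"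
    if sq: "\<And>k. square_integrable \<mu> (A k)" and s: "summable (\<lambda>k. real (k + 1) powr (- r) * (\<integral>\<omega>. (A k \<omega>)\<^sup>2 \<partial>\<mu>))" for A c
  proof -
    have sb: "summable (\<lambda>k. (?w k powr -1 * (\<integral>\<omega>. (A k \<omega>)\<^sup>2 \<partial>\<mu>) / c + c * (?w k * (\<integral>\<omega>. (J k \<omega>)\<^sup>2 \<partial>\<mu>))) / 2)" for c
      using s sumJ unfolding wneg by (intro summable_divide summable_add summable_mult)
    show "summable (\<lambda>k. \<integral>\<omega>. A k \<omega> * J k \<omega> \<partial>\<mu>)"
      by (rule summable_comparison_test [OF _ sb [of 1]]) (use term_le [OF sq, of 1] in auto)
    assume "c > 0"
    have abs: "summable (\<lambda>k. \<bar>\<integral>\<omega>. A k \<omega> * J k \<omega> \<partial>\<mu>\<bar>)"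
      by (rule summable_comparison_test [OF _ sb [of 1]]) (use term_le [OF sq, of 1] in auto)
    have "\<bar>\<Sum>k. \<integral>\<omega>. A k \<omega> * J k \<omega> \<partial>\<mu>\<bar> \<le> (\<Sum>k. \<bar>\<integral>\<omega>. A k \<omega> * J k \<omega> \<partial>\<mu>\<bar>)" by (rule summable_rabs [OF abs])
    also have "\<dots> \<le> (\<Sum>k. (?w k powr -1 * (\<integral>\<omega>. (A k \<omega>)\<^sup>2 \<partial>\<mu>) / c + c * (?w k * (\<integral>\<omega>. (J k \<omega>)\<^sup>2 \<partial>\<mu>))) / 2)"
      by (rule suminf_le [OF term_le [OF sq \<open>c > 0\<close>] abs sb])
    also have "\<dots> = ((\<Sum>k. real (k + 1) powr (- r) * (\<integral>\<omega>. (A k \<omega>)\<^sup>2 \<partial>\<mu>)) / c + c * M) / 2"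
      unfolding wneg M_def using s sumJ unfolding wneg
      by (simp only: suminf_divide [symmetric] suminf_mult [symmetric] suminf_add summable_add summable_divide summable_mult)
    finally show "\<bar>\<Sum>k. \<integral>\<omega>. A k \<omega> * J k \<omega> \<partial>\<mu>\<bar> \<le> ((\<Sum>k. real (k + 1) powr (- r) * (\<integral>\<omega>. (A k \<omega>)\<^sup>2 \<partial>\<mu>)) / c + c * M) / 2" .
  qed
  have \<Phi>: "\<Phi> \<in> D2 \<mu> (- r)" and ev: "\<forall>\<^sub>F x in G. \<Psi> x \<in> D2 \<mu> (- r)"
    and lim: "((\<lambda>x. D2_norm \<mu> (- r) (\<lambda>k \<omega>. \<Psi> x k \<omega> - \<Phi> k \<omega>)) \<longlongrightarrow> 0) G"
    using r by (auto simp: D2_tendsto_def)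
  show ?thesis
  proof (rule tendstoI)
    fix e :: real assume "e > 0"
    \<comment> \<open>This puts the part of the estimate coming from J below e (the + 1 covers M =
      0), and a norm below \<open>sqrt (c * e)\<close> puts the other part below e; the estimate is
      their mean.\<close>
    define c where "c = e / (M + 1)"
    have "c > 0" "c * M < e" using \<open>e > 0\<close> \<open>M \<ge> 0\<close> by (auto simp: c_def field_simps)
    have "sqrt (c * e) > 0" using \<open>c > 0\<close> \<open>e > 0\<close> by simp
    from order_tendstoD(2) [OF lim this] ev
    show "\<forall>\<^sub>F x in G. dist (D2_pairing \<mu> (\<Psi> x) J) (D2_pairing \<mu> \<Phi> J) < e"
    proof eventually_elim
      case (elim x)
      let ?S = "\<lambda>A. \<Sum>k. real (k + 1) powr (- r) * (\<integral>\<omega>. (A k \<omega>)\<^sup>2 \<partial>\<mu>)"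
      let ?A = "\<lambda>k \<omega>. \<Psi> x k \<omega> - \<Phi> k \<omega>"
      have sq: "square_integrable \<mu> (\<Psi> x k)" "square_integrable \<mu> (\<Phi> k)" for k
        using elim(2) \<Phi> by (auto simp: D2_def intro: chaos_square_integrable)
      have sm: "summable (\<lambda>k. real (k + 1) powr (- r) * (\<integral>\<omega>. (\<Psi> x k \<omega>)\<^sup>2 \<partial>\<mu>))"
        "summable (\<lambda>k. real (k + 1) powr (- r) * (\<integral>\<omega>. (\<Phi> k \<omega>)\<^sup>2 \<partial>\<mu>))"
        using elim(2) \<Phi> by (auto simp: D2_def)
      have sA: "summable (\<lambda>k. real (k + 1) powr (- r) * (\<integral>\<omega>. (?A k \<omega>)\<^sup>2 \<partial>\<mu>))"
      proof (rule summable_comparison_test)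
        show "summable (\<lambda>k. 2 * (real (k + 1) powr (- r) * (\<integral>\<omega>. (\<Psi> x k \<omega>)\<^sup>2 \<partial>\<mu>)) +
            2 * (real (k + 1) powr (- r) * (\<integral>\<omega>. (\<Phi> k \<omega>)\<^sup>2 \<partial>\<mu>)))"
          by (intro summable_add summable_mult sm)
        have "(\<integral>\<omega>. (?A k \<omega>)\<^sup>2 \<partial>\<mu>) \<le> 2 * (\<integral>\<omega>. (\<Psi> x k \<omega>)\<^sup>2 \<partial>\<mu>) + 2 * (\<integral>\<omega>. (\<Phi> k \<omega>)\<^sup>2 \<partial>\<mu>)" for k
          using integral_square_le_double [OF sq(1) square_integrable_cmult [OF sq(2), of "-1"], of k k] by simp
        then have "real (k + 1) powr (- r) * (\<integral>\<omega>. (?A k \<omega>)\<^sup>2 \<partial>\<mu>) \<le> real (k + 1) powr (- r) *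
            (2 * (\<integral>\<omega>. (\<Psi> x k \<omega>)\<^sup>2 \<partial>\<mu>) + 2 * (\<integral>\<omega>. (\<Phi> k \<omega>)\<^sup>2 \<partial>\<mu>))" for k
          by (intro mult_left_mono) auto
        then show "\<exists>K. \<forall>k\<ge>K. norm (real (k + 1) powr (- r) * (\<integral>\<omega>. (?A k \<omega>)\<^sup>2 \<partial>\<mu>)) \<le>
            2 * (real (k + 1) powr (- r) * (\<integral>\<omega>. (\<Psi> x k \<omega>)\<^sup>2 \<partial>\<mu>)) + 2 * (real (k + 1) powr (- r) * (\<integral>\<omega>. (\<Phi> k \<omega>)\<^sup>2 \<partial>\<mu>))"
          by (simp add: algebra_simps)
      qed
      have "?S ?A \<ge> 0" by (intro suminf_nonneg sA) auto
      then have "?S ?A < c * e"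
        using elim(1) unfolding D2_norm_def by simp
      then have "?S ?A / c < e" using \<open>c > 0\<close> by (simp add: pos_divide_less_eq mult.commute)
      have "D2_pairing \<mu> (\<Psi> x) J - D2_pairing \<mu> \<Phi> J = (\<Sum>k. \<integral>\<omega>. ?A k \<omega> * J k \<omega> \<partial>\<mu>)"
        unfolding D2_pairing_def
        by (subst suminf_diff [OF summ [OF sq(1) sm(1)] summ [OF sq(2) sm(2)]])
          (simp add: left_diff_distrib square_integrable_mult sq sqJ)
      also have "\<bar>\<dots>\<bar> \<le> (?S ?A / c + c * M) / 2"
        by (rule le [OF square_integrable_diff [OF sq] sA \<open>c > 0\<close>])
      also have "\<dots> < e" using \<open>?S ?A / c < e\<close> \<open>c * M < e\<close> by simp
      finally show ?case by (simp add: dist_real_def)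
    qed
  qed
qed

text \<open>Partial sums of both expansions converge in mean square, and orthogonality of the orders
  leaves only the diagonal terms of their product.\<close>

lemma (in wiener_process) D2_pairing_eq_integral:
  assumes X: "has_chaos_expansion \<mu> X \<Psi>" and Y: "has_chaos_expansion \<mu> Y J"
  shows "D2_pairing \<mu> \<Psi> J = (\<integral>\<omega>. X \<omega> * Y \<omega> \<partial>\<mu>)"
proof -
  have c: "\<Psi> k \<in> chaos \<mu> k" "J k \<in> chaos \<mu> k" for k
    using X Y by (auto simp: has_chaos_expansion_def)
  have lim: "(\<lambda>n. \<integral>\<omega>. (\<Sum>k\<le>n. \<Psi> k \<omega>) * (\<Sum>k\<le>n. J k \<omega>) \<partial>\<mu>) \<longlonglongrightarrow> (\<integral>\<omega>. X \<omega> * Y \<omega> \<partial>\<mu>)"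
    using X Y by (intro tendsto_integral_mult_L2) (auto simp: has_chaos_expansion_def)
  have "(\<integral>\<omega>. (\<Sum>k\<le>n. \<Psi> k \<omega>) * (\<Sum>k\<le>n. J k \<omega>) \<partial>\<mu>) = (\<Sum>k\<le>n. \<integral>\<omega>. \<Psi> k \<omega> * J k \<omega> \<partial>\<mu>)" for n
  proof -
    have "(\<integral>\<omega>. (\<Sum>k\<le>n. \<Psi> k \<omega>) * (\<Sum>k\<le>n. J k \<omega>) \<partial>\<mu>) = (\<Sum>k\<le>n. \<Sum>l\<le>n. \<integral>\<omega>. \<Psi> k \<omega> * J l \<omega> \<partial>\<mu>)"
      by (simp add: sum_product square_integrable_mult chaos_square_integrable [OF c(1)] chaos_square_integrable [OF c(2)])
    also have "\<dots> = (\<Sum>k\<le>n. \<Sum>l\<le>n. if l = k then \<integral>\<omega>. \<Psi> k \<omega> * J k \<omega> \<partial>\<mu> else 0)"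
      by (intro sum.cong refl) (auto simp: chaos_orthogonal [OF c])
    finally show ?thesis by simp
  qed
  with lim have "(\<lambda>k. \<integral>\<omega>. \<Psi> k \<omega> * J k \<omega> \<partial>\<mu>) sums (\<integral>\<omega>. X \<omega> * Y \<omega> \<partial>\<mu>)"
    by (simp add: sums_def_le)
  then show ?thesis unfolding D2_pairing_def by (rule sums_unique [symmetric])
qed

section \<open>Measures on Wiener space are determined by trigonometric functionals\<close>

text \<open>Levy's theorem concerns probability measures: the characters at t = 0 equate the total
  masses, and a nonzero mass is divided out.\<close>

lemma finite_measure_char_unique:
  fixes M N :: "real measure"
  assumes fin: "finite_measure M" "finite_measure N" and sets: "sets M = sets borel" "sets N = sets borel"
    and char: "\<And>t. (CLINT x|M. iexp (t * x)) = (CLINT x|N. iexp (t * x))"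
  shows "M = N"
proof -
  interpret M: finite_measure M by fact
  have sp: "space M = UNIV" "space N = UNIV"
    using sets_eq_imp_space_eq [OF sets(1)] sets_eq_imp_space_eq [OF sets(2)] by simp_all
  define m where "m = measure M UNIV"
  have mN: "m = measure N UNIV" using char [of 0] by (simp add: sp m_def)
  show ?thesis
  proof (cases "m = 0")
    case True
    then have "emeasure M UNIV = 0" "emeasure N UNIV = 0"
      using mN by (simp_all add: m_def finite_measure.emeasure_eq_measure [OF fin(1)] finite_measure.emeasure_eq_measure [OF fin(2)])
    then have "emeasure M A = 0" "emeasure N A = 0" for A
      using emeasure_space [of M A] emeasure_space [of N A] by (simp_all add: sp)
    then show ?thesis using sets by (intro measure_eqI) auto
  next
    case False
    then have m: "m > 0" by (simp add: m_def zero_less_measure_iff)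
    have rd: "real_distribution (density L (\<lambda>_. ennreal (1 / m)))"
      if "finite_measure L" "sets L = sets borel" "measure L UNIV = m" for L :: "real measure"
    proof -
      interpret finite_measure L by fact
      have "space L = UNIV" using sets_eq_imp_space_eq [OF that(2)] by simp
      then have "emeasure (density L (\<lambda>_. ennreal (1 / m))) UNIV = 1"
        using that(2,3) m by (simp add: emeasure_density_const emeasure_eq_measure ennreal_mult [symmetric])
      then show ?thesis
        using that(2) \<open>space L = UNIV\<close>
        by (intro real_distribution.intro real_distribution_axioms.intro prob_spaceI) auto
    qed
    have "density M (\<lambda>_. ennreal (1 / m)) = density N (\<lambda>_. ennreal (1 / m))"
    proof (rule Levy_uniqueness)
      show "char (density M (\<lambda>_. ennreal (1 / m))) = char (density N (\<lambda>_. ennreal (1 / m)))"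
        using char m sets unfolding char_def by (intro ext) (simp add: integral_density)
    qed (use rd fin sets mN in \<open>auto simp: m_def\<close>)
    then have "ennreal (1 / m) * emeasure M A = ennreal (1 / m) * emeasure N A" if "A \<in> sets borel" for A
      using that sets by (metis emeasure_density_const)
    then show ?thesis
      using sets m by (intro measure_eqI) (auto simp: ennreal_mult_cancel_left)
  qed
qed

text \<open>The cosines are traded for indicators one coordinate at a time: the densities \<open>1 + cos (L + b)\<close> are
  nonnegative, so that uniqueness of characteristic functions applies on the line.\<close>
lemma integral_indicators_cos_eq:
  fixes X :: "'i \<Rightarrow> 'a \<Rightarrow> real"
  assumes fin: "finite_measure M" "finite_measure N" and sets: "sets M = sets N"
    and X: "\<And>i. i \<in> D \<Longrightarrow> X i \<in> borel_measurable M"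
    and H: "\<And>I \<kappa> b. finite I \<Longrightarrow> I \<subseteq> D \<Longrightarrow>
      (\<integral>x. cos ((\<Sum>i\<in>I. \<kappa> i * X i x) + b) \<partial>M) = (\<integral>x. cos ((\<Sum>i\<in>I. \<kappa> i * X i x) + b) \<partial>N)"
    and K: "finite K" "K \<subseteq> D" and R: "\<And>i. R i \<in> sets borel" and I: "finite I" "I \<subseteq> D"
  shows "(\<integral>x. (\<Prod>i\<in>K. indicator (R i) (X i x)) * cos ((\<Sum>i\<in>I. \<kappa> i * X i x) + b) \<partial>M) =
    (\<integral>x. (\<Prod>i\<in>K. indicator (R i) (X i x)) * cos ((\<Sum>i\<in>I. \<kappa> i * X i x) + b) \<partial>N)"
  using K I
proof (induction K arbitrary: I \<kappa> b)
  case empty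
  then show ?case using H by simp
next
  case (insert k K I0 \<kappa>0 b0)
  interpret M: finite_measure M by fact
  interpret N: finite_measure N by fact
  define P where "P x = (\<Prod>i\<in>K. indicator (R i) (X i x) :: real)" for x
  define L where "L I \<kappa> x = (\<Sum>i\<in>I. \<kappa> i * X i x)" for I \<kappa> x
  have XN: "X i \<in> borel_measurable N" if "i \<in> D" for i using X [OF that] by (simp cong: measurable_cong_sets add: sets)
  have [measurable]: "R i \<in> sets borel" for i by (rule R)
  have mP [measurable]: "P \<in> borel_measurable M" "P \<in> borel_measurable N"
    unfolding P_def using insert.prems X XN by (auto intro!: borel_measurable_prod simp: subset_eq)
  have mL: "L I \<kappa> \<in> borel_measurable M" "L I \<kappa> \<in> borel_measurable N" if "I \<subseteq> D" for I \<kappa>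
    unfolding L_def using that X XN by (auto intro!: borel_measurable_sum simp: subset_eq)
  have "k \<in> D" using insert.prems by auto
  have mk [measurable]: "X k \<in> borel_measurable M" "X k \<in> borel_measurable N" using X XN \<open>k \<in> D\<close> by auto
  have P01: "0 \<le> P x" "P x \<le> 1" for x unfolding P_def by (auto intro!: prod_nonneg prod_le_1)
  have IH: "(\<integral>x. P x * cos (L I \<kappa> x + b) \<partial>M) = (\<integral>x. P x * cos (L I \<kappa> x + b) \<partial>N)"
    if "finite I" "I \<subseteq> D" for I \<kappa> b
    unfolding P_def L_def using insert.IH insert.prems that by auto
  have bounded: "\<bar>P x * y\<bar> \<le> B" if "\<bar>y\<bar> \<le> B" for x y B
    using P01 [of x] that by (simp add: abs_mult mult_left_le_one_le order_trans [OF mult_left_le_one_le])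
  have intM: "integrable M (\<lambda>x. P x * f x)" if "\<And>x. \<bar>f x\<bar> \<le> B" "f \<in> borel_measurable M" for f and B :: real
    using that by (auto intro!: M.integrable_const_bound [where B = B] AE_I2 bounded)
  have intN: "integrable N (\<lambda>x. P x * f x)" if "\<And>x. \<bar>f x\<bar> \<le> B" "f \<in> borel_measurable N" for f and B :: real
    using that by (auto intro!: N.integrable_const_bound [where B = B] AE_I2 bounded)
  \<comment> \<open>The coefficient function adds t at k whether or not k already belongs to
    \<open>I\<close>.\<close>
  have add: "L (insert k I) (\<lambda>i. (if i \<in> I then \<kappa> i else 0) + (if i = k then t else 0)) x = L I \<kappa> x + t * X k x"
    if "finite I" for I \<kappa> t x
  proof -
    have "L (insert k I) (\<lambda>i. (if i \<in> I then \<kappa> i else 0) + (if i = k then t else 0)) x =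
        (\<Sum>i\<in>insert k I. if i \<in> I then \<kappa> i * X i x else 0) + (\<Sum>i\<in>insert k I. if i = k then t * X k x else 0)"
      unfolding L_def sum.distrib [symmetric] by (intro sum.cong refl) (auto simp: distrib_right)
    also have "(\<Sum>i\<in>insert k I. if i \<in> I then \<kappa> i * X i x else 0) = L I \<kappa> x"
      unfolding L_def using that by (intro sum.mono_neutral_cong_right) auto
    finally show ?thesis using that by simp
  qed
  have IHk: "(\<integral>x. P x * cos (L I \<kappa> x + t * X k x + b) \<partial>M) = (\<integral>x. P x * cos (L I \<kappa> x + t * X k x + b) \<partial>N)"
    if "finite I" "I \<subseteq> D" for I \<kappa> t b
    using IH [of "insert k I" "\<lambda>i. (if i \<in> I then \<kappa> i else 0) + (if i = k then t else 0)" b] that \<open>k \<in> D\<close>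
    by (simp add: add)
  have main: "(\<integral>x. indicator (R k) (X k x) * (P x * (1 + cos (L I \<kappa> x + b))) \<partial>M) =
      (\<integral>x. indicator (R k) (X k x) * (P x * (1 + cos (L I \<kappa> x + b))) \<partial>N)"
    if I: "finite I" "I \<subseteq> D" for I \<kappa> b
  proof -
    define g where "g x = P x * (1 + cos (L I \<kappa> x + b))" for x
    note [measurable] = mL [OF I(2)]
    have mg [measurable]: "g \<in> borel_measurable M" "g \<in> borel_measurable N" unfolding g_def by measurable
    have c1: "1 + cos y \<ge> 0" "\<bar>1 + cos y\<bar> \<le> 2" for y :: real
      using cos_ge_minus_one [of y] cos_le_one [of y] by linarith+
    have g0: "g x \<ge> 0" for x unfolding g_def using P01(1) c1(1) by simp
    have gint: "integrable M g" "integrable N g"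
      unfolding g_def by (auto intro!: intM [where B = 2] intN [where B = 2] c1)
    have cosint: "(\<integral>x. g x * cos (t * X k x + a) \<partial>M) = (\<integral>x. g x * cos (t * X k x + a) \<partial>N)" for t a
    proof -
      \<comment> \<open>The product-to-sum formula returns to single cosines, to which the induction
        hypothesis applies with the frequency t or - t added in coordinate k.\<close>
      have eq: "g x * cos (t * X k x + a) = P x * cos (L {} \<kappa> x + t * X k x + a) +
          (P x * cos (L I \<kappa> x + t * X k x + (b + a)) / 2 + P x * cos (L I \<kappa> x + (- t) * X k x + (b - a)) / 2)" for x
      proof -
        have "cos (L I \<kappa> x + b) * cos (t * X k x + a) =
            (cos (L I \<kappa> x + t * X k x + (b + a)) + cos (L I \<kappa> x + (- t) * X k x + (b - a))) / 2"
          using cos_times_cos [of "L I \<kappa> x + b" "t * X k x + a"] by (simp add: algebra_simps)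
        then show ?thesis by (simp add: g_def L_def ring_distribs mult.assoc add_divide_distrib)
      qed
      have E: "L {} \<kappa> x = 0" for x by (simp add: L_def)
      have int: "integrable M (\<lambda>x. P x * cos (L {} \<kappa> x + t * X k x + a))" "integrable N (\<lambda>x. P x * cos (L {} \<kappa> x + t * X k x + a))"
        "integrable M (\<lambda>x. P x * cos (L I \<kappa> x + s * X k x + c))" "integrable N (\<lambda>x. P x * cos (L I \<kappa> x + s * X k x + c))" for s c
        unfolding E by (auto intro!: intM [where B = 1] intN [where B = 1])
      show ?thesis
        unfolding eq
        using int(1,2) int(3,4) [of t "b + a"] int(3,4) [of "- t" "b - a"]
          IHk [OF I, of \<kappa> t "b + a"] IHk [OF I, of \<kappa> "- t" "b - a"] IHk [of "{}" \<kappa> t a] by simp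
    qed
    have "distr (density M g) borel (X k) = distr (density N g) borel (X k)"
    proof (rule finite_measure_char_unique)
      have "finite_measure (distr (density Q g) borel (X k))"
        if [measurable]: "X k \<in> borel_measurable Q" "g \<in> borel_measurable Q" and int: "integrable Q g" for Q
      proof (rule finite_measure.finite_measure_distr)
        have "emeasure (density Q g) (space Q) = (\<integral>\<^sup>+x. ennreal (g x) \<partial>Q)"
          by (subst emeasure_density) (auto intro!: nn_integral_cong)
        also have "\<dots> = ennreal (\<integral>x. g x \<partial>Q)" using int g0 by (simp add: nn_integral_eq_integral)
        finally show "finite_measure (density Q g)" by (intro finite_measureI) simp
      qed simp
      then show "finite_measure (distr (density M g) borel (X k))" "finite_measure (distr (density N g) borel (X k))"
        using mk mg gint by auto
      fix t :: real
      \<comment> \<open>The sine is a cosine with shifted phase, so equality for cosines of all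
        phases covers the whole character.\<close>
      have iexp: "iexp y = complex_of_real (cos (y + 0)) + \<i> * complex_of_real (cos (y + - (pi / 2)))" for y
        by (simp add: complex_eq_iff cos_diff exp_i_of_real_eq_cis)
      have split: "(CLINT x|distr (density Q g) borel (X k). iexp (t * x)) =
          complex_of_real (\<integral>x. g x * cos (t * X k x + 0) \<partial>Q) + \<i> * complex_of_real (\<integral>x. g x * cos (t * X k x + - (pi / 2)) \<partial>Q)"
        if [measurable]: "X k \<in> borel_measurable Q" "g \<in> borel_measurable Q" and int: "integrable Q g" for Q
      proof -
        have i: "integrable Q (\<lambda>x. g x * cos (t * X k x + a))" for a
          by (rule Bochner_Integration.integrable_bound [OF int]) (auto simp: abs_mult mult_left_le)
        have "(CLINT x|distr (density Q g) borel (X k). iexp (t * x)) = (CLINT x|Q. g x *\<^sub>R iexp (t * X k x))"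
          using g0 by (subst integral_distr) (auto simp: integral_density)
        also have "\<dots> = (CLINT x|Q. complex_of_real (g x * cos (t * X k x + 0)) + \<i> * complex_of_real (g x * cos (t * X k x + - (pi / 2))))"
          unfolding iexp by (simp add: scaleR_conv_of_real algebra_simps)
        also have "\<dots> = complex_of_real (\<integral>x. g x * cos (t * X k x + 0) \<partial>Q) + \<i> * complex_of_real (\<integral>x. g x * cos (t * X k x + - (pi / 2)) \<partial>Q)"
        proof -
          have ic: "complex_integrable Q (\<lambda>x. complex_of_real (g x * cos (t * X k x + a)))" for a
            by (intro integrable_of_real i)
          show ?thesis
            by (simp only: Bochner_Integration.integral_add [OF ic integrable_mult_right [OF ic]]
                integral_mult_right_zero integral_complex_of_real)
        qed
        finally show ?thesis .
      qed
      show "(CLINT x|distr (density M g) borel (X k). iexp (t * x)) = (CLINT x|distr (density N g) borel (X k). iexp (t * x))"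
        unfolding split [OF mk(1) mg(1) gint(1)] split [OF mk(2) mg(2) gint(2)] by (simp only: cosint)
    qed auto
    then have "(\<integral>y. indicator (R k) y \<partial>distr (density M g) borel (X k)) = (\<integral>y. indicator (R k) y \<partial>distr (density N g) borel (X k) :: real)"
      by simp
    then show ?thesis
      unfolding g_def [symmetric] using g0
      by (subst (asm) (1 2) integral_distr; simp add: integral_density mult.commute)
  qed
  have ind: "(\<Prod>i\<in>insert k K. indicator (R i) (X i x)) = indicator (R k) (X k x) * P x" for x
    using insert.hyps by (simp add: P_def)
  have int: "integrable M (\<lambda>x. P x * (indicator (R k) (X k x) * cos (L I \<kappa> x + b)))"
    "integrable N (\<lambda>x. P x * (indicator (R k) (X k x) * cos (L I \<kappa> x + b)))" if "I \<subseteq> D" for I \<kappa> b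
  proof -
    note [measurable] = mL [OF that]
    show "integrable M (\<lambda>x. P x * (indicator (R k) (X k x) * cos (L I \<kappa> x + b)))"
      "integrable N (\<lambda>x. P x * (indicator (R k) (X k x) * cos (L I \<kappa> x + b)))"
      by (auto intro!: intM [where B = 1] intN [where B = 1] simp: abs_mult mult_le_one)
  qed
  have eq: "indicator (R k) (X k x) * (P x * (1 + cos (L I \<kappa> x + b))) =
      P x * (indicator (R k) (X k x) * cos (L {} \<kappa> x + 0)) + P x * (indicator (R k) (X k x) * cos (L I \<kappa> x + b))" for I \<kappa> b x
    by (simp add: L_def algebra_simps)
  note i0 = int [OF empty_subsetI, of \<kappa>0 0] and i1 = int [OF insert.prems(3), of \<kappa>0 b0]
  \<comment> \<open>For empty \<open>I\<close> and phase 0 the factor 1 + cos is the constant 2, so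
    \<open>main\<close> isolates the integral without a cosine, which is subtracted below.\<close>
  have A: "(\<integral>x. P x * (indicator (R k) (X k x) * cos (L {} \<kappa>0 x + 0)) \<partial>M) = (\<integral>x. P x * (indicator (R k) (X k x) * cos (L {} \<kappa>0 x + 0)) \<partial>N)"
    using main [of "{}" \<kappa>0 0, unfolded eq, unfolded Bochner_Integration.integral_add [OF i0(1) i0(1)]
        Bochner_Integration.integral_add [OF i0(2) i0(2)]] by simp
  have "(\<integral>x. P x * (indicator (R k) (X k x) * cos (L I0 \<kappa>0 x + b0)) \<partial>M) = (\<integral>x. P x * (indicator (R k) (X k x) * cos (L I0 \<kappa>0 x + b0)) \<partial>N)"
    using main [OF insert.prems(2,3), of \<kappa>0 b0, unfolded eq, unfolded Bochner_Integration.integral_add [OF i0(1) i1(1)]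
        Bochner_Integration.integral_add [OF i0(2) i1(2)]] A by linarith
  then show ?case unfolding ind L_def [symmetric] by (simp only: mult_ac)
qed

section \<open>Borel sets of Wiener space and coordinates at dyadic times\<close>

lemma dyadics_subset: "dyadics \<subseteq> {0..1}"
  using grid_range [OF grid_dyad] by (auto simp: dyadics_def)

lemma countable_dyadics: "countable dyadics"
  by (auto simp: dyadics_def)

lemma dyadics_dense:
  assumes "t \<in> {0..1}"
  shows "\<exists>s. (\<forall>n. s n \<in> dyadics) \<and> s \<longlonglongrightarrow> t"
proof (intro exI conjI allI)
  let ?s = "\<lambda>n. dyad n (nat \<lfloor>t * 2 ^ n\<rfloor>)"
  show "?s n \<in> dyadics" for n
  proof -
    have "t * 2 ^ n \<le> 2 ^ n" using assms by simp
    then have "real_of_int \<lfloor>t * 2 ^ n\<rfloor> \<le> real_of_int (2 ^ n)"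
      using of_int_floor_le [of "t * 2 ^ n"] unfolding of_int_power of_int_numeral by linarith
    then have "\<lfloor>t * 2 ^ n\<rfloor> \<le> 2 ^ n" by (simp only: of_int_le_iff)
    then have "nat \<lfloor>t * 2 ^ n\<rfloor> \<le> 2 ^ n" by (simp add: nat_le_iff)
    then show ?thesis unfolding dyadics_def by blast
  qed
  show "?s \<longlonglongrightarrow> t"
  proof (rule tendsto_sandwich)
    have r: "real (nat \<lfloor>t * 2 ^ n\<rfloor>) = of_int \<lfloor>t * 2 ^ n\<rfloor>" for n using assms by simp
    show "\<forall>\<^sub>F n in sequentially. t - 1 / 2 ^ n \<le> ?s n"
    proof (intro always_eventually allI)
      fix n
      have "t * 2 ^ n - 1 \<le> of_int \<lfloor>t * 2 ^ n\<rfloor>" by linarith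
      then have "(t * 2 ^ n - 1) / 2 ^ n \<le> of_int \<lfloor>t * 2 ^ n\<rfloor> / 2 ^ n" by (intro divide_right_mono) auto
      then show "t - 1 / 2 ^ n \<le> ?s n" by (simp add: dyad_def r diff_divide_distrib)
    qed
    show "\<forall>\<^sub>F n in sequentially. ?s n \<le> t"
    proof (intro always_eventually allI)
      fix n
      have "of_int \<lfloor>t * 2 ^ n\<rfloor> / 2 ^ n \<le> t * 2 ^ n / 2 ^ n" by (intro divide_right_mono) auto
      then show "?s n \<le> t" by (simp add: dyad_def r)
    qed
    show "(\<lambda>n. t - 1 / 2 ^ n) \<longlonglongrightarrow> t" by real_asymp
  qed auto
qed

lemma dist_wiener_le_dyadics:
  assumes "\<And>t. t \<in> dyadics \<Longrightarrow> dist (path \<omega> t) (path \<eta> t) \<le> b"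
  shows "dist \<omega> \<eta> \<le> b"
proof (rule dist_wiener_le)
  fix t :: real assume t: "t \<in> {0..1}"
  then obtain s where s: "\<And>n. s n \<in> dyadics" "s \<longlonglongrightarrow> t" using dyadics_dense by blast
  have "(\<lambda>n. path \<omega> (s n)) \<longlonglongrightarrow> path \<omega> t" "(\<lambda>n. path \<eta> (s n)) \<longlonglongrightarrow> path \<eta> t"
    using s dyadics_subset t
    by (auto intro!: continuous_on_tendsto_compose [OF path_continuous s(2)] always_eventually)
  then have "(\<lambda>n. dist (path \<omega> (s n)) (path \<eta> (s n))) \<longlonglongrightarrow> dist (path \<omega> t) (path \<eta> t)" by (rule tendsto_dist)
  then show "dist (path \<omega> t) (path \<eta> t) \<le> b"
    by (rule LIMSEQ_le_const2) (use assms s in auto)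
qed

text \<open>Wiener space is second countable, so an open set is a countable union of balls, and by
  continuity of paths a ball is described by countably many coordinates.\<close>

lemma measurable_wienerI:
  fixes f :: "'a \<Rightarrow> ('d::finite) wiener"
  assumes f: "\<And>t c. t \<in> dyadics \<Longrightarrow> (\<lambda>x. path (f x) t $ c) \<in> borel_measurable M"
  shows "f \<in> borel_measurable M"
proof (rule borel_measurableI)
  have v: "(\<lambda>x. path (f x) t) \<in> borel_measurable M" if "t \<in> dyadics" for t
    using f [OF that] by (subst borel_measurable_euclidean_space) (auto simp: Basis_vec_def inner_axis)
  have ball: "f -` ball \<eta> r \<inter> space M \<in> sets M" for \<eta> r
  proof -
    \<comment> \<open>Strict inequalities at dyadic times would bound the supremum only by r itself;
      the margin \<open>1 / real (Suc n)\<close> makes the bound strict.\<close>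
    have "dist \<eta> \<omega> < r \<longleftrightarrow> (\<exists>n. \<forall>t\<in>dyadics. dist (path \<eta> t) (path \<omega> t) \<le> r - 1 / real (Suc n))" (is "_ \<longleftrightarrow> ?R") for \<omega>
    proof
      assume "dist \<eta> \<omega> < r"
      then have "0 < r - dist \<eta> \<omega>" by simp
      then obtain n where "1 / real (Suc n) < r - dist \<eta> \<omega>" by (rule nat_approx_posE)
      then have "dist (path \<eta> t) (path \<omega> t) \<le> r - 1 / real (Suc n)" if "t \<in> dyadics" for t
        using dist_path_le [of t \<eta> \<omega>] that dyadics_subset by force
      then show ?R by blast
    next
      assume ?R
      then obtain n where "\<forall>t\<in>dyadics. dist (path \<eta> t) (path \<omega> t) \<le> r - 1 / real (Suc n)" by blast
      then have "dist \<eta> \<omega> \<le> r - 1 / real (Suc n)" by (intro dist_wiener_le_dyadics) auto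
      also have "\<dots> < r" by simp
      finally show "dist \<eta> \<omega> < r" .
    qed
    then have "f -` ball \<eta> r \<inter> space M =
        {x \<in> space M. \<exists>n. \<forall>t\<in>dyadics. dist (path \<eta> t) (path (f x) t) \<le> r - 1 / real (Suc n)}"
      by (auto simp only: vimage_def mem_ball)
    also have "\<dots> \<in> sets M"
      by (intro sets.sets_Collect_countable_Ex sets.sets_Collect_countable_All' countable_dyadics
          borel_measurable_le borel_measurable_dist v borel_measurable_const)
    finally show ?thesis .
  qed
  fix S :: "'d wiener set" assume "open S"
  let ?F = "{ball \<eta> r | \<eta> r. ball \<eta> r \<subseteq> S}"
  have "\<And>B. B \<in> ?F \<Longrightarrow> open B" by auto
  then obtain F' where F': "F' \<subseteq> ?F" "countable F'" "\<Union>F' = \<Union>?F" by (rule Lindelof)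
  have "S \<subseteq> \<Union>?F"
  proof
    fix x assume "x \<in> S"
    then obtain e where "e > 0" "ball x e \<subseteq> S" using \<open>open S\<close> open_contains_ball by blast
    then show "x \<in> \<Union>?F" by (intro UnionI [of "ball x e"]) auto
  qed
  then have "\<Union>?F = S" by blast
  then have "f -` S \<inter> space M = (\<Union>B\<in>F'. f -` B \<inter> space M)" using F'(3) by auto
  also have "\<dots> \<in> sets M" using F'(1) ball by (intro sets.countable_UN' [OF F'(2)]) auto
  finally show "f -` S \<inter> space M \<in> sets M" .
qed

text \<open>Rectangles in finitely many dyadic coordinates form an intersection-stable generator,
  and their measures are the integrals in \<open>integral_indicators_cos_eq\<close> with the cosine
  equal to 1.\<close>

lemma wiener_measure_eqI:
  fixes M N :: "('d::finite) wiener measure"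
  assumes fin: "finite_measure M" "finite_measure N" and sets: "sets M = sets borel" "sets N = sets borel"
    and H: "\<And>I \<kappa> b. finite I \<Longrightarrow> fst ` I \<subseteq> dyadics \<Longrightarrow>
      (\<integral>\<omega>. cos (lin I \<kappa> \<omega> + b) \<partial>M) = (\<integral>\<omega>. cos (lin I \<kappa> \<omega> + b) \<partial>N)"
  shows "M = N"
proof -
  interpret M: finite_measure M by fact
  interpret N: finite_measure N by fact
  define rect where "rect K R = {\<omega> :: 'd wiener. \<forall>p\<in>K. path \<omega> (fst p) $ snd p \<in> R p}" for K R
  define E where "E = {rect K R | K R. finite K \<and> K \<subseteq> dyadics \<times> UNIV \<and> (\<forall>p. R p \<in> sets borel)}"
  have rect_E: "rect K R \<in> E" if "finite K" "K \<subseteq> dyadics \<times> UNIV" "\<And>p. R p \<in> sets borel" for K R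
    using that unfolding E_def by blast
  have borel: "sets (borel :: 'd wiener measure) \<subseteq> sigma_sets UNIV E"
  proof -
    \<comment> \<open>Measurability of the identity amounts to the inclusion of the Borel sets in
      the generated \<sigma>-algebra.\<close>
    have "(\<lambda>\<omega>. \<omega>) \<in> borel_measurable (sigma UNIV E)"
    proof (rule measurable_wienerI)
      fix t :: real and c :: 'd assume t: "t \<in> dyadics"
      show "(\<lambda>\<omega>. path \<omega> t $ c) \<in> borel_measurable (sigma UNIV E)"
      proof (rule measurableI)
        fix A :: "real set" assume "A \<in> sets borel"
        then have "rect {(t, c)} (\<lambda>_. A) \<in> E" using t by (intro rect_E) auto
        then show "(\<lambda>\<omega>. path \<omega> t $ c) -` A \<inter> space (sigma UNIV E) \<in> sets (sigma UNIV E)"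
          by (auto simp: rect_def vimage_def)
      qed simp
    qed
    from measurable_sets [OF this] show ?thesis by auto
  qed
  have rect_meas: "rect K R \<in> sets borel" if "finite K" "\<And>p. R p \<in> sets borel" for K R
  proof -
    have "rect K R = (\<Inter>p\<in>K. (\<lambda>\<omega>. path \<omega> (fst p) $ snd p) -` R p \<inter> space borel)"
      by (auto simp: rect_def)
    also have "\<dots> \<in> sets borel"
    proof (cases "K = {}")
      case False
      then show ?thesis using that(1) by (intro sets.finite_INT measurable_sets [OF _ that(2)]) auto
    qed simp
    finally show ?thesis .
  qed
  have gen: "sets (borel :: 'd wiener measure) = sigma_sets UNIV E"
  proof
    have "E \<subseteq> sets borel" using rect_meas unfolding E_def by blast
    then show "sigma_sets UNIV E \<subseteq> sets (borel :: 'd wiener measure)"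
      using sets.sigma_sets_subset [of E borel] by simp
  qed (rule borel)
  have em: "emeasure Q (rect K R) = ennreal (\<integral>\<omega>. (\<Prod>p\<in>K. indicator (R p) (path \<omega> (fst p) $ snd p)) * cos ((\<Sum>p\<in>{}. 0 * path \<omega> (fst p) $ snd p) + 0) \<partial>Q)"
    if "finite_measure Q" "sets Q = sets borel" "finite K" "\<And>p. R p \<in> sets borel" for Q and K and R :: "real \<times> 'd \<Rightarrow> real set"
  proof -
    interpret finite_measure Q by fact
    have "(\<Prod>p\<in>K. indicator (R p) (path \<omega> (fst p) $ snd p)) = (indicator (rect K R) \<omega> :: real)" for \<omega>
      using that(3) by (auto simp: rect_def indicator_def prod_zero_iff)
    then show ?thesis
      using rect_meas [OF that(3,4)] that(2) by (simp add: emeasure_eq_measure)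
  qed
  show ?thesis
  proof (rule measure_eqI_generator_eq [where E = E and \<Omega> = UNIV and A = "\<lambda>_. UNIV"])
    show "Int_stable E"
    proof (rule Int_stableI)
      fix a b assume "a \<in> E" "b \<in> E"
      then obtain K R K' R' where ab: "a = rect K R" "b = rect K' R'" "finite K" "finite K'"
        "K \<subseteq> dyadics \<times> UNIV" "K' \<subseteq> dyadics \<times> UNIV" "\<And>p. R p \<in> sets borel" "\<And>p. R' p \<in> sets borel"
        unfolding E_def by blast
      have "a \<inter> b = rect (K \<union> K') (\<lambda>p. (if p \<in> K then R p else UNIV) \<inter> (if p \<in> K' then R' p else UNIV))"
        unfolding ab rect_def by auto
      also have "\<dots> \<in> E" using ab by (intro rect_E) auto
      finally show "a \<inter> b \<in> E" .
    qed
    show "sets M = sigma_sets UNIV E" "sets N = sigma_sets UNIV E" using sets gen by auto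
    show "range (\<lambda>_. UNIV) \<subseteq> E"
      using rect_E [of "{}" "\<lambda>_. UNIV"] by (auto simp: rect_def)
    fix X assume "X \<in> E"
    then obtain K R where X: "X = rect K R" "finite K" "K \<subseteq> dyadics \<times> UNIV" "\<And>p. R p \<in> sets borel"
      unfolding E_def by blast
    have "(\<integral>\<omega>. (\<Prod>p\<in>K. indicator (R p) (path \<omega> (fst p) $ snd p)) * cos ((\<Sum>p\<in>{}. 0 * path \<omega> (fst p) $ snd p) + 0) \<partial>M) =
        (\<integral>\<omega>. (\<Prod>p\<in>K. indicator (R p) (path \<omega> (fst p) $ snd p)) * cos ((\<Sum>p\<in>{}. 0 * path \<omega> (fst p) $ snd p) + 0) \<partial>N)"
    proof (rule integral_indicators_cos_eq [where D = "dyadics \<times> UNIV" and \<kappa> = "\<lambda>_. 0"])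
      show "(\<integral>\<omega>. cos ((\<Sum>i\<in>I. \<kappa> i * path \<omega> (fst i) $ snd i) + b) \<partial>M) = (\<integral>\<omega>. cos ((\<Sum>i\<in>I. \<kappa> i * path \<omega> (fst i) $ snd i) + b) \<partial>N)"
        if "finite I" "I \<subseteq> dyadics \<times> UNIV" for I \<kappa> b
        using H [of I \<kappa> b] that unfolding lin_def by force
      show "(\<lambda>\<omega>. path \<omega> (fst i) $ snd i) \<in> borel_measurable M" for i
        using sets by (simp cong: measurable_cong_sets)
    qed (use X fin sets in auto)
    then show "emeasure M X = emeasure N X"
      unfolding X(1) em [OF fin(1) sets(1) X(2,4)] em [OF fin(2) sets(2) X(2,4)] by simp
  qed (auto simp: M.emeasure_finite)
qed

section \<open>Brownian bridges and the heat kernel\<close>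

text \<open>The two times range over a compact square, so a subsequence of them converges, and
  uniform convergence of the paths carries the equation to the limit. The limit times differ because
  an increment between equal times is 0.\<close>

lemma closed_E_set:
  fixes u :: "real ^ ('d::finite)"
  assumes "u \<noteq> 0"
  shows "closed (E_set u)"
  unfolding closed_sequential_limits
proof (intro allI impI, elim conjE)
  fix f :: "nat \<Rightarrow> 'd wiener" and \<phi> assume f: "\<forall>n. f n \<in> E_set u" and lim: "f \<longlonglongrightarrow> \<phi>"
  from f have "\<forall>n. \<exists>p. 0 \<le> fst p \<and> fst p < snd p \<and> snd p \<le> 1 \<and> path (f n) (snd p) - path (f n) (fst p) = u"
    by (simp add: E_set_def)
  then obtain p where p: "\<And>n. 0 \<le> fst (p n)" "\<And>n. fst (p n) < snd (p n)" "\<And>n. snd (p n) \<le> 1"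
    "\<And>n. path (f n) (snd (p n)) - path (f n) (fst (p n)) = u" by metis
  have p01: "fst (p n) \<in> {0..1}" "snd (p n) \<in> {0..1}" for n
    using p(1-3) [of n] by auto
  have "seq_compact ({0..1::real} \<times> {0..1::real})"
    by (intro compact_imp_seq_compact compact_Times compact_Icc)
  moreover have "\<forall>n. p n \<in> {0..1} \<times> {0..1}" using p01 by (auto simp: mem_Times_iff)
  ultimately obtain q r where q: "q \<in> {0..1} \<times> {0..1}" "strict_mono r" "(p \<circ> r) \<longlonglongrightarrow> q"
    unfolding seq_compact_def by meson
  have flim: "(\<lambda>n. f (r n)) \<longlonglongrightarrow> \<phi>" using LIMSEQ_subseq_LIMSEQ [OF lim q(2)] by (simp add: comp_def)
  have path_lim: "(\<lambda>n. path (f (r n)) (x n)) \<longlonglongrightarrow> path \<phi> y"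
    if x: "x \<longlonglongrightarrow> y" "\<And>n. x n \<in> {0..1}" "y \<in> {0..1}" for x y
  proof -
    have 1: "(\<lambda>n. path \<phi> (x n)) \<longlonglongrightarrow> path \<phi> y"
      by (rule continuous_on_tendsto_compose [OF path_continuous x(1,3)]) (intro always_eventually allI x(2))
    have 2: "(\<lambda>n. dist (path (f (r n)) (x n)) (path \<phi> (x n))) \<longlonglongrightarrow> 0"
      by (rule tendsto_sandwich [of "\<lambda>_. 0", OF _ _ tendsto_const tendsto_dist_iff [THEN iffD1, OF flim]])
        (auto intro!: always_eventually dist_path_le x)
    show ?thesis
      by (rule Lim_transform [OF 1]) (use 2 in \<open>simp add: dist_norm tendsto_norm_zero_iff\<close>)
  qed
  have lims: "(\<lambda>n. fst (p (r n))) \<longlonglongrightarrow> fst q" "(\<lambda>n. snd (p (r n))) \<longlonglongrightarrow> snd q"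
    using tendsto_fst [OF q(3)] tendsto_snd [OF q(3)] by (simp_all add: comp_def)
  have q01: "fst q \<in> {0..1}" "snd q \<in> {0..1}" using q(1) by auto
  have "(\<lambda>n. path (f (r n)) (snd (p (r n))) - path (f (r n)) (fst (p (r n)))) \<longlonglongrightarrow> path \<phi> (snd q) - path \<phi> (fst q)"
    by (intro tendsto_diff path_lim lims p01 q01)
  then have u: "path \<phi> (snd q) - path \<phi> (fst q) = u" by (simp add: p LIMSEQ_const_iff)
  have "fst q \<le> snd q" by (rule LIMSEQ_le [OF lims]) (auto intro: less_imp_le p)
  moreover have "fst q \<noteq> snd q" using u assms by auto
  ultimately show "\<phi> \<in> E_set u" using u q01 unfolding E_set_def by force
qed

text \<open>Evaluation is jointly continuous for times in [0,1] and is 0 elsewhere by the choice of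
  representatives. Joint measurability is what Fubini over times and paths requires.\<close>

lemma measurable_path_joint:
  "(\<lambda>p :: ('d::finite) wiener \<times> real. path (fst p) (snd p)) \<in> borel_measurable (borel \<Otimes>\<^sub>M borel)"
proof -
  have "continuous_on (UNIV \<times> {0..1}) (\<lambda>p :: 'd wiener \<times> real. path (fst p) (snd p))"
    unfolding continuous_on_iff
  proof (intro ballI allI impI)
    fix p :: "'d wiener \<times> real" and e :: real assume p: "p \<in> UNIV \<times> {0..1}" and e: "0 < e"
    obtain \<omega> t where p_eq: "p = (\<omega>, t)" "t \<in> {0..1}" using p by (cases p) auto
    obtain d where d: "d > 0" "\<And>t'. t' \<in> {0..1} \<Longrightarrow> dist t' t < d \<Longrightarrow> dist (path \<omega> t') (path \<omega> t) < e / 2"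
      using path_continuous [of \<omega>, unfolded continuous_on_iff, rule_format, OF p_eq(2), of "e / 2"] e by auto
    show "\<exists>d>0. \<forall>p'\<in>UNIV \<times> {0..1}. dist p' p < d \<longrightarrow> dist (path (fst p') (snd p')) (path (fst p) (snd p)) < e"
    proof (intro exI [of _ "min d (e / 2)"] conjI ballI impI)
      fix p' :: "'d wiener \<times> real" assume p': "p' \<in> UNIV \<times> {0..1}" "dist p' p < min d (e / 2)"
      have "dist (fst p') \<omega> < e / 2" "dist (snd p') t < d"
        using p'(2) dist_fst_le [of p' p] dist_snd_le [of p' p] by (auto simp: p_eq)
      moreover have "dist (path (fst p') (snd p')) (path \<omega> (snd p')) \<le> dist (fst p') \<omega>"
        using p' by (intro dist_path_le) auto
      moreover have "dist (path \<omega> (snd p')) (path \<omega> t) < e / 2" using p' calculation(2) by (intro d(2)) auto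
      moreover have "dist (path (fst p') (snd p')) (path \<omega> t) \<le>
          dist (path (fst p') (snd p')) (path \<omega> (snd p')) + dist (path \<omega> (snd p')) (path \<omega> t)"
        by (rule dist_triangle)
      ultimately have "dist (path (fst p') (snd p')) (path \<omega> t) < e" by linarith
      then show "dist (path (fst p') (snd p')) (path (fst p) (snd p)) < e" by (simp add: p_eq)
    qed (use d e in auto)
  qed
  then have "(\<lambda>p :: 'd wiener \<times> real. indicator (UNIV \<times> {0..1}) p *\<^sub>R path (fst p) (snd p)) \<in> borel_measurable borel"
    by (intro borel_measurable_continuous_on_indicator borel_closed closed_Times) auto
  moreover have "indicator (UNIV \<times> {0..1}) p *\<^sub>R path (fst p) (snd p) = path (fst p) (snd p)" for p :: "'d wiener \<times> real"
    by (cases p) (auto simp: indicator_def path_outside)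
  ultimately show ?thesis by (simp add: borel_prod)
qed

lemma measurable_path_compose [measurable (raw)]:
  assumes "f \<in> borel_measurable M" "g \<in> borel_measurable M"
  shows "(\<lambda>x. path (f x) (g x)) \<in> borel_measurable M"
  using measurable_compose [OF measurable_Pair [OF assms] measurable_path_joint] by simp

text \<open>\<open>overlap s t r\<close> is the length of \<open>[0,r] \<inter> [s,t]\<close> when \<open>s \<le> t\<close>; clamping makes it vanish at \<open>r = 0\<close>.\<close>
definition overlap :: "real \<Rightarrow> real \<Rightarrow> real \<Rightarrow> real" where
  "overlap s t r = max 0 (min r t) - max 0 (min r s)"

text \<open>The path corrected by an affine drift on \<open>[s,t]\<close> so that its increment over \<open>[s,t]\<close> is \<open>z\<close>; under
  \<open>\<mu>\<close> this is the Brownian motion conditioned on that increment.\<close>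
definition bridge :: "real \<Rightarrow> real \<Rightarrow> real ^ 'd \<Rightarrow> ('d::finite) wiener \<Rightarrow> 'd wiener" where
  "bridge s t z \<omega> = Wiener (\<lambda>r. if r \<in> {0..1}
    then path \<omega> r + (overlap s t r / (t - s)) *\<^sub>R (z - (path \<omega> t - path \<omega> s)) else 0)"

lemma path_bridge:
  assumes "r \<in> {0..1}"
  shows "path (bridge s t z \<omega>) r = path \<omega> r + (overlap s t r / (t - s)) *\<^sub>R (z - (path \<omega> t - path \<omega> s))"
proof -
  let ?f = "\<lambda>r. path \<omega> r + (overlap s t r / (t - s)) *\<^sub>R (z - (path \<omega> t - path \<omega> s))"
  have "continuous_on {0..1} (\<lambda>r. overlap s t r / (t - s))"
    unfolding overlap_def divide_inverse by (intro continuous_intros)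
  then have "continuous_on {0..1} ?f"
    by (intro continuous_on_add continuous_on_scaleR continuous_on_const path_continuous)
  then have "continuous_on {0..1} (\<lambda>r. if r \<in> {0..1} then ?f r else 0)"
    by (rule continuous_on_eq) simp
  then show ?thesis
    unfolding bridge_def using assms by (subst Wiener_inverse) (auto simp: path_0 overlap_def)
qed

lemma bridge_in_E_set:
  assumes "0 \<le> s" "s < t" "t \<le> 1"
  shows "bridge s t u \<omega> \<in> E_set u"
proof -
  have "path (bridge s t u \<omega>) t - path (bridge s t u \<omega>) s = u"
    using assms by (subst (1 2) path_bridge) (auto simp: overlap_def)
  then show ?thesis using assms unfolding E_set_def by blast
qed

lemma measurable_bridge [measurable (raw)]:
  fixes z :: "'a \<Rightarrow> real ^ ('d::finite)"
  assumes [measurable]: "s \<in> borel_measurable M" "t \<in> borel_measurable M" "z \<in> borel_measurable M" "\<omega> \<in> borel_measurable M"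
  shows "(\<lambda>x. bridge (s x) (t x) (z x) (\<omega> x)) \<in> borel_measurable M"
proof (rule measurable_wienerI)
  fix r :: real and c :: 'd assume "r \<in> dyadics"
  then have "r \<in> {0..1}" using dyadics_subset by blast
  then show "(\<lambda>x. path (bridge (s x) (t x) (z x) (\<omega> x)) r $ c) \<in> borel_measurable M"
    by (simp only: path_bridge overlap_def) measurable
qed

section \<open>The heat kernel: factorisation, uniform bound, approximate identity\<close>

lemma heat_kernel_eq_prod:
  fixes z :: "real ^ ('d::finite)"
  assumes "\<epsilon> > 0"
  shows "heat_kernel \<epsilon> z = (\<Prod>c\<in>UNIV. normal_density 0 (sqrt \<epsilon>) (z $ c))"
proof -
  have "(\<Prod>c\<in>UNIV. normal_density 0 (sqrt \<epsilon>) (z $ c)) =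
      (1 / sqrt (2 * pi * \<epsilon>)) ^ CARD('d) * exp (\<Sum>c\<in>UNIV. - (z $ c)\<^sup>2 / (2 * \<epsilon>))"
    using assms unfolding normal_density_def prod.distrib prod_constant by (simp add: exp_sum)
  moreover have "(1 / sqrt (2 * pi * \<epsilon>)) ^ CARD('d) = (2 * pi * \<epsilon>) powr (- real CARD('d) / 2)"
  proof -
    have "(1 / sqrt (2 * pi * \<epsilon>)) ^ CARD('d) = ((2 * pi * \<epsilon>) powr (- (1 / 2))) powr real CARD('d)"
      using assms by (subst powr_realpow) (auto simp: powr_minus_divide powr_half_sqrt)
    then show ?thesis by (simp add: powr_powr)
  qed
  moreover have "(\<Sum>c\<in>UNIV. - (z $ c)\<^sup>2 / (2 * \<epsilon>)) = - (norm z)\<^sup>2 / (2 * \<epsilon>)"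
    by (simp add: norm_vec_def L2_set_def sum_nonneg sum_negf sum_divide_distrib)
  ultimately show ?thesis by (simp add: heat_kernel_def)
qed

lemma heat_kernel_nonneg: "heat_kernel \<epsilon> z \<ge> 0"
  by (simp add: heat_kernel_def)

lemma measurable_heat_kernel [measurable (raw)]:
  fixes z :: "'a \<Rightarrow> real ^ ('d::finite)"
  assumes [measurable]: "\<epsilon> \<in> borel_measurable M" "z \<in> borel_measurable M"
  shows "(\<lambda>x. heat_kernel (\<epsilon> x) (z x)) \<in> borel_measurable M"
  unfolding heat_kernel_def by measurable

lemma heat_kernel_le_0: "0 < \<epsilon> \<Longrightarrow> heat_kernel \<epsilon> z \<le> (2 * pi * \<epsilon>) powr (- real CARD('d) / 2)"
  for z :: "real ^ ('d::finite)"
  unfolding heat_kernel_def by (simp add: mult_left_le)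

text \<open>In the variable y = 1 / (2 \<epsilon>) the kernel is (y / \<pi>)^(d/2) exp (- |u|^2 y):
  the exponential wins for large y, and the power is bounded for small y. A bound uniform in
  \<epsilon> holds only away from the origin; it yields the finite mass of \<open>pinned u\<close>
  and the dominating function for the limit.\<close>

lemma heat_kernel_bounded:
  fixes u :: "real ^ ('d::finite)"
  assumes "u \<noteq> 0"
  shows "\<exists>C\<ge>0. \<forall>\<epsilon>>0. heat_kernel \<epsilon> u \<le> C"
proof -
  define a where "a = (norm u)\<^sup>2"
  define p where "p = real CARD('d) / 2"
  have ap: "a > 0" "p > 0" using assms by (auto simp: a_def p_def)
  define g where "g y = (y / pi) powr p * exp (- a * y)" for y
  have "(g \<longlongrightarrow> 0) at_top" unfolding g_def using ap by real_asymp
  then have "\<forall>\<^sub>F y in at_top. g y < 1" by (rule order_tendstoD(2)) simp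
  then obtain Y where Y: "\<And>y. y \<ge> Y \<Longrightarrow> g y < 1" by (auto simp: eventually_at_top_linorder)
  define C where "C = max 1 ((\<bar>Y\<bar> / pi) powr p)"
  have "g y \<le> C" if "y > 0" for y
  proof (cases "y \<ge> Y")
    case True
    then show ?thesis using Y [OF True] by (simp add: C_def)
  next
    case False
    have "g y \<le> (y / pi) powr p" unfolding g_def using that ap by (simp add: mult_left_le)
    also have "\<dots> \<le> (\<bar>Y\<bar> / pi) powr p"
      using that False ap by (intro powr_mono2 divide_right_mono) auto
    finally show ?thesis by (simp add: C_def)
  qed
  moreover have "heat_kernel \<epsilon> u = g (1 / (2 * \<epsilon>))" if "\<epsilon> > 0" for \<epsilon>
  proof -
    have "(2 * pi * \<epsilon>) powr (- real CARD('d) / 2) = (1 / (2 * \<epsilon>) / pi) powr p"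
      using that unfolding p_def by (simp add: powr_minus_divide powr_divide mult_ac)
    then show ?thesis by (simp add: heat_kernel_def g_def a_def)
  qed
  ultimately have "\<forall>\<epsilon>>0. heat_kernel \<epsilon> u \<le> C" by simp
  moreover have "C \<ge> 0" by (simp add: C_def)
  ultimately show ?thesis by blast
qed

text \<open>The substitution x = u + sqrt (e n) y moves the concentration from the density to the
  argument of \<open>f\<close>.\<close>

lemma normal_density_approx_identity:
  fixes f :: "real \<Rightarrow> complex"
  assumes f: "continuous_on UNIV f" "\<And>x. norm (f x) \<le> B" and e: "\<And>n. e n > 0" "e \<longlonglongrightarrow> 0"
  shows "(\<lambda>n. CLBINT x. normal_density 0 (sqrt (e n)) (x - u) *\<^sub>R f x) \<longlonglongrightarrow> f u"
proof -
  have [measurable]: "f \<in> borel_measurable borel" using f(1) by (rule borel_measurable_continuous_onI)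
  have eq: "(CLBINT x. normal_density 0 (sqrt (e n)) (x - u) *\<^sub>R f x) =
      (CLBINT y. std_normal_density y *\<^sub>R f (u + sqrt (e n) * y))" for n
  proof -
    have "sqrt (e n) * normal_density 0 (sqrt (e n)) (sqrt (e n) * y) = std_normal_density y" for y
      using e(1) [of n] by (simp add: normal_density_def power_mult_distrib real_sqrt_mult)
    then show ?thesis
      using e(1) [of n] by (subst lborel_integral_real_affine [of "sqrt (e n)" _ u])
        (auto simp flip: integral_scaleR_right)
  qed
  have "(\<lambda>n. CLBINT y. std_normal_density y *\<^sub>R f (u + sqrt (e n) * y)) \<longlonglongrightarrow> (CLBINT y. std_normal_density y *\<^sub>R f u)"
  proof (rule integral_dominated_convergence [where w = "\<lambda>y. B * std_normal_density y"])
    show "AE y in lborel. (\<lambda>n. std_normal_density y *\<^sub>R f (u + sqrt (e n) * y)) \<longlonglongrightarrow> std_normal_density y *\<^sub>R f u"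
    proof (intro AE_I2 tendsto_scaleR tendsto_const)
      fix y
      have "(\<lambda>n. u + sqrt (e n) * y) \<longlonglongrightarrow> u + sqrt 0 * y" by (intro tendsto_intros e)
      then show "(\<lambda>n. f (u + sqrt (e n) * y)) \<longlonglongrightarrow> f u"
        using continuous_on_tendsto_compose [OF f(1)] by simp
    qed
    show "AE y in lborel. norm (std_normal_density y *\<^sub>R f (u + sqrt (e n) * y)) \<le> B * std_normal_density y" for n
    proof (rule AE_I2)
      show "norm (std_normal_density y *\<^sub>R f (u + sqrt (e n) * y)) \<le> B * std_normal_density y" for y
        using mult_right_mono [OF f(2) normal_density_nonneg, of "u + sqrt (e n) * y"] by (simp add: mult.commute)
    qed
  qed auto
  then show ?thesis unfolding eq by simp
qed

text \<open>A narrow Gaussian weight at u evaluates density times character at u in the limit.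
  Without the character the value is exact, by convolution of normal laws; this exactness later
  gives domination in the time variables.\<close>

lemma (in prob_space) normal_density_expectation_tendsto:
  assumes T: "T > 0" and X: "distributed M lborel X (normal_density 0 (sqrt T))"
    and e: "\<And>n. e n > 0" "e \<longlonglongrightarrow> 0"
  shows "(\<lambda>n. CLINT x|M. normal_density 0 (sqrt (e n)) (X x - u) *\<^sub>R iexp (m * X x)) \<longlonglongrightarrow>
    normal_density 0 (sqrt T) u *\<^sub>R iexp (m * u)"
    and "(\<integral>x. normal_density 0 (sqrt (e n)) (X x - u) \<partial>M) = normal_density 0 (sqrt (e n + T)) u"
proof -
  have [measurable]: "X \<in> borel_measurable M" using X by (auto simp: distributed_def)
  have D: "distr M lborel X = density lborel (normal_density 0 (sqrt T))"
    using X by (simp add: distributed_def)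
  have E: "(\<integral>x. g (X x) \<partial>M) = (\<integral>x. normal_density 0 (sqrt T) x *\<^sub>R g x \<partial>lborel)"
    if [measurable]: "g \<in> borel_measurable borel" for g :: "real \<Rightarrow> 'c :: {banach, second_countable_topology}"
  proof -
    have "(\<integral>x. g (X x) \<partial>M) = (\<integral>x. g x \<partial>distr M lborel X)" by (subst integral_distr) auto
    then show ?thesis unfolding D by (subst (asm) integral_density) auto
  qed
  have "(\<lambda>n. CLBINT x. normal_density 0 (sqrt (e n)) (x - u) *\<^sub>R (normal_density 0 (sqrt T) x *\<^sub>R iexp (m * x))) \<longlonglongrightarrow>
    normal_density 0 (sqrt T) u *\<^sub>R iexp (m * u)"
  proof (rule normal_density_approx_identity [where B = "1 / sqrt (2 * pi * T)", OF _ _ e])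
    show "continuous_on UNIV (\<lambda>x. normal_density 0 (sqrt T) x *\<^sub>R iexp (m * x))"
      unfolding normal_density_def using T by (intro continuous_intros) auto
    show "norm (normal_density 0 (sqrt T) x *\<^sub>R iexp (m * x)) \<le> 1 / sqrt (2 * pi * T)" for x
      using T by (simp add: normal_density_def divide_right_mono)
  qed
  then show "(\<lambda>n. CLINT x|M. normal_density 0 (sqrt (e n)) (X x - u) *\<^sub>R iexp (m * X x)) \<longlonglongrightarrow>
    normal_density 0 (sqrt T) u *\<^sub>R iexp (m * u)"
    by (subst E [of "\<lambda>x. normal_density 0 (sqrt _) (x - u) *\<^sub>R iexp (m * x)"])
      (auto simp: mult.commute [of "normal_density 0 (sqrt T) _"])
  have "(\<integral>x. normal_density 0 (sqrt (e n)) (X x - u) \<partial>M) =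
      (\<integral>x. normal_density 0 (sqrt T) x * normal_density 0 (sqrt (e n)) (x - u) \<partial>lborel)"
    by (subst E) auto
  also have "\<dots> = enn2real (\<integral>\<^sup>+x. ennreal (normal_density 0 (sqrt T) x * normal_density 0 (sqrt (e n)) (x - u)) \<partial>lborel)"
    by (rule integral_eq_nn_integral) auto
  also have "(\<integral>\<^sup>+x. ennreal (normal_density 0 (sqrt T) x * normal_density 0 (sqrt (e n)) (x - u)) \<partial>lborel) =
      (\<integral>\<^sup>+x. ennreal (normal_density 0 (sqrt (e n)) (u - x) * normal_density 0 (sqrt T) x) \<partial>lborel)"
    by (intro nn_integral_cong) (simp add: normal_density_def power2_commute mult.commute)
  also have "\<dots> = ennreal (normal_density 0 (sqrt (e n + T)) u)"
    using fun_cong [OF conv_normal_density_zero_mean [of "sqrt (e n)" "sqrt T"], of u] e(1) [of n] T by simp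
  finally show "(\<integral>x. normal_density 0 (sqrt (e n)) (X x - u) \<partial>M) = normal_density 0 (sqrt (e n + T)) u" by simp
qed

section \<open>Increments over one interval and the law of the bridge\<close>

definition increment :: "real \<Rightarrow> real \<Rightarrow> ('d::finite) wiener \<Rightarrow> real ^ 'd" where
  "increment s t \<omega> = path \<omega> t - path \<omega> s"

lemma measurable_increment [measurable (raw)]:
  assumes [measurable]: "s \<in> borel_measurable M" "t \<in> borel_measurable M" "\<omega> \<in> borel_measurable M"
  shows "(\<lambda>x. increment (s x) (t x) (\<omega> x)) \<in> borel_measurable M"
  unfolding increment_def by measurable

lemma increment_bridge:
  assumes "0 \<le> s" "s < t" "t \<le> 1"
  shows "increment s t (bridge s t z \<omega>) = z"
  using assms unfolding increment_def by (subst (1 2) path_bridge) (auto simp: overlap_def)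

lemma prod_singleton_times: "(\<Prod>p\<in>{..<1::nat} \<times> UNIV. f (snd p)) = (\<Prod>c\<in>UNIV. f c)"
  by (rule prod.reindex_bij_witness [of _ "\<lambda>c. (0, c)" snd]) auto

lemma sum_atoms_between:
  assumes "j \<le> n"
  shows "(\<Sum>\<alpha>\<in>atoms n. if i \<le> fst \<alpha> \<and> fst \<alpha> < j then F \<alpha> else 0) = (\<Sum>c\<in>UNIV. \<Sum>k\<in>{i..<j}. F (k, c :: 'd::finite))"
proof -
  have "(\<Sum>\<alpha>\<in>atoms n. if i \<le> fst \<alpha> \<and> fst \<alpha> < j then F \<alpha> else 0) = (\<Sum>\<alpha>\<in>{i..<j} \<times> UNIV. F \<alpha>)"
    using assms by (intro sum.mono_neutral_cong_right finite_atoms) (auto simp: atoms_def)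
  also have "\<dots> = (\<Sum>k\<in>{i..<j}. \<Sum>c\<in>UNIV. F (k, c))" by (simp add: sum.cartesian_product)
  finally show ?thesis by (simp add: sum.swap [of _ UNIV])
qed

context wiener_process
begin

text \<open>The defining property of \<open>wiener_measure\<close> for the single step from s to t;
  the index set \<open>{..<1} \<times> UNIV\<close> is inherited from it.\<close>

lemma increment_indep:
  assumes "0 \<le> s" "s < t" "t \<le> 1"
  shows "indep_vars (\<lambda>_. borel) (\<lambda>p \<omega>. increment s t \<omega> $ snd p) ({..<1::nat} \<times> (UNIV :: 'd set))"
    and "distributed \<mu> lborel (\<lambda>\<omega>. increment s t \<omega> $ c) (normal_density 0 (sqrt (t - s)))"
proof -
  let ?t = "\<lambda>i::nat. if i = 0 then s else t"
  have t: "0 \<le> ?t 0 \<and> (\<forall>i<1. ?t i < ?t (Suc i)) \<and> ?t 1 \<le> 1" using assms by simp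
  have *: "indep_vars (\<lambda>_. borel) (\<lambda>(i, c) \<omega>. (path \<omega> (?t (Suc i)) - path \<omega> (?t i)) $ c) ({..<1} \<times> (UNIV :: 'd set))"
    "\<forall>i<1. \<forall>c. distributed \<mu> lborel (\<lambda>\<omega>. (path \<omega> (?t (Suc i)) - path \<omega> (?t i)) $ c)
        (normal_density 0 (sqrt (?t (Suc i) - ?t i)))"
    using wiener [unfolded wiener_measure_def, THEN conjunct2, THEN conjunct2, THEN spec [of _ 1],
        THEN spec [of _ ?t], THEN mp, OF t] by blast+
  have "indep_vars (\<lambda>_. borel) (\<lambda>p \<omega>. increment s t \<omega> $ snd p) ({..<1::nat} \<times> (UNIV :: 'd set)) \<longleftrightarrow>
    indep_vars (\<lambda>_. borel) (\<lambda>(i, c) \<omega>. (path \<omega> (?t (Suc i)) - path \<omega> (?t i)) $ c) ({..<1} \<times> (UNIV :: 'd set))"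
    by (rule indep_vars_cong) (auto simp: increment_def)
  then show "indep_vars (\<lambda>_. borel) (\<lambda>p \<omega>. increment s t \<omega> $ snd p) ({..<1::nat} \<times> (UNIV :: 'd set))"
    using *(1) by simp
  show "distributed \<mu> lborel (\<lambda>\<omega>. increment s t \<omega> $ c) (normal_density 0 (sqrt (t - s)))"
    using *(2) by (simp add: increment_def)
qed

text \<open>The heat kernel is a product over coordinates and the coordinates of the increment are
  independent, so both claims reduce to one normal variable. The first is the semigroup property of
  the heat kernel.\<close>

lemma heat_kernel_increment:
  assumes st: "0 \<le> s" "s < t" "t \<le> 1" and e: "\<And>n. e n > 0" "e \<longlonglongrightarrow> 0"
  shows "(\<integral>\<omega>. heat_kernel (e n) (increment s t \<omega> - u) \<partial>\<mu>) = heat_kernel (e n + (t - s)) u"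
    and "(\<lambda>n. CLINT \<omega>|\<mu>. heat_kernel (e n) (increment s t \<omega> - u) *\<^sub>R iexp (\<Sum>c\<in>UNIV. m c * increment s t \<omega> $ c))
      \<longlonglongrightarrow> heat_kernel (t - s) u *\<^sub>R iexp (\<Sum>c\<in>UNIV. m c * u $ c)"
proof -
  let ?K = "{..<1::nat} \<times> (UNIV :: 'd set)"
  let ?X = "\<lambda>c \<omega>. increment s t \<omega> $ c"
  note N = normal_density_expectation_tendsto [OF _ increment_indep(2) [OF st] e]
  have T: "t - s > 0" using st by simp
  have bd: "normal_density 0 (sqrt v) x \<le> 1 / sqrt (2 * pi * v)" if "v > 0" for v x
    using that by (simp add: normal_density_def divide_right_mono)
  have "(\<integral>\<omega>. heat_kernel (e n) (increment s t \<omega> - u) \<partial>\<mu>) =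
      (\<integral>\<omega>. (\<Prod>p\<in>?K. normal_density 0 (sqrt (e n)) (?X (snd p) \<omega> - u $ snd p)) \<partial>\<mu>)"
    using e(1) [of n] prod_singleton_times [of "\<lambda>c. normal_density 0 (sqrt (e n)) (?X c _ - u $ c)"]
    by (simp add: heat_kernel_eq_prod)
  also have "\<dots> = (\<Prod>p\<in>?K. \<integral>\<omega>. normal_density 0 (sqrt (e n)) (?X (snd p) \<omega> - u $ snd p) \<partial>\<mu>)"
  proof (rule indep_vars_lebesgue_integral)
    show "indep_vars (\<lambda>_. borel) (\<lambda>p \<omega>. normal_density 0 (sqrt (e n)) (?X (snd p) \<omega> - u $ snd p)) ?K"
      by (rule indep_vars_compose2 [OF increment_indep(1) [OF st]]) simp
    show "integrable \<mu> (\<lambda>\<omega>. normal_density 0 (sqrt (e n)) (?X (snd p) \<omega> - u $ snd p))" for p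
      using bd [OF e(1)] by (intro integrable_const_bound [where B = "1 / sqrt (2 * pi * e n)"]) auto
  qed simp
  also have "\<dots> = (\<Prod>c\<in>UNIV. normal_density 0 (sqrt (e n + (t - s))) (u $ c))"
    using prod_singleton_times [of "\<lambda>c. \<integral>\<omega>. normal_density 0 (sqrt (e n)) (?X c \<omega> - u $ c) \<partial>\<mu>"]
    by (simp only: N(2) [OF T])
  also have "\<dots> = heat_kernel (e n + (t - s)) u"
    using e(1) [of n] T by (simp add: heat_kernel_eq_prod)
  finally show "(\<integral>\<omega>. heat_kernel (e n) (increment s t \<omega> - u) \<partial>\<mu>) = heat_kernel (e n + (t - s)) u" .
  define G where "G n c x = normal_density 0 (sqrt (e n)) (x - u $ c) *\<^sub>R iexp (m c * x)" for n c x
  have split: "(\<Prod>c\<in>UNIV. r c *\<^sub>R iexp (m c * y c)) = (\<Prod>c\<in>UNIV. r c) *\<^sub>R iexp (\<Sum>c\<in>UNIV. m c * y c)" for r y :: "'d \<Rightarrow> real"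
    by (simp add: scaleR_conv_of_real prod.distrib exp_sum sum_distrib_left)
  have eq: "(CLINT \<omega>|\<mu>. heat_kernel (e n) (increment s t \<omega> - u) *\<^sub>R iexp (\<Sum>c\<in>UNIV. m c * ?X c \<omega>)) =
      (\<Prod>c\<in>UNIV. CLINT \<omega>|\<mu>. G n c (?X c \<omega>))" for n
  proof -
    have "heat_kernel (e n) (increment s t \<omega> - u) *\<^sub>R iexp (\<Sum>c\<in>UNIV. m c * ?X c \<omega>) = (\<Prod>p\<in>?K. G n (snd p) (?X (snd p) \<omega>))" for \<omega>
    proof -
      have "(\<Prod>p\<in>?K. G n (snd p) (?X (snd p) \<omega>)) = (\<Prod>c\<in>UNIV. G n c (?X c \<omega>))"
        by (rule prod_singleton_times [of "\<lambda>c. G n c (?X c \<omega>)"])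
      also have "\<dots> = heat_kernel (e n) (increment s t \<omega> - u) *\<^sub>R iexp (\<Sum>c\<in>UNIV. m c * ?X c \<omega>)"
        unfolding G_def split using e(1) [of n] by (simp add: heat_kernel_eq_prod)
      finally show ?thesis ..
    qed
    then have "(CLINT \<omega>|\<mu>. heat_kernel (e n) (increment s t \<omega> - u) *\<^sub>R iexp (\<Sum>c\<in>UNIV. m c * ?X c \<omega>)) =
        (CLINT \<omega>|\<mu>. \<Prod>p\<in>?K. G n (snd p) (?X (snd p) \<omega>))" by (simp only:)
    also have "\<dots> = (\<Prod>p\<in>?K. CLINT \<omega>|\<mu>. G n (snd p) (?X (snd p) \<omega>))"
    proof (rule indep_vars_lebesgue_integral)
      have [measurable]: "G n c \<in> borel_measurable borel" for c unfolding G_def by measurable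
      show "indep_vars (\<lambda>_. borel) (\<lambda>p \<omega>. G n (snd p) (?X (snd p) \<omega>)) ?K"
        by (rule indep_vars_compose2 [OF increment_indep(1) [OF st]]) simp
      show "complex_integrable \<mu> (\<lambda>\<omega>. G n (snd p) (?X (snd p) \<omega>))" for p
        using bd [OF e(1)] by (intro integrable_const_bound [where B = "1 / sqrt (2 * pi * e n)"]) (auto simp: G_def)
    qed simp
    finally show ?thesis by (simp only: prod_singleton_times [of "\<lambda>c. CLINT \<omega>|\<mu>. G n c (?X c \<omega>)"])
  qed
  have "(\<lambda>n. \<Prod>c\<in>UNIV. CLINT \<omega>|\<mu>. G n c (?X c \<omega>)) \<longlonglongrightarrow>
      (\<Prod>c\<in>UNIV. normal_density 0 (sqrt (t - s)) (u $ c) *\<^sub>R iexp (m c * u $ c))"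
    unfolding G_def by (intro tendsto_prod N(1) [OF T])
  also have "(\<Prod>c\<in>UNIV. normal_density 0 (sqrt (t - s)) (u $ c) *\<^sub>R iexp (m c * u $ c)) =
      heat_kernel (t - s) u *\<^sub>R iexp (\<Sum>c\<in>UNIV. m c * u $ c)"
    unfolding split using T by (simp add: heat_kernel_eq_prod)
  finally show "(\<lambda>n. CLINT \<omega>|\<mu>. heat_kernel (e n) (increment s t \<omega> - u) *\<^sub>R iexp (\<Sum>c\<in>UNIV. m c * increment s t \<omega> $ c))
      \<longlonglongrightarrow> heat_kernel (t - s) u *\<^sub>R iexp (\<Sum>c\<in>UNIV. m c * u $ c)"
    unfolding eq .
qed

text \<open>Orthogonal decomposition of a linear functional into its regression on the increment over \<open>[s,t]\<close>
  and a remainder, which are uncorrelated; in terms of characteristic functions, independent.\<close>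
lemma lin_bridge:
  fixes \<kappa> :: "real \<times> 'd \<Rightarrow> real"
  assumes st: "0 \<le> s" "s < t" "t \<le> 1" and I: "finite I" "fst ` I \<subseteq> {0..1}"
  shows "\<exists>m. (\<forall>z \<omega>. lin I \<kappa> (bridge s t z \<omega>) = lin I \<kappa> \<omega> + (\<Sum>c\<in>UNIV. m c * (z $ c - increment s t \<omega> $ c))) \<and>
    (CLINT \<omega>|\<mu>. iexp (lin I \<kappa> \<omega> - (\<Sum>c\<in>UNIV. m c * increment s t \<omega> $ c))) *
    (CLINT \<omega>|\<mu>. iexp (\<Sum>c\<in>UNIV. m c * increment s t \<omega> $ c)) = (CLINT \<omega>|\<mu>. iexp (lin I \<kappa> \<omega>))"
proof -
  have "finite (fst ` I \<union> {s, t})" "fst ` I \<union> {s, t} \<subseteq> {0..1}" using I st by auto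
  from grid_exists [OF this] obtain n \<tau> where g: "grid n \<tau>" and sub: "fst ` I \<union> {s, t} \<subseteq> \<tau> ` {..n}" by blast
  obtain i j where ij: "i \<le> n" "j \<le> n" "s = \<tau> i" "t = \<tau> j" using sub by auto
  interpret G: gaussian_family \<mu> "atoms n" "incr \<tau>" "gap \<tau>" by (rule gaussian_grid [OF g])
  define h where "h \<alpha> = lin_kernel I \<kappa> (\<tau> (Suc (fst \<alpha>)), snd \<alpha>)" for \<alpha>
  have L: "lin I \<kappa> \<omega> = (\<Sum>\<alpha>\<in>atoms n. h \<alpha> * incr \<tau> \<alpha> \<omega>)" for \<omega>
    unfolding h_def using sub by (intro lin_grid [OF g]) auto
  have ij': "i < j" using st(2) grid_less_iff [OF g ij(1,2)] by (simp add: ij)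
  \<comment> \<open>The mean over [s,t] of the kernel in coordinate c, that is, the regression
    coefficient; it makes \<open>p\<close> orthogonal to \<open>h - p\<close> in
    \<open>cross\<close>.\<close>
  define m where "m c = (\<Sum>k\<in>{i..<j}. h (k, c) * gap \<tau> (k, c)) / (t - s)" for c
  define q where "q \<alpha> \<longleftrightarrow> i \<le> fst \<alpha> \<and> fst \<alpha> < j" for \<alpha> :: "nat \<times> 'd"
  define p where "p \<alpha> = (if q \<alpha> then m (snd \<alpha>) else 0)" for \<alpha>
  have S: "(\<Sum>\<alpha>\<in>atoms n. if q \<alpha> then F \<alpha> else 0) = (\<Sum>c\<in>UNIV. \<Sum>k\<in>{i..<j}. F (k, c))" for F :: "nat \<times> 'd \<Rightarrow> real"
    unfolding q_def by (rule sum_atoms_between [OF ij(2)])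
  have gapsum: "(\<Sum>k\<in>{i..<j}. gap \<tau> (k, c)) = t - s" for c :: 'd
    using sum_Suc_diff' [of i j \<tau>] ij' by (simp add: gap_def ij)
  have X: "increment s t \<omega> $ c = (\<Sum>k\<in>{i..<j}. incr \<tau> (k, c) \<omega>)" for c and \<omega> :: "'d wiener"
    using incr_telescope [of i j \<omega> \<tau> c] ij' by (simp add: increment_def ij)
  have P: "(\<Sum>c\<in>UNIV. m c * increment s t \<omega> $ c) = (\<Sum>\<alpha>\<in>atoms n. p \<alpha> * incr \<tau> \<alpha> \<omega>)" for \<omega>
    using S [of "\<lambda>\<alpha>. m (snd \<alpha>) * incr \<tau> \<alpha> \<omega>"]
    by (simp add: X sum_distrib_left p_def if_distrib [of "\<lambda>y. y * _"] cong: if_cong)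
  \<comment> \<open>Since s and t are grid times, a grid cell lies either inside [s,t] or outside
    its interior.\<close>
  have ov: "overlap s t (\<tau> (Suc k)) - overlap s t (\<tau> k) = (if i \<le> k \<and> k < j then \<tau> (Suc k) - \<tau> k else 0)"
    if "k < n" for k
  proof -
    have "0 \<le> \<tau> k" "\<tau> k \<le> \<tau> (Suc k)" using that grid_range(1) [OF g, of k] grid_mono [OF g, of "Suc k" k] by auto
    moreover have "\<tau> k < s \<Longrightarrow> \<tau> (Suc k) \<le> s" "\<tau> k < t \<Longrightarrow> \<tau> (Suc k) \<le> t"
      "i \<le> k \<longleftrightarrow> s \<le> \<tau> k" "k < j \<longleftrightarrow> \<tau> k < t"
      using that ij grid_less_iff [OF g] grid_le_iff [OF g] by auto
    ultimately show ?thesis using st by (auto simp: overlap_def max_def min_def)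
  qed
  have B: "incr \<tau> \<alpha> (bridge s t z \<omega>) = incr \<tau> \<alpha> \<omega> +
      (if q \<alpha> then gap \<tau> \<alpha> / (t - s) * (z $ snd \<alpha> - increment s t \<omega> $ snd \<alpha>) else 0)" if "\<alpha> \<in> atoms n" for \<alpha> z \<omega>
  proof -
    obtain k c where \<alpha>: "\<alpha> = (k, c)" "k < n" using \<open>\<alpha> \<in> atoms n\<close> by (auto simp: atoms_def)
    have "\<tau> k \<in> {0..1}" "\<tau> (Suc k) \<in> {0..1}" using \<alpha>(2) grid_range [OF g] by auto
    then have "incr \<tau> \<alpha> (bridge s t z \<omega>) = incr \<tau> \<alpha> \<omega> +
        (overlap s t (\<tau> (Suc k)) - overlap s t (\<tau> k)) / (t - s) * (z $ c - increment s t \<omega> $ c)"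
      by (simp add: incr_def \<alpha> path_bridge increment_def diff_divide_distrib left_diff_distrib)
    then show ?thesis by (simp add: ov [OF \<alpha>(2)] q_def gap_def \<alpha>)
  qed
  have "lin I \<kappa> (bridge s t z \<omega>) = lin I \<kappa> \<omega> + (\<Sum>c\<in>UNIV. m c * (z $ c - increment s t \<omega> $ c))" for z \<omega>
  proof -
    let ?d = "\<lambda>c. z $ c - increment s t \<omega> $ c"
    have "lin I \<kappa> (bridge s t z \<omega>) = lin I \<kappa> \<omega> + (\<Sum>\<alpha>\<in>atoms n. if q \<alpha> then h \<alpha> * gap \<tau> \<alpha> / (t - s) * ?d (snd \<alpha>) else 0)"
      unfolding L sum.distrib [symmetric] by (intro sum.cong refl) (simp add: B algebra_simps)
    also have "(\<Sum>\<alpha>\<in>atoms n. if q \<alpha> then h \<alpha> * gap \<tau> \<alpha> / (t - s) * ?d (snd \<alpha>) else 0) = (\<Sum>c\<in>UNIV. m c * ?d c)"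
      unfolding S by (simp add: m_def sum_divide_distrib sum_distrib_right)
    finally show ?thesis .
  qed
  moreover have "(CLINT \<omega>|\<mu>. iexp (lin I \<kappa> \<omega> - (\<Sum>c\<in>UNIV. m c * increment s t \<omega> $ c))) *
    (CLINT \<omega>|\<mu>. iexp (\<Sum>c\<in>UNIV. m c * increment s t \<omega> $ c)) = (CLINT \<omega>|\<mu>. iexp (lin I \<kappa> \<omega>))"
  proof -
    have "(\<Sum>\<alpha>\<in>atoms n. p \<alpha> * (h \<alpha> - p \<alpha>) * gap \<tau> \<alpha>) = (\<Sum>\<alpha>\<in>atoms n. if q \<alpha> then m (snd \<alpha>) * (h \<alpha> - m (snd \<alpha>)) * gap \<tau> \<alpha> else 0)"
      by (intro sum.cong refl) (simp add: p_def)
    also have "\<dots> = (\<Sum>c\<in>UNIV. m c * ((\<Sum>k\<in>{i..<j}. h (k, c) * gap \<tau> (k, c)) - m c * (\<Sum>k\<in>{i..<j}. gap \<tau> (k, c))))"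
      unfolding S by (simp add: sum_distrib_left sum_subtractf [symmetric] algebra_simps)
    also have "\<dots> = 0" using st(2) by (simp add: gapsum m_def)
    \<comment> \<open>Orthogonality of regression and remainder splits the variance, hence
      factorises the characteristic function.\<close>
    finally have cross: "(\<Sum>\<alpha>\<in>atoms n. p \<alpha> * (h \<alpha> - p \<alpha>) * gap \<tau> \<alpha>) = 0" .
    have "(\<Sum>\<alpha>\<in>atoms n. (h \<alpha>)\<^sup>2 * gap \<tau> \<alpha>) =
        (\<Sum>\<alpha>\<in>atoms n. (h \<alpha> - p \<alpha>)\<^sup>2 * gap \<tau> \<alpha>) + (\<Sum>\<alpha>\<in>atoms n. (p \<alpha>)\<^sup>2 * gap \<tau> \<alpha>) + 2 * (\<Sum>\<alpha>\<in>atoms n. p \<alpha> * (h \<alpha> - p \<alpha>) * gap \<tau> \<alpha>)"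
      unfolding sum_distrib_left sum.distrib [symmetric] by (intro sum.cong refl) (simp add: power2_eq_square algebra_simps)
    then have var: "- (\<Sum>\<alpha>\<in>atoms n. (h \<alpha> - p \<alpha>)\<^sup>2 * gap \<tau> \<alpha>) / 2 + - (\<Sum>\<alpha>\<in>atoms n. (p \<alpha>)\<^sup>2 * gap \<tau> \<alpha>) / 2 =
        - (\<Sum>\<alpha>\<in>atoms n. (h \<alpha>)\<^sup>2 * gap \<tau> \<alpha>) / 2"
      unfolding cross by simp
    have Y: "lin I \<kappa> \<omega> - (\<Sum>c\<in>UNIV. m c * increment s t \<omega> $ c) = (\<Sum>\<alpha>\<in>atoms n. (h \<alpha> - p \<alpha>) * incr \<tau> \<alpha> \<omega>)" for \<omega>
      unfolding P L by (simp add: sum_subtractf left_diff_distrib)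
    show ?thesis
      unfolding Y unfolding P L G.char_linear of_real_mult [symmetric] exp_add [symmetric] var ..
  qed
  ultimately show ?thesis by blast
qed

text \<open>Of the two independent copies the first enters only through its increment and the second
  only through its remainder, so the integral factorises. The weight \<open>w\<close> is 1 when the
  law of the bridge is identified and a heat kernel when the limit is taken.\<close>

lemma bridge_expectation:
  fixes \<kappa> :: "real \<times> 'd \<Rightarrow> real"
  assumes m: "\<And>z \<omega>. lin I \<kappa> (bridge s t z \<omega>) = lin I \<kappa> \<omega> + (\<Sum>c\<in>UNIV. m c * (z $ c - increment s t \<omega> $ c))"
    and w [measurable]: "w \<in> borel_measurable borel" and bd: "\<And>x. \<bar>w x\<bar> \<le> B"
  shows "(\<integral>x. w (increment s t (fst x)) * cos (lin I \<kappa> (bridge s t (increment s t (fst x)) (snd x)) + b) \<partial>(\<mu> \<Otimes>\<^sub>M \<mu>)) =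
    Re (cis b * (CLINT \<omega>|\<mu>. w (increment s t \<omega>) *\<^sub>R iexp (\<Sum>c\<in>UNIV. m c * increment s t \<omega> $ c)) *
      (CLINT \<omega>|\<mu>. iexp (lin I \<kappa> \<omega> - (\<Sum>c\<in>UNIV. m c * increment s t \<omega> $ c))))"
proof -
  interpret pair_prob_space \<mu> \<mu> by unfold_locales
  let ?Z = "\<lambda>\<omega>. \<Sum>c\<in>UNIV. m c * increment s t \<omega> $ c"
  let ?f = "\<lambda>x. cis b * ((w (increment s t (fst x)) *\<^sub>R iexp (?Z (fst x))) * iexp (lin I \<kappa> (snd x) - ?Z (snd x)))"
  have pw: "w (increment s t (fst x)) * cos (lin I \<kappa> (bridge s t (increment s t (fst x)) (snd x)) + b) = Re (?f x)" for x
  proof -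
    have "lin I \<kappa> (bridge s t (increment s t (fst x)) (snd x)) + b = b + (?Z (fst x) + (lin I \<kappa> (snd x) - ?Z (snd x)))"
      unfolding m by (simp add: right_diff_distrib sum_subtractf)
    then have "cis (lin I \<kappa> (bridge s t (increment s t (fst x)) (snd x)) + b) =
        cis b * (cis (?Z (fst x)) * cis (lin I \<kappa> (snd x) - ?Z (snd x)))"
      by (simp only: cis_mult)
    then have "?f x = w (increment s t (fst x)) *\<^sub>R cis (lin I \<kappa> (bridge s t (increment s t (fst x)) (snd x)) + b)"
      unfolding exp_i_of_real_eq_cis by (simp only: mult_scaleR_left mult_scaleR_right)
    then show ?thesis by (simp del: mult_scaleR_left mult_scaleR_right)
  qed
  have int: "integrable (\<mu> \<Otimes>\<^sub>M \<mu>) ?f"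
    using bd by (intro P.integrable_const_bound [where B = B]) (auto simp: norm_mult)
  have "(\<integral>x. w (increment s t (fst x)) * cos (lin I \<kappa> (bridge s t (increment s t (fst x)) (snd x)) + b) \<partial>(\<mu> \<Otimes>\<^sub>M \<mu>)) =
      Re (CLINT x|\<mu> \<Otimes>\<^sub>M \<mu>. ?f x)"
    unfolding pw by (rule integral_Re [OF int])
  also have "(CLINT x|\<mu> \<Otimes>\<^sub>M \<mu>. ?f x) = (CLINT \<omega>'|\<mu>. CLINT \<omega>|\<mu>. ?f (\<omega>', \<omega>))"
    by (rule integral_fst' [OF int, symmetric])
  also have "\<dots> = cis b * ((CLINT \<omega>|\<mu>. w (increment s t \<omega>) *\<^sub>R iexp (?Z \<omega>)) * (CLINT \<omega>|\<mu>. iexp (lin I \<kappa> \<omega> - ?Z \<omega>)))"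
    by (simp only: fst_conv snd_conv integral_mult_right_zero integral_mult_left_zero)
  finally show ?thesis by (simp only: mult.assoc)
qed

text \<open>Inserting an independent copy of the increment into the bridge rebuilds Brownian motion,
  which is the disintegration of \<mu> along the increment. It is checked on cosines, where the two
  factors of \<open>lin_bridge\<close> recombine.\<close>

lemma distr_bridge:
  assumes st: "0 \<le> s" "s < t" "t \<le> 1"
  shows "distr (\<mu> \<Otimes>\<^sub>M \<mu>) borel (\<lambda>x. bridge s t (increment s t (fst x)) (snd x)) = \<mu>"
proof (rule wiener_measure_eqI)
  interpret PP: pair_prob_space \<mu> \<mu> by unfold_locales
  show "finite_measure (distr (\<mu> \<Otimes>\<^sub>M \<mu>) borel (\<lambda>x. bridge s t (increment s t (fst x)) (snd x)))"
    by (rule PP.P.finite_measure_distr) measurable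
  show "finite_measure \<mu>" by unfold_locales
  fix I :: "(real \<times> 'd) set" and \<kappa> b assume I: "finite I" "fst ` I \<subseteq> dyadics"
  then have "fst ` I \<subseteq> {0..1}" using dyadics_subset by blast
  from lin_bridge [OF st I(1) this] obtain m where
    m: "\<And>z \<omega>. lin I \<kappa> (bridge s t z \<omega>) = lin I \<kappa> \<omega> + (\<Sum>c\<in>UNIV. m c * (z $ c - increment s t \<omega> $ c))"
    and ch: "(CLINT \<omega>|\<mu>. iexp (lin I \<kappa> \<omega> - (\<Sum>c\<in>UNIV. m c * increment s t \<omega> $ c))) *
    (CLINT \<omega>|\<mu>. iexp (\<Sum>c\<in>UNIV. m c * increment s t \<omega> $ c)) = (CLINT \<omega>|\<mu>. iexp (lin I \<kappa> \<omega>))"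
    by blast
  have "(\<integral>\<omega>. cos (lin I \<kappa> \<omega> + b) \<partial>distr (\<mu> \<Otimes>\<^sub>M \<mu>) borel (\<lambda>x. bridge s t (increment s t (fst x)) (snd x))) =
      (\<integral>x. 1 * cos (lin I \<kappa> (bridge s t (increment s t (fst x)) (snd x)) + b) \<partial>(\<mu> \<Otimes>\<^sub>M \<mu>))"
    by (subst integral_distr) auto
  also have "\<dots> = Re (cis b * (CLINT \<omega>|\<mu>. 1 *\<^sub>R iexp (\<Sum>c\<in>UNIV. m c * increment s t \<omega> $ c)) *
      (CLINT \<omega>|\<mu>. iexp (lin I \<kappa> \<omega> - (\<Sum>c\<in>UNIV. m c * increment s t \<omega> $ c))))"
    by (rule bridge_expectation [OF m, where w = "\<lambda>_. 1" and B = 1]) auto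
  also have "\<dots> = Re (cis b * (CLINT \<omega>|\<mu>. iexp (lin I \<kappa> \<omega>)))"
    unfolding ch [symmetric] by (simp only: scaleR_one mult.assoc mult.commute)
  also have "\<dots> = Re (CLINT \<omega>|\<mu>. cis b * iexp (lin I \<kappa> \<omega>))" by simp
  also have "\<dots> = (\<integral>\<omega>. Re (cis b * iexp (lin I \<kappa> \<omega>)) \<partial>\<mu>)"
    by (rule integral_Re [symmetric], rule integrable_const_bound [where B = 1]) (auto simp: norm_mult)
  also have "\<dots> = (\<integral>\<omega>. cos (lin I \<kappa> \<omega> + b) \<partial>\<mu>)"
    by (simp only: exp_i_of_real_eq_cis cis_mult cis.sel add.commute)
  finally show "(\<integral>\<omega>. cos (lin I \<kappa> \<omega> + b) \<partial>distr (\<mu> \<Otimes>\<^sub>M \<mu>) borel (\<lambda>x. bridge s t (increment s t (fst x)) (snd x))) =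
      (\<integral>\<omega>. cos (lin I \<kappa> \<omega> + b) \<partial>\<mu>)" .
qed auto

text \<open>In the representation of \<open>distr_bridge\<close> the heat kernel sees only the first
  copy, whose increment the bridge has. In the limit the first factor concentrates at u, and the
  product is reassembled as an expectation over the bridge with increment u.\<close>

lemma heat_kernel_cos_tendsto:
  fixes \<kappa> :: "real \<times> 'd \<Rightarrow> real"
  assumes st: "0 \<le> s" "s < t" "t \<le> 1" and I: "finite I" "fst ` I \<subseteq> {0..1}" and e: "\<And>n. e n > 0" "e \<longlonglongrightarrow> 0"
  shows "(\<lambda>n. \<integral>\<omega>. heat_kernel (e n) (increment s t \<omega> - u) * cos (lin I \<kappa> \<omega> + b) \<partial>\<mu>)
    \<longlonglongrightarrow> heat_kernel (t - s) u * (\<integral>\<omega>. cos (lin I \<kappa> (bridge s t u \<omega>) + b) \<partial>\<mu>)"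
proof -
  interpret PP: pair_prob_space \<mu> \<mu> by unfold_locales
  from lin_bridge [OF st I] obtain m where
    m: "\<And>z \<omega>. lin I \<kappa> (bridge s t z \<omega>) = lin I \<kappa> \<omega> + (\<Sum>c\<in>UNIV. m c * (z $ c - increment s t \<omega> $ c))"
    by blast
  let ?Z = "\<lambda>\<omega>. \<Sum>c\<in>UNIV. m c * increment s t \<omega> $ c"
  define Y where "Y = (CLINT \<omega>|\<mu>. iexp (lin I \<kappa> \<omega> - ?Z \<omega>))"
  have eq: "(\<integral>\<omega>. heat_kernel (e n) (increment s t \<omega> - u) * cos (lin I \<kappa> \<omega> + b) \<partial>\<mu>) =
      Re (cis b * (CLINT \<omega>|\<mu>. heat_kernel (e n) (increment s t \<omega> - u) *\<^sub>R iexp (?Z \<omega>)) * Y)" for n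
  proof -
    have "(\<integral>\<omega>. heat_kernel (e n) (increment s t \<omega> - u) * cos (lin I \<kappa> \<omega> + b) \<partial>\<mu>) =
        (\<integral>\<omega>. heat_kernel (e n) (increment s t \<omega> - u) * cos (lin I \<kappa> \<omega> + b)
          \<partial>distr (\<mu> \<Otimes>\<^sub>M \<mu>) borel (\<lambda>x. bridge s t (increment s t (fst x)) (snd x)))"
      by (simp only: distr_bridge [OF st])
    also have "\<dots> = (\<integral>x. heat_kernel (e n) (increment s t (fst x) - u) *
        cos (lin I \<kappa> (bridge s t (increment s t (fst x)) (snd x)) + b) \<partial>(\<mu> \<Otimes>\<^sub>M \<mu>))"
      by (subst integral_distr) (auto simp: increment_bridge [OF st])
    also have "\<dots> = Re (cis b * (CLINT \<omega>|\<mu>. heat_kernel (e n) (increment s t \<omega> - u) *\<^sub>R iexp (?Z \<omega>)) * Y)"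
      unfolding Y_def
    proof (rule bridge_expectation [OF m, where w = "\<lambda>x. heat_kernel (e n) (x - u)"])
      show "\<bar>heat_kernel (e n) (x - u)\<bar> \<le> (2 * pi * e n) powr (- real CARD('d) / 2)" for x
        unfolding abs_of_nonneg [OF heat_kernel_nonneg] by (rule heat_kernel_le_0 [OF e(1)])
    qed measurable
    finally show ?thesis .
  qed
  have "(\<lambda>n. Re (cis b * (CLINT \<omega>|\<mu>. heat_kernel (e n) (increment s t \<omega> - u) *\<^sub>R iexp (?Z \<omega>)) * Y)) \<longlonglongrightarrow>
      Re (cis b * (heat_kernel (t - s) u *\<^sub>R iexp (\<Sum>c\<in>UNIV. m c * u $ c)) * Y)"
    by (intro tendsto_intros heat_kernel_increment(2) [OF st e])
  also have "Re (cis b * (heat_kernel (t - s) u *\<^sub>R iexp (\<Sum>c\<in>UNIV. m c * u $ c)) * Y) =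
      heat_kernel (t - s) u * Re (CLINT \<omega>|\<mu>. (cis b * iexp (\<Sum>c\<in>UNIV. m c * u $ c)) * iexp (lin I \<kappa> \<omega> - ?Z \<omega>))"
    unfolding Y_def integral_mult_right_zero mult_scaleR_left mult_scaleR_right scaleR_complex.sel ..
  also have "Re (CLINT \<omega>|\<mu>. (cis b * iexp (\<Sum>c\<in>UNIV. m c * u $ c)) * iexp (lin I \<kappa> \<omega> - ?Z \<omega>)) =
      (\<integral>\<omega>. Re ((cis b * iexp (\<Sum>c\<in>UNIV. m c * u $ c)) * iexp (lin I \<kappa> \<omega> - ?Z \<omega>)) \<partial>\<mu>)"
    by (rule integral_Re [symmetric], rule integrable_const_bound [where B = 1]) (auto simp: norm_mult)
  also have "\<dots> = (\<integral>\<omega>. cos (lin I \<kappa> (bridge s t u \<omega>) + b) \<partial>\<mu>)"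
    unfolding exp_i_of_real_eq_cis cis_mult cis.sel m
    by (intro Bochner_Integration.integral_cong refl arg_cong [of _ _ cos]) (simp add: right_diff_distrib sum_subtractf)
  finally show ?thesis unfolding eq .
qed

end

section \<open>Disintegration of the measure\<close>

definition time_pairs :: "(real \<times> real) set" where
  "time_pairs = {(s, t). 0 \<le> s \<and> s < t \<and> t \<le> 1}"

lemma time_pairs_sets: "time_pairs \<in> sets borel"
proof -
  have "time_pairs = {p. 0 \<le> fst p} \<inter> {p. fst p < snd p} \<inter> {p. snd p \<le> 1}"
    by (auto simp: time_pairs_def)
  also have "\<dots> \<in> sets borel"
    by (intro sets.Int borel_closed borel_open closed_Collect_le open_Collect_less continuous_intros)
  finally show ?thesis .
qed

lemma emeasure_time_pairs: "emeasure lborel time_pairs < \<infinity>"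
proof -
  have "time_pairs \<subseteq> {0..1} \<times> {0..1}" by (auto simp: time_pairs_def)
  then have "bounded time_pairs" by (rule bounded_subset [rotated]) (intro bounded_Times bounded_closed_interval)
  then show ?thesis using emeasure_bounded_finite by blast
qed

context wiener_process
begin

lemma integrable_time_pairs_pair:
  fixes f :: "(real \<times> real) \<times> 'd wiener \<Rightarrow> real"
  assumes [measurable]: "f \<in> borel_measurable (lborel \<Otimes>\<^sub>M \<mu>)"
    and bd: "\<And>p \<omega>. p \<in> time_pairs \<Longrightarrow> \<bar>f (p, \<omega>)\<bar> \<le> B"
  shows "integrable (lborel \<Otimes>\<^sub>M \<mu>) (\<lambda>x. indicator time_pairs (fst x) * f x)"
proof -
  have ind: "indicator time_pairs (fst x) * f x = indicator (time_pairs \<times> UNIV) x *\<^sub>R f x" for x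
    by (cases x) (simp add: indicator_def)
  have "time_pairs \<times> UNIV \<in> sets (lborel \<Otimes>\<^sub>M \<mu>)"
    using time_pairs_sets by (intro pair_measureI) auto
  moreover have "emeasure (lborel \<Otimes>\<^sub>M \<mu>) (time_pairs \<times> UNIV) < \<infinity>"
    using emeasure_time_pairs time_pairs_sets emeasure_space_1
    by (subst emeasure_pair_measure_Times) auto
  ultimately show ?thesis
    unfolding ind using bd by (intro integrableI_bounded_set_indicator [where B = B]) (auto intro!: AE_I2)
qed

text \<open>The disintegration of \<open>\<theta>\<^sub>u\<close> into pinned Wiener measures.\<close>
definition pinned :: "real ^ 'd \<Rightarrow> 'd wiener measure" where
  "pinned u = distr (density (lborel \<Otimes>\<^sub>M \<mu>)
      (\<lambda>x. ennreal (indicator time_pairs (fst x) * heat_kernel (snd (fst x) - fst (fst x)) u)))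
    borel (\<lambda>x. bridge (fst (fst x)) (snd (fst x)) u (snd x))"

lemma measurable_indicator_time_pairs [measurable]:
  "(\<lambda>x. indicator time_pairs (fst x) :: real) \<in> borel_measurable (lborel \<Otimes>\<^sub>M \<mu>)"
  using time_pairs_sets by measurable

lemma measurable_components [measurable]:
  "(\<lambda>x. fst (fst x)) \<in> borel_measurable (lborel \<Otimes>\<^sub>M \<mu> :: ((real \<times> real) \<times> 'd wiener) measure)"
  "(\<lambda>x. snd (fst x)) \<in> borel_measurable (lborel \<Otimes>\<^sub>M \<mu> :: ((real \<times> real) \<times> 'd wiener) measure)"
proof -
  have "fst \<in> borel_measurable (borel :: (real \<times> real) measure)" "snd \<in> borel_measurable (borel :: (real \<times> real) measure)"
    by (intro borel_measurable_continuous_onI continuous_intros)+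
  then have "fst \<in> borel_measurable (lborel :: (real \<times> real) measure)" "snd \<in> borel_measurable (lborel :: (real \<times> real) measure)"
    by simp_all
  then show "(\<lambda>x. fst (fst x)) \<in> borel_measurable (lborel \<Otimes>\<^sub>M \<mu> :: ((real \<times> real) \<times> 'd wiener) measure)"
    "(\<lambda>x. snd (fst x)) \<in> borel_measurable (lborel \<Otimes>\<^sub>M \<mu> :: ((real \<times> real) \<times> 'd wiener) measure)"
    by (auto intro: measurable_compose [OF measurable_fst])
qed

lemma sets_pinned [simp]: "sets (pinned u) = sets borel"
  by (simp add: pinned_def)

lemma integrable_heat_kernel_time_pairs:
  assumes "u \<noteq> 0"
  shows "integrable (lborel \<Otimes>\<^sub>M \<mu>) (\<lambda>x. indicator time_pairs (fst x) * heat_kernel (snd (fst x) - fst (fst x)) u)"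
proof -
  obtain C where "\<And>\<epsilon>. \<epsilon> > 0 \<Longrightarrow> heat_kernel \<epsilon> u \<le> C" using heat_kernel_bounded [OF assms] by blast
  moreover have "(\<lambda>x. heat_kernel (snd (fst x) - fst (fst x)) u)
      \<in> borel_measurable (lborel \<Otimes>\<^sub>M \<mu> :: ((real \<times> real) \<times> 'd wiener) measure)" by measurable
  ultimately show ?thesis
    by (intro integrable_time_pairs_pair [where B = C]) (simp_all add: time_pairs_def heat_kernel_nonneg case_prod_beta)
qed

lemma finite_measure_pinned:
  assumes "u \<noteq> 0"
  shows "finite_measure (pinned u)"
  unfolding pinned_def
proof (rule finite_measure.finite_measure_distr)
  let ?g = "\<lambda>x :: (real \<times> real) \<times> 'd wiener. indicator time_pairs (fst x) * heat_kernel (snd (fst x) - fst (fst x)) u"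
  have "emeasure (density (lborel \<Otimes>\<^sub>M \<mu>) (\<lambda>x. ennreal (?g x))) (space (lborel \<Otimes>\<^sub>M \<mu>)) = (\<integral>\<^sup>+x. ennreal (?g x) \<partial>(lborel \<Otimes>\<^sub>M \<mu>))"
    by (subst emeasure_density [OF _ sets.top]) (auto intro!: nn_integral_cong)
  also have "\<dots> = ennreal (\<integral>x. ?g x \<partial>(lborel \<Otimes>\<^sub>M \<mu>))"
    by (rule nn_integral_eq_integral [OF integrable_heat_kernel_time_pairs [OF assms]]) (simp add: heat_kernel_nonneg)
  finally show "finite_measure (density (lborel \<Otimes>\<^sub>M \<mu>) (\<lambda>x. ennreal (?g x)))" by (intro finite_measureI) simp
qed measurable

text \<open>The density vanishes off \<open>time_pairs\<close>, and on it every bridge with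
  increment u lies in \<open>E_set u\<close>, so the integrand is identically 0.\<close>

lemma pinned_E_set:
  assumes "u \<noteq> 0"
  shows "emeasure (pinned u) (- E_set u) = 0"
proof -
  let ?g = "\<lambda>x :: (real \<times> real) \<times> 'd wiener. indicator time_pairs (fst x) * heat_kernel (snd (fst x) - fst (fst x)) u"
  let ?b = "\<lambda>x :: (real \<times> real) \<times> 'd wiener. bridge (fst (fst x)) (snd (fst x)) u (snd x)"
  have E: "- E_set u \<in> sets borel" using closed_E_set [OF assms] by (intro borel_open) auto
  have b: "?b \<in> borel_measurable (lborel \<Otimes>\<^sub>M \<mu>)" by measurable
  have "emeasure (pinned u) (- E_set u) =
      emeasure (density (lborel \<Otimes>\<^sub>M \<mu>) (\<lambda>x. ennreal (?g x))) (?b -` (- E_set u) \<inter> space (lborel \<Otimes>\<^sub>M \<mu>))"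
    unfolding pinned_def using E b by (subst emeasure_distr) auto
  also have "\<dots> = (\<integral>\<^sup>+x. ennreal (?g x) * indicator (?b -` (- E_set u) \<inter> space (lborel \<Otimes>\<^sub>M \<mu>)) x \<partial>(lborel \<Otimes>\<^sub>M \<mu>))"
    using measurable_sets [OF b E] by (intro emeasure_density) auto
  also have "\<dots> = nn_integral (lborel \<Otimes>\<^sub>M \<mu>) (\<lambda>x :: (real \<times> real) \<times> 'd wiener. 0)"
    by (intro nn_integral_cong) (auto simp: indicator_def time_pairs_def bridge_in_E_set)
  finally show ?thesis by simp
qed

lemma integral_cos_pinned:
  fixes \<kappa> :: "real \<times> 'd \<Rightarrow> real"
  assumes "u \<noteq> 0"
  shows "(\<integral>\<omega>. cos (lin I \<kappa> \<omega> + b) \<partial>pinned u) =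
    (\<integral>p. indicator time_pairs p * (heat_kernel (snd p - fst p) u * (\<integral>\<omega>. cos (lin I \<kappa> (bridge (fst p) (snd p) u \<omega>) + b) \<partial>\<mu>)) \<partial>lborel)"
proof -
  interpret Q: pair_sigma_finite lborel \<mu> by unfold_locales
  let ?g = "\<lambda>x :: (real \<times> real) \<times> 'd wiener. indicator time_pairs (fst x) * heat_kernel (snd (fst x) - fst (fst x)) u"
  let ?b = "\<lambda>x :: (real \<times> real) \<times> 'd wiener. bridge (fst (fst x)) (snd (fst x)) u (snd x)"
  obtain C where C: "\<And>\<epsilon>. \<epsilon> > 0 \<Longrightarrow> heat_kernel \<epsilon> u \<le> C" using heat_kernel_bounded [OF assms] by blast
  have "(\<integral>\<omega>. cos (lin I \<kappa> \<omega> + b) \<partial>pinned u) = (\<integral>x. ?g x * cos (lin I \<kappa> (?b x) + b) \<partial>(lborel \<Otimes>\<^sub>M \<mu>))"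
    unfolding pinned_def by (subst integral_distr, measurable)
      (subst integral_density, auto simp: heat_kernel_nonneg)
  also have "\<dots> = (\<integral>x. indicator time_pairs (fst x) * (heat_kernel (snd (fst x) - fst (fst x)) u * cos (lin I \<kappa> (?b x) + b)) \<partial>(lborel \<Otimes>\<^sub>M \<mu>))"
    by (simp only: mult.assoc)
  also have "\<dots> = (\<integral>p. \<integral>\<omega>. indicator time_pairs (fst (p, \<omega>)) * (heat_kernel (snd (fst (p, \<omega>)) - fst (fst (p, \<omega>))) u * cos (lin I \<kappa> (?b (p, \<omega>)) + b)) \<partial>\<mu> \<partial>lborel)"
  proof (rule Q.integral_fst' [symmetric], rule integrable_time_pairs_pair [where B = C])
    show "\<bar>heat_kernel (snd (fst (p, \<omega>)) - fst (fst (p, \<omega>))) u * cos (lin I \<kappa> (?b (p, \<omega>)) + b)\<bar> \<le> C"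
      if "p \<in> time_pairs" for p \<omega>
    proof -
      have "\<bar>heat_kernel (snd p - fst p) u * cos (lin I \<kappa> (?b (p, \<omega>)) + b)\<bar> \<le> heat_kernel (snd p - fst p) u"
        by (simp add: abs_mult heat_kernel_nonneg mult_left_le)
      also have "\<dots> \<le> C" using that by (intro C) (auto simp: time_pairs_def)
      finally show ?thesis by simp
    qed
  qed measurable
  finally show ?thesis by simp
qed

text \<open>Fubini for fixed \<epsilon>, justified by bounding the heat kernel by its value at 0;
  that bound blows up as \<epsilon> tends to 0 and cannot serve for the limit.\<close>

lemma integral_rho2_approx_cos:
  fixes \<kappa> :: "real \<times> 'd \<Rightarrow> real"
  assumes "\<epsilon> > 0"
  shows "(\<integral>\<omega>. rho2_approx u \<epsilon> \<omega> * cos (lin I \<kappa> \<omega> + b) \<partial>\<mu>) =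
    (\<integral>p. indicator time_pairs p * (\<integral>\<omega>. heat_kernel \<epsilon> (increment (fst p) (snd p) \<omega> - u) * cos (lin I \<kappa> \<omega> + b) \<partial>\<mu>) \<partial>lborel)"
proof -
  interpret Q: pair_sigma_finite lborel \<mu> by unfold_locales
  let ?f = "\<lambda>x :: (real \<times> real) \<times> 'd wiener. indicator time_pairs (fst x) *
      (heat_kernel \<epsilon> (increment (fst (fst x)) (snd (fst x)) (snd x) - u) * cos (lin I \<kappa> (snd x) + b))"
  define B where "B = (2 * pi * \<epsilon>) powr (- real CARD('d) / 2)"
  have int: "integrable (lborel \<Otimes>\<^sub>M \<mu>) ?f"
  proof (rule integrable_time_pairs_pair [where B = B])
    fix p \<omega>
    have "\<bar>heat_kernel \<epsilon> z * cos y\<bar> \<le> B" for z :: "real ^ 'd" and y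
    proof -
      have "\<bar>heat_kernel \<epsilon> z * cos y\<bar> \<le> heat_kernel \<epsilon> z" by (simp add: abs_mult heat_kernel_nonneg mult_left_le)
      also have "\<dots> \<le> B" unfolding B_def by (rule heat_kernel_le_0 [OF assms])
      finally show ?thesis .
    qed
    then show "\<bar>heat_kernel \<epsilon> (increment (fst (fst (p, \<omega>))) (snd (fst (p, \<omega>))) (snd (p, \<omega>)) - u) *
        cos (lin I \<kappa> (snd (p, \<omega>)) + b)\<bar> \<le> B" .
  qed measurable
  have rho: "rho2_approx u \<epsilon> \<omega> = (\<integral>p. indicator time_pairs p * heat_kernel \<epsilon> (increment (fst p) (snd p) \<omega> - u) \<partial>lborel)" for \<omega>
    unfolding rho2_approx_def set_lebesgue_integral_def time_pairs_def increment_def by (simp add: case_prod_beta)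
  have "(\<integral>\<omega>. rho2_approx u \<epsilon> \<omega> * cos (lin I \<kappa> \<omega> + b) \<partial>\<mu>) = (\<integral>\<omega>. \<integral>p. ?f (p, \<omega>) \<partial>lborel \<partial>\<mu>)"
    unfolding rho by (simp only: integral_mult_left_zero [symmetric] mult.assoc fst_conv snd_conv)
  also have "\<dots> = (\<integral>p. \<integral>\<omega>. ?f (p, \<omega>) \<partial>\<mu> \<partial>lborel)"
  proof (rule Q.Fubini_integral)
    show "integrable (lborel \<Otimes>\<^sub>M \<mu>) (\<lambda>(p, \<omega>). ?f (p, \<omega>))"
      using int unfolding case_prod_beta prod.collapse .
  qed
  finally show ?thesis by simp
qed

text \<open>Dominated convergence over the times: with the cosine bounded by 1, the inner integral
  is at most the heat kernel at u and time \<epsilon> + t - s, which stays below a constant since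
  \<open>u \<noteq> 0\<close>.\<close>

lemma integral_rho2_approx_cos_tendsto:
  fixes \<kappa> :: "real \<times> 'd \<Rightarrow> real"
  assumes u: "u \<noteq> 0" and I: "finite I" "fst ` I \<subseteq> {0..1}" and e: "\<And>n. e n > 0" "e \<longlonglongrightarrow> 0"
  shows "(\<lambda>n. \<integral>\<omega>. rho2_approx u (e n) \<omega> * cos (lin I \<kappa> \<omega> + b) \<partial>\<mu>) \<longlonglongrightarrow> (\<integral>\<omega>. cos (lin I \<kappa> \<omega> + b) \<partial>pinned u)"
  unfolding integral_rho2_approx_cos [OF e(1)] integral_cos_pinned [OF u]
proof -
  interpret Q: pair_sigma_finite lborel \<mu> by unfold_locales
  obtain C where C: "\<And>\<epsilon>. \<epsilon> > 0 \<Longrightarrow> heat_kernel \<epsilon> u \<le> C" "C \<ge> 0" using heat_kernel_bounded [OF u] by blast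
  let ?J = "\<lambda>n p. \<integral>\<omega>. heat_kernel (e n) (increment (fst p) (snd p) \<omega> - u) * cos (lin I \<kappa> \<omega> + b) \<partial>\<mu>"
  let ?L = "\<lambda>p. heat_kernel (snd p - fst p) u * (\<integral>\<omega>. cos (lin I \<kappa> (bridge (fst p) (snd p) u \<omega>) + b) \<partial>\<mu>)"
  have "(\<lambda>x. indicator time_pairs x :: real) \<in> borel_measurable lborel" using time_pairs_sets by simp
  moreover have "?J n \<in> borel_measurable lborel" for n
  proof -
    have "(\<lambda>x :: (real \<times> real) \<times> 'd wiener. heat_kernel (e n) (increment (fst (fst x)) (snd (fst x)) (snd x) - u) * cos (lin I \<kappa> (snd x) + b))
        \<in> borel_measurable (lborel \<Otimes>\<^sub>M \<mu>)" by measurable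
    then show ?thesis using borel_measurable_lebesgue_integral [of "\<lambda>p \<omega>. heat_kernel (e n) (increment (fst p) (snd p) \<omega> - u) * cos (lin I \<kappa> \<omega> + b)" lborel]
      by (simp add: case_prod_beta)
  qed
  moreover have "?L \<in> borel_measurable lborel"
  proof -
    have "(\<lambda>x :: (real \<times> real) \<times> 'd wiener. heat_kernel (snd (fst x) - fst (fst x)) u * cos (lin I \<kappa> (bridge (fst (fst x)) (snd (fst x)) u (snd x)) + b))
        \<in> borel_measurable (lborel \<Otimes>\<^sub>M \<mu>)" by measurable
    then show ?thesis using borel_measurable_lebesgue_integral [of "\<lambda>p \<omega>. heat_kernel (snd p - fst p) u * cos (lin I \<kappa> (bridge (fst p) (snd p) u \<omega>) + b)" lborel]
      by (simp add: case_prod_beta)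
  qed
  ultimately have meas: "(\<lambda>p. indicator time_pairs p * ?J n p) \<in> borel_measurable lborel"
    "(\<lambda>p. indicator time_pairs p * ?L p) \<in> borel_measurable lborel" for n by simp_all
  show "(\<lambda>n. \<integral>p. indicator time_pairs p * ?J n p \<partial>lborel) \<longlonglongrightarrow> (\<integral>p. indicator time_pairs p * ?L p \<partial>lborel)"
  proof (rule integral_dominated_convergence [where w = "\<lambda>p. indicator time_pairs p * C"])
    show "integrable lborel (\<lambda>p. indicator time_pairs p * C)"
      using time_pairs_sets emeasure_time_pairs by (intro integrable_mult_left integrable_real_indicator) auto
    show "AE p in lborel. (\<lambda>n. indicator time_pairs p * ?J n p) \<longlonglongrightarrow> indicator time_pairs p * ?L p"
    proof (rule AE_I2)
      fix p
      show "(\<lambda>n. indicator time_pairs p * ?J n p) \<longlonglongrightarrow> indicator time_pairs p * ?L p"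
      proof (cases "p \<in> time_pairs")
        case True
        then have "0 \<le> fst p" "fst p < snd p" "snd p \<le> 1" by (auto simp: time_pairs_def)
        from heat_kernel_cos_tendsto [OF this I e] show ?thesis by (intro tendsto_mult tendsto_const)
      qed simp
    qed
    show "AE p in lborel. norm (indicator time_pairs p * ?J n p) \<le> indicator time_pairs p * C" for n
    proof (rule AE_I2)
      fix p
      show "norm (indicator time_pairs p * ?J n p) \<le> indicator time_pairs p * C"
      proof (cases "p \<in> time_pairs")
        case True
        then have st: "0 \<le> fst p" "fst p < snd p" "snd p \<le> 1" by (auto simp: time_pairs_def)
        have int: "integrable \<mu> (\<lambda>\<omega>. heat_kernel (e n) (increment (fst p) (snd p) \<omega> - u))"
        proof (rule integrable_const_bound)
          show "AE \<omega> in \<mu>. norm (heat_kernel (e n) (increment (fst p) (snd p) \<omega> - u)) \<le> (2 * pi * e n) powr (- real CARD('d) / 2)"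
            unfolding real_norm_def abs_of_nonneg [OF heat_kernel_nonneg] by (intro AE_I2 heat_kernel_le_0 e)
        qed measurable
        have "norm (?J n p) \<le> (\<integral>\<omega>. heat_kernel (e n) (increment (fst p) (snd p) \<omega> - u) \<partial>\<mu>)"
        proof (rule order_trans [OF integral_norm_bound integral_mono'])
          show "norm (heat_kernel (e n) (increment (fst p) (snd p) \<omega> - u) * cos (lin I \<kappa> \<omega> + b))
              \<le> heat_kernel (e n) (increment (fst p) (snd p) \<omega> - u)" for \<omega>
            by (simp add: abs_mult heat_kernel_nonneg mult_left_le)
        qed (use int heat_kernel_nonneg in auto)
        also have "\<dots> = heat_kernel (e n + (snd p - fst p)) u"
          by (rule heat_kernel_increment(1) [OF st e])
        also have "\<dots> \<le> C" using st e(1) [of n] by (intro C) auto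
        finally show ?thesis using True by simp
      qed simp
    qed
  qed (use meas in auto)
qed

text \<open>The expectations of \<open>rho2_approx\<close> against a cosine have two limits to
  compare: the pairing with \<rho>, which is the integral against \<theta>, and the integral against
  \<open>pinned u\<close>.\<close>

lemma represents_rho2_eq_pinned:
  assumes u: "u \<noteq> 0" and \<rho>: "is_rho2 \<mu> u \<rho>" and \<theta>: "represents \<mu> \<rho> \<theta>"
  shows "\<theta> = pinned u"
proof (rule wiener_measure_eqI)
  show "finite_measure \<theta>" "sets \<theta> = sets borel" using \<theta> by (auto simp: represents_def)
  show "finite_measure (pinned u)" by (rule finite_measure_pinned [OF u])
  fix I :: "(real \<times> 'd) set" and \<kappa> b assume I: "finite I" "fst ` I \<subseteq> dyadics"
  then obtain N where N: "\<And>n. n \<ge> N \<Longrightarrow> fst ` I \<subseteq> dyad n ` {..2 ^ n}"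
    using dyadics_level [of "fst ` I"] by auto
  interpret F: dyadic_functional \<mu> I \<kappa> N by unfold_locales (rule N)
  let ?F = "\<lambda>\<omega>. cos (lin I \<kappa> \<omega> + b)"
  obtain \<Psi> where \<Psi>: "\<And>\<epsilon>. \<epsilon> > 0 \<Longrightarrow> has_chaos_expansion \<mu> (rho2_approx u \<epsilon>) (\<Psi> \<epsilon>)"
    and lim: "\<And>\<gamma>. \<gamma> < (4 - real CARD('d)) / 2 \<Longrightarrow> D2_tendsto \<mu> \<gamma> \<Psi> \<rho> (at_right 0)"
    using \<rho> unfolding is_rho2_def by blast
  define e where "e n = 1 / real (Suc n)" for n
  have e: "\<And>n. e n > 0" "e \<longlonglongrightarrow> 0"
    unfolding e_def using LIMSEQ_inverse_real_of_nat by (auto simp: inverse_eq_divide)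
  then have e0: "filterlim e (at_right 0) sequentially"
    by (intro tendsto_imp_filterlim_at_right) (auto intro: always_eventually)
  \<comment> \<open>The order - d lies below (4 - d) / 2 because d > - 4, and the expansion of the
    cosine belongs to the dual space of order d.\<close>
  have "D2_tendsto \<mu> (- real CARD('d)) \<Psi> \<rho> (at_right 0)" by (rule lim) (simp add: field_simps)
  moreover have "F.expansion b \<in> D2 \<mu> (real CARD('d))"
    using F.expansion_D2_plus_inf unfolding D2_plus_inf_def by auto
  ultimately have "((\<lambda>\<epsilon>. D2_pairing \<mu> (\<Psi> \<epsilon>) (F.expansion b)) \<longlongrightarrow> D2_pairing \<mu> \<rho> (F.expansion b)) (at_right 0)"
    by (rule D2_pairing_tendsto)
  from filterlim_compose [OF this e0]
  have "(\<lambda>n. D2_pairing \<mu> (\<Psi> (e n)) (F.expansion b)) \<longlonglongrightarrow> D2_pairing \<mu> \<rho> (F.expansion b)" .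
  moreover have "D2_pairing \<mu> (\<Psi> (e n)) (F.expansion b) = (\<integral>\<omega>. rho2_approx u (e n) \<omega> * ?F \<omega> \<partial>\<mu>)" for n
    by (rule D2_pairing_eq_integral [OF \<Psi> [OF e(1)] F.has_chaos_expansion_cos])
  ultimately have "(\<lambda>n. \<integral>\<omega>. rho2_approx u (e n) \<omega> * ?F \<omega> \<partial>\<mu>) \<longlonglongrightarrow> D2_pairing \<mu> \<rho> (F.expansion b)"
    by simp
  moreover have "(\<lambda>n. \<integral>\<omega>. rho2_approx u (e n) \<omega> * ?F \<omega> \<partial>\<mu>) \<longlonglongrightarrow> (\<integral>\<omega>. ?F \<omega> \<partial>pinned u)"
    using I dyadics_subset by (intro integral_rho2_approx_cos_tendsto [OF u _ _ e]) auto
  ultimately have "D2_pairing \<mu> \<rho> (F.expansion b) = (\<integral>\<omega>. ?F \<omega> \<partial>pinned u)"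
    by (rule LIMSEQ_unique)
  moreover have "quasi_continuous_version \<mu> ?F ?F"
    by (intro quasi_continuous_version_continuous continuous_intros continuous_on_lin)
  then have "D2_pairing \<mu> \<rho> (F.expansion b) = (\<integral>\<omega>. ?F \<omega> \<partial>\<theta>)"
    using \<theta> F.has_chaos_expansion_cos F.expansion_D2_plus_inf unfolding represents_def by blast
  ultimately show "(\<integral>\<omega>. ?F \<omega> \<partial>\<theta>) = (\<integral>\<omega>. ?F \<omega> \<partial>pinned u)" by simp
qed simp

end

theorem theorem5:
  fixes u :: "real ^ ('d::finite)"
  assumes "CARD('d) \<ge> 4" and "u \<noteq> 0"
  shows "closed (E_set u) \<and>
    (\<forall>\<mu> \<rho> \<theta>. wiener_measure \<mu> \<and> is_rho2 \<mu> u \<rho> \<and> represents \<mu> \<rho> \<theta> \<longrightarrow>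
      measure_support \<theta> \<subseteq> E_set u)"
proof (intro conjI allI impI, rule closed_E_set [OF assms(2)], elim conjE)
  fix \<mu> \<theta> :: "'d wiener measure" and \<rho>
  assume \<mu>: "wiener_measure \<mu>" and \<rho>: "is_rho2 \<mu> u \<rho>" and \<theta>: "represents \<mu> \<rho> \<theta>"
  interpret wiener_process \<mu> by unfold_locales (rule \<mu>)
  have "\<theta> = pinned u" by (rule represents_rho2_eq_pinned [OF assms(2) \<rho> \<theta>])
  then have "sets \<theta> = sets borel" "emeasure \<theta> (- E_set u) = 0"
    using pinned_E_set [OF assms(2)] by simp_all
  then show "measure_support \<theta> \<subseteq> E_set u"
    by (intro measure_support_smallest(3) closed_E_set [OF assms(2)])
qed

end
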